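(* For every $\ell\ge 2$ and $r\ge 3$ there exist $\epsilon,K>0$ such that the following holds for all sufficiently large $n$ and every $t\ge K(\log n)^{r-2}$. Given an $r$-graph $H$ with $n$ vertices and $tn^{1+1/\ell}$ edges, there exists a collection $\mathcal{C}$ of at most $$\exp\left(\frac{(\log n)^{r-1}}{\epsilon}\max\left\{\left(\frac{t}{(\log n)^{r-2}}\right)^{-\frac{2\ell-2}{2(r-1)\ell^2-(r+2)\ell+2}}n^{1+1/\ell},\ n^{1+\frac{1}{2\ell-1}}\right\}\right)$$ subgraphs of $H$ such that (a) every $\mathcal{B}^r_{2\ell}$-free subgraph of $H$ is a subgraph of some $G\in\mathcal{C}$; (b) $e(G)\le\left(1-\frac{\epsilon}{(\log n)^{r-2}}\right)tn^{1+1/\ell}$ for each $G\in\mathcal{C}$.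
   Context: An $r$-graph is an $r$-uniform hypergraph; $e(G)$ is the number of edges. For $k\ge2$, $\mathcal{B}^r_k$ is the family of $r$-graphs with $k$ distinct edges $e_1,\dots,e_k$ for which there are $k$ distinct vertices $v_1,\dots,v_k$ with $v_{i-1},v_i\in e_i$ ($1\le i\le k$, $v_0=v_k$). $\mathcal{B}^r_{2\ell}$-free means containing no member of $\mathcal{B}^r_{2\ell}$ as a subgraph. *)

theory Defs
  imports Complex_Main
begin

datatype 'a hypergraph = Hypergraph (verts: "'a set") (edges: "'a set set")

definition r_graph :: "nat \<Rightarrow> 'a hypergraph \<Rightarrow> bool" where
  "r_graph r H \<longleftrightarrow> finite (verts H) \<and> (\<forall>e \<in> edges H. e \<subseteq> verts H \<and> card e = r)"

definition num_edges :: "'a hypergraph \<Rightarrow> nat" where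
  "num_edges H = card (edges H)"

definition subgraph :: "nat \<Rightarrow> 'a hypergraph \<Rightarrow> 'a hypergraph \<Rightarrow> bool" where
  "subgraph r G H \<longleftrightarrow>
     r_graph r G \<and> r_graph r H \<and> verts G \<subseteq> verts H \<and> edges G \<subseteq> edges H"

(* The members have exactly k edges. The family is closed under isomorphism, so containing a
   copy of a member is the same as having a member as a literal subgraph. *)
definition berge_cycles :: "nat \<Rightarrow> nat \<Rightarrow> 'a hypergraph set" where
  "berge_cycles r k = {B. r_graph r B \<and>
     (\<exists>(e :: nat \<Rightarrow> 'a set) (v :: nat \<Rightarrow> 'a).
        inj_on e {1..k} \<and> edges B = e ` {1..k} \<and>
        inj_on v {1..k} \<and> v 0 = v k \<and>
        (\<forall>i \<in> {1..k}. v (i - 1) \<in> e i \<and> v i \<in> e i))}"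

definition berge_free :: "nat \<Rightarrow> nat \<Rightarrow> 'a hypergraph \<Rightarrow> bool" where
  "berge_free r k G \<longleftrightarrow> \<not> (\<exists>B \<in> berge_cycles r k. subgraph r B G)"

end

theory Submission
  imports Defs "HOL-Library.FuncSet" "HOL-Analysis.Convex"
begin

text \<open>
  By the hypergraph container lemma it suffices to find, inside \<open>H\<close>, many Berge \<open>2\<ell>\<close>-cycles that are
  evenly spread over their sets of edges. A maximal evenly spread collection is large as soon as
  every family of forbidden sets of edges which is sparse at the scale \<open>p\<close> can be avoided by some
  Berge \<open>2\<ell>\<close>-cycle. The latter is decided by the codegrees of pairs of vertices, at the threshold
  \<open>D = t\<^sup>x\<close> for which the two cases below balance.

  If many edges can be charged to pairs with at most \<open>D\<close> charges each, choose a random set of vertices,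
  and one edge at random for each pair of vertices. In the resulting sparse graph few forbidden sets
  survive, because a proper subset of a cycle is a forest; after deleting them, the graph still has
  large minimum degree somewhere, and hence many \<open>2\<ell>\<close>-cycles. These are counted through the closed
  walks of the matrix with entries \<open>1 / sqrt (max (d x) (d y))\<close>, for which walks with a repeated
  vertex are negligible however irregular the degrees are.

  Otherwise some subhypergraph has all codegrees above \<open>D\<close>. Then there are vertex sets \<open>Z\<close> whose links
  contain systems of triples in which every pair has many well spread extensions. In a random set of
  vertices, even after the forbidden sets are destroyed, some triples remain among which every pair
  still has many extensions, and a cycle is grown by inserting vertices.

  All constants are independent of \<open>n\<close>, so that no power of \<open>log n\<close> is lost on the way; the powers
  in the statement are only used to absorb the factor \<open>log n\<close> coming from the number of containers.
\<close>

section \<open>Containers\<close>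

text \<open>Write \<open>s = 1 / p\<close>. In a random vertex set of density \<open>q\<close>,
  surviving forbidden \<open>j\<close>-sets with \<open>j < 2 * l\<close> amount to a fraction of
  about \<open>\<delta> * (s * q / D) ^ (j - 1)\<close> of what survives of the hypergraph, so
  \<open>s\<close> may grow up to \<open>D / q\<close>. In the light regime \<open>q\<close> can be
  as small as \<open>1 / b\<close> with \<open>b ^ (l - 1) = (t / D) ^ l\<close>: the average degree
  of the sampled graph must reach the order of the \<open>l\<close>-th root of its number of
  vertices. In the heavy regime \<open>q\<close> can be \<open>1 / m\<close> with
  \<open>m ^ (r - 2) = D\<close>, since \<open>m\<close> measures the guaranteed branching. Full
  sets, \<open>j = 2 * l\<close>, behave differently, because a whole cycle spans only as many
  vertices as it has edges. In the heavy regime they require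
  \<open>s ^ (2 * l - 1) \<le> D ^ (2 * l - 1) * m ^ (2 * l - 2)\<close>; equating this with the
  light bound \<open>s \<le> D * b\<close> means \<open>b ^ (2 * l - 1) = m ^ (2 * l - 2)\<close>,
  which determines \<open>D\<close> and the exponent in the theorem. In the light regime they
  require \<open>s \<le> t * n powr y\<close>, which gives the second term of the maximum.\<close>

lemma sum_card_swap:
  assumes "finite A" "finite B"
  shows "(\<Sum>a\<in>A. card {b\<in>B. R a b}) = (\<Sum>b\<in>B. card {a\<in>A. R a b})"
  using sum.swap_restrict[OF assms, of "\<lambda>_ _. 1::nat" R] by simp

definition deg :: "'b set set \<Rightarrow> 'b set \<Rightarrow> nat" where
  "deg G T = card {E\<in>G. T \<subseteq> E}"

definition indep :: "'b set set \<Rightarrow> 'b set \<Rightarrow> bool" where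
  "indep G I \<longleftrightarrow> (\<forall>E\<in>G. \<not> E \<subseteq> I)"

definition uniform :: "'b set \<Rightarrow> nat \<Rightarrow> 'b set set \<Rightarrow> bool" where
  "uniform V k G \<longleftrightarrow> G \<subseteq> {E. E \<subseteq> V \<and> card E = k}"

lemma uniform_finite: "uniform V k G \<Longrightarrow> finite V \<Longrightarrow> finite G"
  unfolding uniform_def by (rule finite_subset[of _ "Pow V"]) auto

lemma sum_deg:
  assumes "finite V" "uniform V k G"
  shows "(\<Sum>T\<in>Pow V. deg G T) = card G * 2 ^ k"
proof -
  have fin: "finite G" using assms uniform_finite by blast
  have "(\<Sum>T\<in>Pow V. deg G T) = (\<Sum>E\<in>G. card {T\<in>Pow V. T \<subseteq> E})"
    unfolding deg_def using assms fin by (intro sum_card_swap) auto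
  also have "\<dots> = (\<Sum>E\<in>G. 2 ^ k)"
  proof (rule sum.cong[OF refl])
    fix E assume "E \<in> G"
    with assms have E: "E \<subseteq> V" "card E = k" by (auto simp: uniform_def)
    then have "{T\<in>Pow V. T \<subseteq> E} = Pow E" by auto
    then show "card {T\<in>Pow V. T \<subseteq> E} = 2 ^ k"
      using E assms by (simp add: card_Pow finite_subset)
  qed
  finally show ?thesis by simp
qed

text \<open>The threshold is the degree permitted by \<open>spread\<close> with
  \<open>M = 1\<close>. For a \<open>k\<close>-set it equals 1, so every edge of \<open>G\<close> is
  itself saturated; this is what keeps repeated edges out.\<close>

definition saturated :: "real \<Rightarrow> nat \<Rightarrow> 'b set set \<Rightarrow> 'b set \<Rightarrow> bool" where
  "saturated p k G T \<longleftrightarrow> T \<noteq> {} \<and> card T \<le> k \<and> real (deg G T) \<ge> (1 / p) ^ (k - card T)"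

text \<open>The degree condition of container lemmas. With about
  \<open>card V * (1 / p) ^ (k - 1)\<close> edges the average degree of a vertex has order
  \<open>(1 / p) ^ (k - 1)\<close>, and each further vertex of \<open>T\<close> lowers the bound by
  a factor \<open>p\<close>.\<close>

definition spread :: "'b set \<Rightarrow> real \<Rightarrow> nat \<Rightarrow> real \<Rightarrow> 'b set set \<Rightarrow> bool" where
  "spread V p k M G \<longleftrightarrow>
     (\<forall>T. T \<noteq> {} \<longrightarrow> T \<subseteq> V \<longrightarrow> card T \<le> k \<longrightarrow> real (deg G T) \<le> M * (1 / p) ^ (k - card T))"

text \<open>The edges whose links may still be added to \<open>G\<close>: their vertices are all
  unqueried, and none of their subsets is so full that another link through it could break the
  degree condition.\<close>

definition available :: "real \<Rightarrow> nat \<Rightarrow> 'b set set \<Rightarrow> 'b set \<Rightarrow> 'b set set \<Rightarrow> 'b set set" where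
  "available p k H W G = {E\<in>H. E \<subseteq> W \<and> (\<forall>T. T \<subseteq> E \<longrightarrow> \<not> saturated p k G T)}"

lemma card_available:
  assumes fin: "finite V" and HV: "uniform V (Suc k) H" and GV: "uniform V k G"
    and p: "0 < p" "p \<le> 1" and M: "M \<ge> 0" and sp: "spread V p (Suc k) M H" and W: "W \<subseteq> V"
  shows "real (card H) \<le> real (card (available p k H W G))
           + real (card (V - W)) * M * (1 / p) ^ k + M * 2 ^ k / p * real (card G)"
proof -
  let ?A = "available p k H W G" and ?S = "{T\<in>Pow V. saturated p k G T}"
  have finH: "finite H" using HV fin uniform_finite by blast
  have "H \<subseteq> ?A \<union> ((\<Union>v\<in>V - W. {E\<in>H. {v} \<subseteq> E}) \<union> (\<Union>T\<in>?S. {E\<in>H. T \<subseteq> E}))"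
    using HV by (fastforce simp: available_def uniform_def)
  then have "card H \<le> card (?A \<union> ((\<Union>v\<in>V - W. {E\<in>H. {v} \<subseteq> E}) \<union> (\<Union>T\<in>?S. {E\<in>H. T \<subseteq> E})))"
    by (rule card_mono[rotated]) (use finH fin in \<open>auto simp: available_def\<close>)
  also have "\<dots> \<le> card ?A + (card (\<Union>v\<in>V - W. {E\<in>H. {v} \<subseteq> E}) + card (\<Union>T\<in>?S. {E\<in>H. T \<subseteq> E}))"
    by (meson card_Un_le add_left_mono order_trans)
  also have "\<dots> \<le> card ?A + ((\<Sum>v\<in>V - W. deg H {v}) + (\<Sum>T\<in>?S. deg H T))"
    unfolding deg_def by (intro add_mono order_refl card_UN_le) (use fin in auto)
  finally have 1: "real (card H) \<le> real (card ?A) + (\<Sum>v\<in>V - W. real (deg H {v})) + (\<Sum>T\<in>?S. real (deg H T))"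
    by (simp flip: of_nat_sum of_nat_add)
  have 2: "(\<Sum>v\<in>V - W. real (deg H {v})) \<le> real (card (V - W)) * (M * (1 / p) ^ k)"
    using sp by (intro sum_bounded_above) (auto simp: spread_def)
  have "(\<Sum>T\<in>?S. real (deg H T)) \<le> (\<Sum>T\<in>?S. M / p * real (deg G T))"
  proof (rule sum_mono)
    fix T assume T: "T \<in> ?S"
    then have c: "card T \<le> k" and d: "(1 / p) ^ (k - card T) \<le> real (deg G T)"
      by (auto simp: saturated_def)
    have "real (deg H T) \<le> M * (1 / p) ^ (Suc k - card T)"
      using sp T by (auto simp: spread_def saturated_def)
    also have "\<dots> = M / p * (1 / p) ^ (k - card T)" using c by (simp add: Suc_diff_le)
    also have "\<dots> \<le> M / p * real (deg G T)" using d M p by (intro mult_left_mono) auto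
    finally show "real (deg H T) \<le> M / p * real (deg G T)" .
  qed
  also have "\<dots> \<le> (\<Sum>T\<in>Pow V. M / p * real (deg G T))"
    using fin M p by (intro sum_mono2) auto
  also have "\<dots> = M / p * real (\<Sum>T\<in>Pow V. deg G T)" by (simp add: sum_distrib_left)
  also have "\<dots> = M * 2 ^ k / p * real (card G)" by (simp add: sum_deg[OF fin GV])
  finally show ?thesis using 1 2 by (simp add: mult.assoc)
qed

text \<open>Only sets \<open>T\<close> inside available edges gain degree, and these are
  unsaturated: the old part is at most \<open>(1 / p) ^ (k - card T)\<close>, the new part at most
  the degree of \<open>insert v T\<close> in \<open>H\<close>. The sum stays within the factor
  \<open>2 * M\<close>, however many links are added one after the other.\<close>

lemma spread_add_link:
  assumes fin: "finite V" and HV: "uniform V (Suc k) H" and GV: "uniform V k G"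
    and p: "0 < p" "p \<le> 1" and M: "M \<ge> 1" and sp: "spread V p (Suc k) M H"
    and spG: "spread V p k (2 * M) G" and W: "W \<subseteq> V" and v: "v \<in> W" and k: "k \<ge> 1"
  defines "L \<equiv> (\<lambda>E. E - {v}) ` {E \<in> available p k H W G. v \<in> E}"
  shows "spread V p k (2 * M) (G \<union> L)" and "uniform V k (G \<union> L)"
    and "card (G \<union> L) = card G + deg (available p k H W G) {v}"
proof -
  let ?A = "available p k H W G"
  have finH: "finite H" and finG: "finite G" using HV GV fin uniform_finite by blast+
  have finA: "finite ?A" using finH by (simp add: available_def)
  have AH: "?A \<subseteq> H" by (auto simp: available_def)
  have finL: "finite L" using finA by (simp add: L_def)
  have finE: "finite E" if "E \<in> H" for E using that HV fin by (auto simp: uniform_def intro: finite_subset)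
  have "card (E - {v}) = k \<and> E - {v} \<subseteq> V" if "E \<in> H" "v \<in> E" for E
  proof -
    have "card E = Suc k" "E \<subseteq> V" using that HV by (auto simp: uniform_def)
    then show ?thesis using that(2) card_Diff_singleton[of v E] by auto
  qed
  then have "L \<subseteq> {E. E \<subseteq> V \<and> card E = k}" using AH unfolding L_def by blast
  then show unif: "uniform V k (G \<union> L)" using GV unfolding uniform_def by blast
  have inj: "inj_on (\<lambda>E. E - {v}) {E \<in> ?A. v \<in> E}" by (auto simp: inj_on_def)
  \<comment> \<open>A link already present in \<open>G\<close> would be saturated, the threshold for
    a \<open>k\<close>-set being 1, and its edge would not be available. Hence the sizes add up
    exactly.\<close>
  have disj: "G \<inter> L = {}"
  proof (rule ccontr)
    assume "G \<inter> L \<noteq> {}"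
    then obtain E where E: "E \<in> ?A" "v \<in> E" "E - {v} \<in> G" by (auto simp: L_def)
    have c: "card (E - {v}) = k" using E(3) GV by (auto simp: uniform_def)
    then have "E - {v} \<noteq> {}" using k by (metis card.empty not_one_le_zero)
    moreover have "deg G (E - {v}) \<ge> 1"
    proof -
      have "card {E - {v}} \<le> deg G (E - {v})" unfolding deg_def
        by (rule card_mono) (use E finG in auto)
      then show ?thesis by simp
    qed
    ultimately have "saturated p k G (E - {v})" using c by (simp add: saturated_def)
    then show False using E by (auto simp: available_def)
  qed
  show "card (G \<union> L) = card G + deg ?A {v}"
    using card_Un_disjoint[OF finG finL disj] card_image[OF inj] by (simp add: L_def deg_def)
  show "spread V p k (2 * M) (G \<union> L)"
    unfolding spread_def
  proof (intro allI impI)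
    fix T assume T: "T \<noteq> {}" "T \<subseteq> V" "card T \<le> k"
    have finT: "finite T" using T fin finite_subset by blast
    have "{E \<in> G \<union> L. T \<subseteq> E} = {E\<in>G. T \<subseteq> E} \<union> {E\<in>L. T \<subseteq> E}" by auto
    then have le: "deg (G \<union> L) T \<le> deg G T + deg L T"
      unfolding deg_def by (metis card_Un_le)
    show "real (deg (G \<union> L) T) \<le> 2 * M * (1 / p) ^ (k - card T)"
    proof (cases "deg L T = 0")
      case True
      have "real (deg G T) \<le> 2 * M * (1 / p) ^ (k - card T)"
        using spG T by (simp add: spread_def)
      then show ?thesis using le True by linarith
    next
      case False
      then have "{E\<in>L. T \<subseteq> E} \<noteq> {}" unfolding deg_def by (metis card.empty)
      then obtain E where E: "E \<in> ?A" "v \<in> E" "T \<subseteq> E - {v}"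
        by (auto simp: L_def)
      then have vT: "v \<notin> T" by auto
      have "\<not> saturated p k G T" using E by (auto simp: available_def)
      then have a: "real (deg G T) \<le> (1 / p) ^ (k - card T)" using T by (auto simp: saturated_def)
      have "{E\<in>L. T \<subseteq> E} \<subseteq> (\<lambda>E. E - {v}) ` {E\<in>H. insert v T \<subseteq> E}"
        using AH by (auto simp: L_def)
      then have "deg L T \<le> deg H (insert v T)"
        unfolding deg_def using finH by (intro surj_card_le) auto
      also have "real (deg H (insert v T)) \<le> M * (1 / p) ^ (k - card T)"
      proof -
        have "insert v T \<subseteq> V" "card (insert v T) = Suc (card T)" using T W v vT finT by auto
        moreover have "insert v T \<noteq> {}" "card (insert v T) \<le> Suc k" using calculation T by auto
        ultimately show ?thesis using sp unfolding spread_def by (metis diff_Suc_Suc)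
      qed
      finally have b: "real (deg L T) \<le> M * (1 / p) ^ (k - card T)" by simp
      have "(1 / p) ^ (k - card T) \<le> M * (1 / p) ^ (k - card T)"
        using M p by (simp add: mult_le_cancel_right1)
      then show ?thesis using le a b by linarith
    qed
  qed
qed

lemma exists_large_degree:
  assumes fin: "finite W" and HV: "uniform W (Suc k) H" and large: "real (card H) \<ge> c * real (card W)" and W: "W \<noteq> {}"
  shows "\<exists>v\<in>W. real (deg H {v}) \<ge> c"
proof (rule ccontr)
  assume "\<not> ?thesis"
  then have "(\<Sum>v\<in>W. real (deg H {v})) < (\<Sum>v\<in>W. c)"
    using W fin by (intro sum_strict_mono) (auto simp: not_le)
  then have 1: "(\<Sum>v\<in>W. real (deg H {v})) < c * real (card W)" by (simp add: mult.commute)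
  have finH: "finite H" using HV fin uniform_finite by blast
  have "(\<Sum>v\<in>W. deg H {v}) = (\<Sum>E\<in>H. card {v\<in>W. {v} \<subseteq> E})"
    unfolding deg_def using fin finH by (rule sum_card_swap)
  also have "\<dots> = (\<Sum>E\<in>H. Suc k)"
  proof (rule sum.cong[OF refl])
    fix E assume "E \<in> H"
    then have "E \<subseteq> W" "card E = Suc k" using HV by (auto simp: uniform_def)
    moreover from \<open>E \<subseteq> W\<close> have "{v\<in>W. {v} \<subseteq> E} = E" by auto
    ultimately show "card {v\<in>W. {v} \<subseteq> E} = Suc k" by simp
  qed
  finally have "(\<Sum>v\<in>W. deg H {v}) = card H * Suc k" by simp
  then have "(\<Sum>v\<in>W. deg H {v}) \<ge> card H" by simp
  then have "real (card H) \<le> (\<Sum>v\<in>W. real (deg H {v}))" by (simp flip: of_nat_sum)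
  then show False using 1 large by linarith
qed

text \<open>The containers are the leaves of a decision tree that queries vertices for membership in \<open>I\<close>:
  \<open>W\<close> are the vertices not queried yet, \<open>X\<close> those outside \<open>I\<close>, \<open>G\<close> collects the links of those inside \<open>I\<close>,
  and \<open>b\<close> bounds the number of further positive answers.\<close>

definition has_leaves where
  "has_leaves V k p M H \<delta>' \<epsilon> W X G b \<longleftrightarrow>
    (\<exists>\<L>. finite \<L> \<and> card \<L> \<le> (card W + 1) ^ b \<and>
      (\<forall>(X', G')\<in>\<L>. X' \<subseteq> V \<and> uniform V k G' \<and> spread V p k ((2 * M :: real)) G' \<and>
         (real (card X') \<ge> \<epsilon> * real (card V) \<or> real (card G') \<ge> \<delta>' * real (card V) * (1 / p) ^ (k - 1))) \<and>
      (\<forall>I. indep H I \<longrightarrow> indep G I \<longrightarrow> I \<inter> X = {} \<longrightarrow> V - W - X \<subseteq> I \<longrightarrow>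
         (\<exists>(X', G')\<in>\<L>. I \<inter> X' = {} \<and> indep G' I)))"

lemma scythe:
  fixes V :: "'b set" and p M \<delta> \<delta>' \<epsilon> :: real
  assumes fin: "finite V" and HV: "uniform V (Suc k) H" and k: "k \<ge> 1"
    and p: "0 < p" "p \<le> 1" and M: "M \<ge> 1" and sp: "spread V p (Suc k) M H"
    and large: "real (card H) \<ge> \<delta> * real (card V) * (1 / p) ^ k"
    and pos: "\<delta> > 0" "\<delta>' > 0" "\<epsilon> > 0"
    and const: "(\<epsilon> + 2 * \<delta>' / \<delta>) * M + 2 ^ k * M * \<delta>' \<le> \<delta> / 2"
    and B: "real B > 2 * \<delta>' / \<delta> * p * real (card V)"
  shows "\<lbrakk>W \<subseteq> V; X \<subseteq> V - W; uniform V k G; spread V p k (2 * M) G;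
      real (card G) \<ge> real (card (V - W - X)) * (\<delta> / 2) * (1 / p) ^ k;
      card (V - W - X) + b \<ge> B\<rbrakk> \<Longrightarrow>
    has_leaves V k p M H \<delta>' \<epsilon> W X G b"
proof (induction "card W" arbitrary: W X G b rule: less_induct)
  case less
  note W = less.prems(1) and X = less.prems(2) and GV = less.prems(3) and spG = less.prems(4)
    and cG = less.prems(5) and b = less.prems(6)
  have finW: "finite W" using W fin finite_subset by blast
  show ?case
  proof (cases "real (card X) \<ge> \<epsilon> * real (card V) \<or> real (card G) \<ge> \<delta>' * real (card V) * (1 / p) ^ (k - 1)")
    case True
    show ?thesis unfolding has_leaves_def
      by (rule exI[of _ "{(X, G)}"]) (use True GV spG X in \<open>auto simp: uniform_def\<close>)
  next
    case False
    define N where "N = real (card V)"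
    define A where "A = available p k H W G"
    define y where "y = card (V - W - X)"
    have xX: "real (card X) < \<epsilon> * N" and gG: "real (card G) < \<delta>' * N * (1 / p) ^ (k - 1)"
      using False by (auto simp: N_def)
    have pk: "(1 / p) ^ k = (1 / p) ^ (k - 1) / p"
      using k by (metis divide_inverse inverse_eq_divide le_add_diff_inverse2 mult.commute power_Suc Suc_eq_plus1)
    have pkpos: "(1 / p) ^ k > 0" and pkpos': "(1/p)^(k-1) > 0" using p by simp_all
    have N0: "N > 0" using xX pos
      by (metis N_def mult_zero_right of_nat_0_le_iff less_eq_real_def linorder_not_less)
    \<comment> \<open>Each of the \<open>y\<close> positive answers so far has contributed its share
      to \<open>G\<close>, which is still small; so \<open>y < B\<close>, and another positive
      answer may be spent.\<close>
    have "real y * (\<delta> / 2) * (1 / p) ^ k < \<delta>' * N * (1 / p) ^ (k - 1)"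
      using cG gG by (simp add: y_def)
    then have "(real y * (\<delta> / 2) / p) * (1 / p) ^ (k - 1) < (\<delta>' * N) * (1 / p) ^ (k - 1)"
      unfolding pk by (simp add: mult.commute)
    then have "real y * (\<delta> / 2) / p < \<delta>' * N"
      using pkpos' mult_less_cancel_right_pos by blast
    then have ylt: "real y < 2 * \<delta>' / \<delta> * p * N" using pos p by (simp add: field_simps)
    then have "y < B" using B by (simp add: N_def)
    then have b1: "b \<ge> 1" using b y_def by linarith
    have "p * (2 * \<delta>' / \<delta> * N) \<le> 1 * (2 * \<delta>' / \<delta> * N)" using p pos N0 by (intro mult_right_mono) auto
    then have yN: "real y \<le> 2 * \<delta>' / \<delta> * N" using ylt by (simp add: mult_ac)
    have "card (V - W) \<le> card X + y"
    proof -
      have "V - W \<subseteq> X \<union> (V - W - X)" by auto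
      then have "card (V - W) \<le> card (X \<union> (V - W - X))"
        by (rule card_mono[rotated]) (use fin X in \<open>auto intro: finite_subset\<close>)
      also have "\<dots> \<le> card X + y" unfolding y_def by (rule card_Un_le)
      finally show ?thesis .
    qed
    then have cVW: "real (card (V - W)) \<le> (\<epsilon> + 2 * \<delta>' / \<delta>) * N"
      using xX yN by (simp add: distrib_right)
    have Abig: "real (card A) \<ge> (\<delta> / 2) * N * (1 / p) ^ k"
    proof -
      have 1: "real (card H) \<le> real (card A) + real (card (V - W)) * M * (1 / p) ^ k + M * 2 ^ k / p * real (card G)"
        unfolding A_def by (rule card_available[OF fin HV GV p _ sp W]) (use M in simp)
      have 2: "real (card (V - W)) * M * (1 / p) ^ k \<le> (\<epsilon> + 2 * \<delta>' / \<delta>) * N * M * (1 / p) ^ k"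
        using cVW M pkpos by (intro mult_right_mono) auto
      have "M * 2 ^ k / p * real (card G) \<le> M * 2 ^ k / p * (\<delta>' * N * (1 / p) ^ (k - 1))"
        using gG M p by (intro mult_left_mono) auto
      then have 3: "M * 2 ^ k / p * real (card G) \<le> 2 ^ k * M * \<delta>' * N * (1 / p) ^ k"
        unfolding pk by (simp add: mult_ac)
      have "((\<epsilon> + 2 * \<delta>' / \<delta>) * M + 2 ^ k * M * \<delta>') * (N * (1 / p) ^ k) \<le> \<delta> / 2 * (N * (1 / p) ^ k)"
        using const N0 pkpos by (intro mult_right_mono) auto
      then have "real (card (V - W)) * M * (1 / p) ^ k + M * 2 ^ k / p * real (card G) \<le> \<delta> / 2 * (N * (1 / p) ^ k)"
      proof -
        have "((\<epsilon> + 2 * \<delta>' / \<delta>) * M + 2 ^ k * M * \<delta>') * (N * (1 / p) ^ k)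
            = (\<epsilon> + 2 * \<delta>' / \<delta>) * N * M * (1 / p) ^ k + 2 ^ k * M * \<delta>' * N * (1 / p) ^ k"
          by (simp only: ring_distribs mult_ac)
        then show ?thesis using 2 3 \<open>_ \<le> \<delta> / 2 * (N * (1 / p) ^ k)\<close> by linarith
      qed
      moreover have "\<delta> * real (card V) * (1 / p) ^ k = \<delta> / 2 * (N * (1 / p) ^ k) + \<delta> / 2 * N * (1 / p) ^ k"
        unfolding N_def by (simp add: field_simps)
      ultimately show ?thesis using 1 large by linarith
    qed
    have WN: "real (card W) \<le> N" unfolding N_def using W fin by (simp add: card_mono)
    have "W \<noteq> {}"
    proof
      assume "W = {}"
      then have "A = {}" using HV unfolding A_def available_def uniform_def by auto
      then have "\<delta> / 2 * N * (1 / p) ^ k \<le> 0" using Abig by simp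
      moreover have "\<delta> / 2 * N * (1 / p) ^ k > 0" using pos N0 pkpos by simp
      ultimately show False by linarith
    qed
    moreover have "uniform W (Suc k) A" using HV by (auto simp: uniform_def A_def available_def)
    moreover have "real (card A) \<ge> (\<delta> / 2 * (1 / p) ^ k) * real (card W)"
    proof -
      have "(\<delta> / 2 * (1 / p) ^ k) * real (card W) \<le> (\<delta> / 2 * (1 / p) ^ k) * N"
        using WN pos pkpos by (intro mult_left_mono) auto
      then show ?thesis using Abig by (simp add: mult_ac)
    qed
    ultimately obtain v where v: "v \<in> W" "real (deg A {v}) \<ge> \<delta> / 2 * (1 / p) ^ k"
      using exists_large_degree[OF finW] by blast
    define L where "L = (\<lambda>E. E - {v}) ` {E \<in> A. v \<in> E}"
    note link = spread_add_link[OF fin HV GV p M sp spG W v(1) k, folded A_def, folded L_def]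
    have cW: "card (W - {v}) < card W" "card (W - {v}) + 1 = card W"
      using v(1) finW card_Diff1_less[of W v] card_Suc_Diff1[of W v] by auto
    have eq1: "V - (W - {v}) - insert v X = V - W - X" using v W by auto
    have eq2: "V - (W - {v}) - X = insert v (V - W - X)" using v W X by auto
    have c2: "card (V - (W - {v}) - X) = Suc y"
      unfolding eq2 y_def using fin v(1) by (subst card_insert_disjoint) auto
    have hl1: "has_leaves V k p M H \<delta>' \<epsilon> (W - {v}) (insert v X) G b"
      by (rule less.hyps) (use cW(1) W X v(1) GV spG cG b in \<open>auto simp: eq1\<close>)
    have "real (Suc y) * (\<delta> / 2) * (1 / p) ^ k \<le> real (card (G \<union> L))"
      unfolding link(3) using cG v(2) by (simp add: y_def[symmetric] algebra_simps)
    then have hl2: "has_leaves V k p M H \<delta>' \<epsilon> (W - {v}) X (G \<union> L) (b - 1)"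
      using b b1 W X v(1) by (intro less.hyps cW link(1,2)) (auto simp: c2 y_def[symmetric])
    obtain L1 where L1: "finite L1" "card L1 \<le> (card (W - {v}) + 1) ^ b"
      "\<forall>(X', G')\<in>L1. X' \<subseteq> V \<and> uniform V k G' \<and> spread V p k (2 * M) G' \<and>
         (real (card X') \<ge> \<epsilon> * real (card V) \<or> real (card G') \<ge> \<delta>' * real (card V) * (1 / p) ^ (k - 1))"
      "\<forall>I. indep H I \<longrightarrow> indep G I \<longrightarrow> I \<inter> insert v X = {} \<longrightarrow> V - W - X \<subseteq> I \<longrightarrow>
         (\<exists>(X', G')\<in>L1. I \<inter> X' = {} \<and> indep G' I)"
      using hl1 unfolding has_leaves_def eq1 by auto
    obtain L2 where L2: "finite L2" "card L2 \<le> (card (W - {v}) + 1) ^ (b - 1)"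
      "\<forall>(X', G')\<in>L2. X' \<subseteq> V \<and> uniform V k G' \<and> spread V p k (2 * M) G' \<and>
         (real (card X') \<ge> \<epsilon> * real (card V) \<or> real (card G') \<ge> \<delta>' * real (card V) * (1 / p) ^ (k - 1))"
      "\<forall>I. indep H I \<longrightarrow> indep (G \<union> L) I \<longrightarrow> I \<inter> X = {} \<longrightarrow> V - (W - {v}) - X \<subseteq> I \<longrightarrow>
         (\<exists>(X', G')\<in>L2. I \<inter> X' = {} \<and> indep G' I)"
      using hl2 unfolding has_leaves_def by auto
    show ?thesis unfolding has_leaves_def
    proof (intro exI[of _ "L1 \<union> L2"] conjI)
      show "finite (L1 \<union> L2)" using L1 L2 by simp
      \<comment> \<open>Both branches lose a vertex of \<open>W\<close>, but only the positive one
        uses up a unit of \<open>b\<close>;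
        \<open>w ^ b + w ^ (b - 1) = (w + 1) * w ^ (b - 1)\<close> closes the induction.\<close>
      have "card (L1 \<union> L2) \<le> card W ^ b + card W ^ (b - 1)"
        using card_Un_le[of L1 L2] L1(2) L2(2) cW(2) by simp
      also have "\<dots> = (card W + 1) * card W ^ (b - 1)"
        using b1 by (cases b) (auto simp: algebra_simps)
      also have "\<dots> \<le> (card W + 1) * (card W + 1) ^ (b - 1)"
        by (intro mult_left_mono power_mono) auto
      also have "\<dots> = (card W + 1) ^ b" using b1 by (cases b) auto
      finally show "card (L1 \<union> L2) \<le> (card W + 1) ^ b" .
      show "\<forall>(X', G')\<in>L1 \<union> L2. X' \<subseteq> V \<and> uniform V k G' \<and> spread V p k (2 * M) G' \<and>
         (real (card X') \<ge> \<epsilon> * real (card V) \<or> real (card G') \<ge> \<delta>' * real (card V) * (1 / p) ^ (k - 1))"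
        using L1(3) L2(3) by blast
      show "\<forall>I. indep H I \<longrightarrow> indep G I \<longrightarrow> I \<inter> X = {} \<longrightarrow> V - W - X \<subseteq> I \<longrightarrow>
         (\<exists>(X', G')\<in>L1 \<union> L2. I \<inter> X' = {} \<and> indep G' I)"
      proof (intro allI impI)
        fix I assume I: "indep H I" "indep G I" "I \<inter> X = {}" "V - W - X \<subseteq> I"
        show "\<exists>(X', G')\<in>L1 \<union> L2. I \<inter> X' = {} \<and> indep G' I"
        proof (cases "v \<in> I")
          case False
          then have "\<exists>(X', G')\<in>L1. I \<inter> X' = {} \<and> indep G' I"
            using I by (intro L1(4)[rule_format]) auto
          then show ?thesis by auto
        next
          case True
          have "indep L I"
            unfolding indep_def
          proof
            fix E' assume "E' \<in> L"
            then obtain E where "E \<in> A" "E' = E - {v}" "v \<in> E" by (auto simp: L_def)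
            moreover from \<open>E \<in> A\<close> have "E \<in> H" by (simp add: A_def available_def)
            ultimately show "\<not> E' \<subseteq> I" using True I(1) by (auto simp: indep_def)
          qed
          then have "indep (G \<union> L) I" using I(2) by (auto simp: indep_def)
          moreover have "V - (W - {v}) - X \<subseteq> I" using True I(4) eq2 by auto
          ultimately have "\<exists>(X', G')\<in>L2. I \<inter> X' = {} \<and> indep G' I"
            by (intro L2(4)[rule_format] I)
          then show ?thesis by auto
        qed
      qed
    qed
  qed
qed

text \<open>\<open>B\<close> bounds the number of positive answers along a branch, added up over the
  nested decision trees, and each of them costs a factor \<open>card V + 1\<close>. The additive 1
  pays for rounding when \<open>p * card V\<close> is small.\<close>

definition has_containers where
  "has_containers V H p \<epsilon> c \<longleftrightarrow> (\<exists>\<C> B. finite \<C> \<and> real B \<le> (c :: real) * (p * real (card V) + 1) \<and> card \<C> \<le> (card V + 1) ^ B \<and>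
          (\<forall>C\<in>\<C>. C \<subseteq> V \<and> real (card C) \<le> (1 - \<epsilon>) * real (card V)) \<and>
          (\<forall>I. I \<subseteq> V \<longrightarrow> indep H I \<longrightarrow> (\<exists>C\<in>\<C>. I \<subseteq> C)))"

text \<open>Induction on the uniformity. A leaf of the decision tree has either a large
  \<open>X\<close>, whose complement is a container, or a \<open>G\<close> of smaller uniformity
  that again has many edges and is spread with \<open>2 * M\<close>, so that the induction
  hypothesis applies to it. The constants depend neither on \<open>V\<close> nor on
  \<open>p\<close>.\<close>

lemma containers:
  assumes "k \<ge> 1"
  shows "\<delta> > 0 \<Longrightarrow> M \<ge> 1 \<Longrightarrow> \<exists>\<epsilon> c :: real. \<epsilon> > 0 \<and> c > 0 \<and>
    (\<forall>(V :: 'b set) H p. finite V \<longrightarrow> uniform V k H \<longrightarrow> 0 < p \<longrightarrow> p \<le> 1 \<longrightarrow> spread V p k M H \<longrightarrow>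
       real (card H) \<ge> \<delta> * real (card V) * (1 / p) ^ (k - 1) \<longrightarrow>
       has_containers V H p \<epsilon> c)"
  using assms
proof (induction k arbitrary: \<delta> M rule: nat_induct_at_least)
  case base
  show ?case
  proof (rule exI[of _ \<delta>], rule exI[of _ 1], intro conjI allI impI)
    fix V :: "'b set" and H p
    assume V: "finite V" "uniform V 1 H" and p: "0 < p" "p \<le> 1"
      and H: "\<delta> * real (card V) * (1 / p) ^ (1 - 1) \<le> real (card H)"
    \<comment> \<open>The independent sets of a 1-uniform hypergraph are those that avoid all its
      edges' vertices, so a single container suffices.\<close>
    have HU: "H = (\<lambda>v. {v}) ` \<Union>H"
      using V(2) by (auto simp: uniform_def card_1_singleton_iff image_iff) fastforce+
    have sub: "\<Union>H \<subseteq> V" using V(2) by (auto simp: uniform_def)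
    have "card H = card (\<Union>H)" by (subst HU, rule card_image) auto
    moreover have "card (V - \<Union>H) = card V - card (\<Union>H)"
      by (rule card_Diff_subset) (use sub V finite_subset in auto)
    moreover have "card (\<Union>H) \<le> card V" using sub V by (simp add: card_mono)
    ultimately have "real (card (V - \<Union>H)) \<le> (1 - \<delta>) * real (card V)"
      using H by (simp add: of_nat_diff left_diff_distrib)
    moreover have "I \<subseteq> V - \<Union>H" if "I \<subseteq> V" "indep H I" for I
    proof -
      have "\<not> {v} \<subseteq> I" if "v \<in> \<Union>H" for v using \<open>indep H I\<close> HU that unfolding indep_def by blast
      then show ?thesis using \<open>I \<subseteq> V\<close> by auto
    qed
    ultimately show "has_containers V H p \<delta> 1"
      using p unfolding has_containers_def by (intro exI[of _ "{V - \<Union>H}"] exI[of _ 0]) auto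
  qed (use base in auto)
next
  case (Suc k)
  note \<delta> = \<open>\<delta> > 0\<close> and M = \<open>M \<ge> 1\<close>
  \<comment> \<open>Chosen so that the two terms of \<open>const\<close> with
    \<open>\<delta>'\<close> add up to \<open>\<delta> / 4\<close>; \<open>\<epsilon>0\<close> makes
    the remaining term another \<open>\<delta> / 4\<close>.\<close>
  define \<delta>' where "\<delta>' = \<delta> / (4 * M * (2 / \<delta> + 2 ^ k))"
  define \<epsilon>0 where "\<epsilon>0 = \<delta> / (4 * M)"
  have den: "4 * M * (2 / \<delta> + 2 ^ k) > 0" using \<delta> M by (simp add: add_pos_pos)
  have pos: "\<delta>' > 0" "\<epsilon>0 > 0" using \<delta> M den by (auto simp: \<delta>'_def \<epsilon>0_def)
  have "\<delta>' * (4 * M * (2 / \<delta> + 2 ^ k)) = \<delta>"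
    unfolding \<delta>'_def using den by (intro nonzero_eq_divide_eq[THEN iffD1]) linarith+
  then have "(2 * \<delta>' / \<delta>) * M + 2 ^ k * M * \<delta>' = \<delta> / 4" by (simp add: algebra_simps)
  moreover have "\<epsilon>0 * M = \<delta> / 4" using M by (simp add: \<epsilon>0_def)
  ultimately have const: "(\<epsilon>0 + 2 * \<delta>' / \<delta>) * M + 2 ^ k * M * \<delta>' \<le> \<delta> / 2"
    unfolding distrib_right using \<delta> by linarith
  have M2: "1 \<le> 2 * M" using M by simp
  obtain \<epsilon>1 c1 :: real where 1: "\<epsilon>1 > 0" "c1 > 0"
    "\<And>(V :: 'b set) H p. \<lbrakk>finite V; uniform V k H; 0 < p; p \<le> 1; spread V p k (2 * M) H;
       real (card H) \<ge> \<delta>' * real (card V) * (1 / p) ^ (k - 1)\<rbrakk> \<Longrightarrow>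
       has_containers V H p \<epsilon>1 c1"
    using Suc.IH[OF pos(1) M2] by auto
  define \<epsilon> where "\<epsilon> = min \<epsilon>0 \<epsilon>1"
  define c where "c = 2 * \<delta>' / \<delta> + 1 + c1"
  have c: "c > 0" using \<delta> pos 1 by (simp add: c_def add_pos_pos)
  show ?case
  proof (rule exI[of _ \<epsilon>], rule exI[of _ c], intro conjI allI impI)
    show "\<epsilon> > 0" using pos 1 by (simp add: \<epsilon>_def)
    show "c > 0" by fact
    fix V :: "'b set" and H p
    assume V: "finite V" "uniform V (Suc k) H" and p: "0 < p" "p \<le> 1" and sp: "spread V p (Suc k) M H"
      and H: "\<delta> * real (card V) * (1 / p) ^ (Suc k - 1) \<le> real (card H)"
    define N where "N = real (card V)"
    have N0: "N \<ge> 0" by (simp add: N_def)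
    \<comment> \<open>The added 1 makes the rounded-down value a strict upper bound, as
      \<open>scythe\<close> demands.\<close>
    define B1 where "B1 = nat \<lfloor>2 * \<delta>' / \<delta> * p * N\<rfloor> + 1"
    define B2 where "B2 = nat \<lfloor>c1 * (p * N + 1)\<rfloor>"
    have nn: "0 \<le> 2 * \<delta>' / \<delta> * p * N" "0 \<le> c1 * (p * N + 1)" using pos \<delta> p N0 1 by simp_all
    have B1: "2 * \<delta>' / \<delta> * p * real (card V) < real B1" using nn unfolding B1_def N_def by linarith
    have "has_leaves V k p M H \<delta>' \<epsilon>0 V {} {} B1"
      by (rule scythe[OF V(1,2) Suc.hyps p M sp _ \<delta> pos const B1])
        (use H M p in \<open>auto simp: uniform_def spread_def deg_def\<close>)
    then obtain L where L: "finite L" "card L \<le> (card V + 1) ^ B1"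
      and leaf': "\<forall>(X', G')\<in>L. X' \<subseteq> V \<and> uniform V k G' \<and> spread V p k (2 * M) G' \<and>
         (real (card X') \<ge> \<epsilon>0 * real (card V) \<or> real (card G') \<ge> \<delta>' * real (card V) * (1 / p) ^ (k - 1))"
      and cover: "\<forall>I. indep H I \<longrightarrow> indep {} I \<longrightarrow> (\<exists>(X', G')\<in>L. I \<inter> X' = {} \<and> indep G' I)"
      unfolding has_leaves_def by auto
    have leaf: "X' \<subseteq> V \<and> uniform V k G' \<and> spread V p k (2 * M) G' \<and>
         (real (card X') \<ge> \<epsilon>0 * real (card V) \<or> real (card G') \<ge> \<delta>' * real (card V) * (1 / p) ^ (k - 1))"
      if "(X', G') \<in> L" for X' G'
      using bspec[OF leaf' that] by simp
    define Q where "Q x \<C> \<longleftrightarrow> finite \<C> \<and> card \<C> \<le> (card V + 1) ^ B2 \<and>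
          (\<forall>C\<in>\<C>. C \<subseteq> V \<and> real (card C) \<le> (1 - \<epsilon>) * N) \<and>
          (\<forall>I. I \<subseteq> V \<longrightarrow> I \<inter> fst x = {} \<longrightarrow> indep (snd x) I \<longrightarrow> (\<exists>C\<in>\<C>. I \<subseteq> C))"
      for x :: "'b set \<times> 'b set set" and \<C>
    have "\<exists>\<C>. Q x \<C>" if "x \<in> L" for x
    proof -
      obtain X G where x: "x = (X, G)" by force
      note lf = leaf[OF that[unfolded x]]
      show ?thesis
      proof (cases "real (card X) \<ge> \<epsilon>0 * real (card V)")
        case True
        have "card (V - X) = card V - card X" "card X \<le> card V"
          using lf V by (auto intro: card_Diff_subset card_mono finite_subset)
        then have "real (card (V - X)) \<le> (1 - \<epsilon>0) * N"
          using True by (simp add: of_nat_diff N_def left_diff_distrib)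
        also have "\<dots> \<le> (1 - \<epsilon>) * N" using N0 by (intro mult_right_mono) (auto simp: \<epsilon>_def)
        finally show ?thesis unfolding Q_def by (intro exI[of _ "{V - X}"]) (auto simp: x)
      next
        case False
        then obtain \<C> B where C: "finite \<C>" "real B \<le> c1 * (p * real (card V) + 1)" "card \<C> \<le> (card V + 1) ^ B"
          "\<forall>C\<in>\<C>. C \<subseteq> V \<and> real (card C) \<le> (1 - \<epsilon>1) * real (card V)"
          "\<forall>I. I \<subseteq> V \<longrightarrow> indep G I \<longrightarrow> (\<exists>C\<in>\<C>. I \<subseteq> C)"
          using 1(3)[OF V(1) _ p, of G] lf unfolding has_containers_def by auto
        have "B \<le> B2" using C(2) nn unfolding B2_def N_def by linarith
        then have "card \<C> \<le> (card V + 1) ^ B2"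
          using C(3) by (meson le_add2 order_trans power_increasing)
        moreover have "(1 - \<epsilon>1) * N \<le> (1 - \<epsilon>) * N" using N0 by (intro mult_right_mono) (auto simp: \<epsilon>_def)
        ultimately show ?thesis using C unfolding Q_def by (intro exI[of _ \<C>]) (fastforce simp: x N_def)
      qed
    qed
    then obtain F where FQ: "\<And>x. x \<in> L \<Longrightarrow> Q x (F x)" by metis
    have F: "\<And>x. x \<in> L \<Longrightarrow> finite (F x)" "\<And>x. x \<in> L \<Longrightarrow> card (F x) \<le> (card V + 1) ^ B2"
      "\<And>x C. x \<in> L \<Longrightarrow> C \<in> F x \<Longrightarrow> C \<subseteq> V \<and> real (card C) \<le> (1 - \<epsilon>) * N"
      "\<And>x I. x \<in> L \<Longrightarrow> I \<subseteq> V \<Longrightarrow> I \<inter> fst x = {} \<Longrightarrow> indep (snd x) I \<Longrightarrow> \<exists>C\<in>F x. I \<subseteq> C"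
      using FQ unfolding Q_def by simp_all
    show "has_containers V H p \<epsilon> c" unfolding has_containers_def
    proof (intro exI[of _ "\<Union>x\<in>L. F x"] exI[of _ "B1 + B2"] conjI)
      show "finite (\<Union>x\<in>L. F x)" using L F by auto
      have "real B1 \<le> 2 * \<delta>' / \<delta> * p * N + 1" using nn unfolding B1_def by linarith
      moreover have "real B2 \<le> c1 * (p * N + 1)" using nn unfolding B2_def by linarith
      moreover have "0 \<le> 2 * \<delta>' / \<delta> + p * N" using pos \<delta> p N0 by simp
      ultimately show "real (B1 + B2) \<le> c * (p * real (card V) + 1)"
        unfolding c_def N_def[symmetric] by (simp add: ring_distribs mult.assoc)
      have "card (\<Union>x\<in>L. F x) \<le> (\<Sum>x\<in>L. card (F x))" using L(1) by (rule card_UN_le)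
      also have "\<dots> \<le> (\<Sum>x\<in>L. (card V + 1) ^ B2)" using F by (intro sum_mono) auto
      also have "\<dots> = card L * (card V + 1) ^ B2" by simp
      also have "\<dots> \<le> (card V + 1) ^ B1 * (card V + 1) ^ B2" using L by (intro mult_right_mono) auto
      finally show "card (\<Union>x\<in>L. F x) \<le> (card V + 1) ^ (B1 + B2)" by (simp add: power_add)
      show "\<forall>C\<in>\<Union>x\<in>L. F x. C \<subseteq> V \<and> real (card C) \<le> (1 - \<epsilon>) * real (card V)"
        using F(3) by (auto simp: N_def)
      show "\<forall>I. I \<subseteq> V \<longrightarrow> indep H I \<longrightarrow> (\<exists>C\<in>\<Union>x\<in>L. F x. I \<subseteq> C)"
      proof (intro allI impI)
        fix I assume I: "I \<subseteq> V" "indep H I"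
        then obtain x where x: "x \<in> L" "I \<inter> fst x = {}" "indep (snd x) I"
          using cover[rule_format, of I] by (auto simp: indep_def)
        show "\<exists>C\<in>\<Union>x\<in>L. F x. I \<subseteq> C" using F(4)[OF x(1) I(1) x(2,3)] x(1) by auto
      qed
    qed
  qed
qed

text \<open>Take a maximal subfamily that is spread with constant 2. If it is too small, double
  counting shows that it has few saturated sets of each size, so \<open>avoid\<close> supplies an
  edge without saturated subsets. Adding this edge raises by one only degrees strictly below
  \<open>(1 / p) ^ (k - card T)\<close>, a quantity that is at least 1; the constant 2 tolerates
  this, contrary to maximality.\<close>

lemma balanced_subfamily:
  assumes V: "finite V" "uniform V k H" and p: "0 < p" "p \<le> 1" and k: "k \<ge> 1"
    and avoid: "\<And>F. F \<subseteq> Pow V - {{}} \<Longrightarrow>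
      (\<And>j. 1 \<le> j \<Longrightarrow> j \<le> k \<Longrightarrow> real (card {T\<in>F. card T = j}) \<le> \<delta> * real (card V) * (1 / p) ^ (j - 1)) \<Longrightarrow>
      \<exists>E\<in>H. \<forall>T\<in>F. \<not> T \<subseteq> E"
  shows "\<exists>H'. H' \<subseteq> H \<and> spread V p k 2 H' \<and> real (card H') \<ge> \<delta> / 2 ^ k * real (card V) * (1 / p) ^ (k - 1)"
proof -
  have finH: "finite H" using V uniform_finite by blast
  let ?S = "{H'. H' \<subseteq> H \<and> spread V p k 2 H'}"
  have "finite ?S" using finH by simp
  moreover have "{} \<in> ?S" using p by (auto simp: spread_def deg_def)
  ultimately have "\<exists>m\<in>?S. \<forall>b\<in>?S. m \<subseteq> b \<longrightarrow> m = b"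
    by (intro finite_has_maximal) auto
  then obtain H' where H': "H' \<subseteq> H" "spread V p k 2 H'" and max: "\<forall>H''\<in>?S. H' \<subseteq> H'' \<longrightarrow> H' = H''"
    by (elim bexE) (use that in \<open>blast\<close>)
  have finH': "finite H'" using H' finH finite_subset by blast
  have unif': "uniform V k H'" using V H' by (auto simp: uniform_def)
  have "real (card H') \<ge> \<delta> / 2 ^ k * real (card V) * (1 / p) ^ (k - 1)"
  proof (rule ccontr)
    assume "\<not> ?thesis"
    then have "real (card H') \<le> \<delta> / 2 ^ k * real (card V) * (1 / p) ^ (k - 1)" by simp
    then have small: "real (card H') * 2 ^ k \<le> \<delta> * real (card V) * (1 / p) ^ (k - 1)"
      using mult_right_mono[of "real (card H')" _ "2 ^ k :: real"] by fastforce
    define F where "F = {T\<in>Pow V. saturated p k H' T}"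
    have "\<exists>E\<in>H. \<forall>T\<in>F. \<not> T \<subseteq> E"
    proof (rule avoid)
      show "F \<subseteq> Pow V - {{}}" by (auto simp: F_def saturated_def)
      fix j assume j: "1 \<le> j" "j \<le> k"
      let ?F = "{T\<in>F. card T = j}"
      have ppos: "(1 / p) ^ (k - j) > 0" using p by simp
      have "real (card ?F) * (1 / p) ^ (k - j) = (\<Sum>T\<in>?F. (1 / p) ^ (k - j))" by simp
      also have "\<dots> \<le> (\<Sum>T\<in>?F. real (deg H' T))" by (rule sum_mono) (auto simp: F_def saturated_def)
      also have "\<dots> \<le> (\<Sum>T\<in>Pow V. real (deg H' T))" using V by (intro sum_mono2) (auto simp: F_def)
      also have "\<dots> = real (card H') * 2 ^ k" using sum_deg[OF V(1) unif'] by (simp flip: of_nat_sum)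
      also have "\<dots> \<le> \<delta> * real (card V) * (1 / p) ^ (k - 1)" by (rule small)
      also have "\<dots> = \<delta> * real (card V) * (1 / p) ^ (j - 1) * (1 / p) ^ (k - j)"
        using j by (simp flip: power_add)
      finally show "real (card ?F) \<le> \<delta> * real (card V) * (1 / p) ^ (j - 1)"
        using ppos mult_le_cancel_right_pos by blast
    qed
    then obtain E where EH: "E \<in> H" "\<forall>T\<in>F. \<not> T \<subseteq> E" by blast
    then have EV: "E \<subseteq> V" "card E = k" using V(2) by (auto simp: uniform_def)
    have E: "E \<in> H" "\<And>T. T \<subseteq> E \<Longrightarrow> \<not> saturated p k H' T"
      using EH EV by (auto simp: F_def)
    \<comment> \<open>An edge of \<open>H'\<close> is a saturated subset of itself, so the edge
      found must be new.\<close>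
    have Enew: "E \<notin> H'"
    proof
      assume "E \<in> H'"
      then have "card {E} \<le> deg H' E" unfolding deg_def by (intro card_mono) (use finH' in auto)
      then have "saturated p k H' E" using EV k by (auto simp: saturated_def)
      then show False using E(2) by auto
    qed
    have "spread V p k 2 (insert E H')"
      unfolding spread_def
    proof (intro allI impI)
      fix T assume T: "T \<noteq> {}" "T \<subseteq> V" "card T \<le> k"
      have one: "1 \<le> (1 / p) ^ (k - card T)" using p by (simp add: one_le_power)
      show "real (deg (insert E H') T) \<le> 2 * (1 / p) ^ (k - card T)"
      proof (cases "T \<subseteq> E")
        case True
        have "{E'\<in>insert E H'. T \<subseteq> E'} = insert E {E'\<in>H'. T \<subseteq> E'}" using True by auto
        then have "deg (insert E H') T = Suc (deg H' T)"
          using Enew finH' by (simp add: deg_def)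
        moreover have "real (deg H' T) < (1 / p) ^ (k - card T)"
          using E(2)[OF True] T by (auto simp: saturated_def)
        ultimately show ?thesis using one by simp
      next
        case False
        then have "deg (insert E H') T = deg H' T" unfolding deg_def by (metis insert_iff)
        then show ?thesis using H'(2) T by (auto simp: spread_def)
      qed
    qed
    then show False using max[rule_format, of "insert E H'"] E H' Enew by auto
  qed
  then show ?thesis using H' by blast
qed

section \<open>Even cycles in graphs of large minimum degree\<close>

lemma logconvex_shift:
  fixes s :: "nat \<Rightarrow> real"
  assumes pos: "\<And>m. s m > 0" and lc: "\<And>m. (s (Suc m))\<^sup>2 \<le> s m * s (Suc (Suc m))" and "i \<le> j"
  shows "s (Suc i) * s j \<le> s i * s (Suc j)"
  using \<open>i \<le> j\<close>
proof (induction j rule: dec_induct)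
  case base
  show ?case by (simp add: mult.commute)
next
  case (step j)
  have "s j * (s (Suc i) * s (Suc j)) \<le> s i * (s (Suc j))\<^sup>2"
    using mult_right_mono[OF step.IH, of "s (Suc j)"] pos[of "Suc j"]
    by (simp add: power2_eq_square mult_ac)
  also have "\<dots> \<le> s i * (s j * s (Suc (Suc j)))" using lc pos[of i] by (intro mult_left_mono) auto
  finally have "s j * (s (Suc i) * s (Suc j)) \<le> s j * (s i * s (Suc (Suc j)))" by (simp add: mult_ac)
  then show ?case using pos[of j] by simp
qed

text \<open>Log-convexity favours unequal indices: with \<open>a + b\<close> fixed, the product does
  not decrease while the smaller index is lowered to 1.\<close>

lemma logconvex_spread:
  fixes s :: "nat \<Rightarrow> real"
  assumes pos: "\<And>m. s m > 0" and lc: "\<And>m. (s (Suc m))\<^sup>2 \<le> s m * s (Suc (Suc m))"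
    and ab: "a \<ge> 1" "b \<ge> 1"
  shows "s a * s b \<le> s 1 * s (a + b - 1)"
proof -
  have *: "s a * s b \<le> s 1 * s (a + b - 1)" if "a \<le> b" "a \<ge> 1" for a b
    using that(2,1)
  proof (induction a arbitrary: b rule: dec_induct)
    case base
    then show ?case by simp
  next
    case (step a)
    have "s (Suc a) * s b \<le> s a * s (Suc b)" by (rule logconvex_shift[of s, OF pos lc]) (use step in auto)
    also have "\<dots> \<le> s 1 * s (a + Suc b - 1)" by (rule step.IH) (use step in auto)
    finally show ?case by simp
  qed
  show ?thesis
  proof (cases "a \<le> b")
    case True
    then show ?thesis using * ab by blast
  next
    case False
    then have "s b * s a \<le> s 1 * s (b + a - 1)" using * ab by simp
    then show ?thesis by (simp add: add.commute mult.commute)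
  qed
qed

text \<open>Ratios of consecutive terms do not decrease. If the last one were below
  \<open>C\<close>, all would be, and their product would keep \<open>s (Suc l)\<close> below
  \<open>C ^ Suc l * s 0\<close>.\<close>

lemma logconvex_ratio:
  fixes s :: "nat \<Rightarrow> real"
  assumes pos: "\<And>m. s m > 0" and lc: "\<And>m. (s (Suc m))\<^sup>2 \<le> s m * s (Suc (Suc m))"
    and C: "C > 0" and large: "s (Suc l) \<ge> C ^ Suc l * s 0"
  shows "s (Suc l) \<ge> C * s l"
proof (rule ccontr)
  assume "\<not> ?thesis"
  then have less: "s (Suc l) < C * s l" by simp
  have ratio: "s (Suc i) < C * s i" if "i \<le> l" for i
  proof -
    have "s (Suc i) * s l \<le> s i * s (Suc l)" by (rule logconvex_shift[of s, OF pos lc that])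
    also have "\<dots> < s i * (C * s l)" using less pos by simp
    finally have "s (Suc i) * s l < (C * s i) * s l" by (simp add: mult_ac)
    then show ?thesis using pos[of l] mult_less_cancel_right_pos by blast
  qed
  have "s i \<le> C ^ i * s 0 \<and> (i > 0 \<longrightarrow> s i < C ^ i * s 0)" if "i \<le> Suc l" for i
    using that
  proof (induction i)
    case (Suc i)
    have "s (Suc i) < C * s i" using ratio Suc by simp
    also have "\<dots> \<le> C * (C ^ i * s 0)" using Suc C by (intro mult_left_mono) auto
    finally show ?case by (simp add: mult_ac)
  qed simp
  from this[of "Suc l"] show False using large by simp
qed

lemma sum_UN_le:
  fixes f :: "'b \<Rightarrow> real"
  assumes "finite I" "\<And>i. i \<in> I \<Longrightarrow> finite (A i)" "\<And>x. f x \<ge> 0"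
  shows "(\<Sum>x\<in>(\<Union>i\<in>I. A i). f x) \<le> (\<Sum>i\<in>I. \<Sum>x\<in>A i. f x)"
  using assms(1,2)
proof (induction I rule: finite_induct)
  case (insert i I)
  have "(\<Sum>x\<in>A i \<union> (\<Union>i\<in>I. A i). f x) \<le> (\<Sum>x\<in>A i. f x) + (\<Sum>x\<in>(\<Union>i\<in>I. A i). f x)"
    using insert assms(3) by (subst sum_Un) (auto intro!: sum_nonneg)
  then show ?case using insert by simp
qed simp

section \<open>Closed walks in weighted graphs\<close>

primrec wpow :: "'a set \<Rightarrow> ('a \<Rightarrow> 'a \<Rightarrow> real) \<Rightarrow> nat \<Rightarrow> 'a \<Rightarrow> 'a \<Rightarrow> real" where
  "wpow V W 0 x y = (if x = y then 1 else 0)"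
| "wpow V W (Suc k) x y = (\<Sum>z\<in>V. W x z * wpow V W k z y)"

declare wpow.simps(2) [simp del]

fun wt :: "('a \<Rightarrow> 'a \<Rightarrow> real) \<Rightarrow> 'a list \<Rightarrow> real" where
  "wt W (x # y # zs) = W x y * wt W (y # zs)"
| "wt W _ = 1"

definition lists_of :: "'a set \<Rightarrow> nat \<Rightarrow> 'a list set" where
  "lists_of V n = {xs. set xs \<subseteq> V \<and> length xs = n}"

lemma lists_of_0: "lists_of V 0 = {[]}" by (auto simp: lists_of_def)

lemma finite_lists_of: "finite V \<Longrightarrow> finite (lists_of V n)"
  unfolding lists_of_def by (rule finite_lists_length_eq)

lemma sum_lists_Suc:
  fixes f :: "'a list \<Rightarrow> real"
  assumes "finite V"
  shows "(\<Sum>xs\<in>lists_of V (Suc n). f xs) = (\<Sum>z\<in>V. \<Sum>B\<in>lists_of V n. f (z # B))"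
proof -
  have "lists_of V (Suc n) = (\<lambda>(z, B). z # B) ` (V \<times> lists_of V n)"
    unfolding lists_of_def by (auto simp: length_Suc_conv image_iff)
  then have "(\<Sum>xs\<in>lists_of V (Suc n). f xs) = (\<Sum>(z, B)\<in>V \<times> lists_of V n. f (z # B))"
    by (simp only:) (subst sum.reindex, auto simp: inj_on_def case_prod_unfold)
  then show ?thesis by (simp add: sum.cartesian_product)
qed

lemma wt_nonneg':
  assumes "\<And>x y. W x y \<ge> 0"
  shows "wt W xs \<ge> 0"
  by (induction xs rule: induct_list012) (auto intro: mult_nonneg_nonneg assms)

lemma wt_append: "wt W (xs @ a # ys) = wt W (xs @ [a]) * wt W (a # ys)"
proof (induction xs)
  case (Cons x xs)
  then show ?case by (cases xs) auto
qed simp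

locale weighted_graph =
  fixes V :: "'a set" and W :: "'a \<Rightarrow> 'a \<Rightarrow> real"
  assumes fin: "finite V" and sym: "\<And>x y. W x y = W y x" and nonneg: "\<And>x y. W x y \<ge> 0"
begin

abbreviation "P \<equiv> wpow V W"

lemma wpow_nonneg: "P k x y \<ge> 0"
  by (induction k arbitrary: x) (auto simp: wpow.simps(2) intro!: sum_nonneg mult_nonneg_nonneg nonneg)

lemma wpow_1: "y \<in> V \<Longrightarrow> P (Suc 0) x y = W x y"
  using fin by (simp add: wpow.simps(2) if_distrib[of "\<lambda>z. _ * z"] cong: if_cong)

lemma wpow_add:
  assumes "x \<in> V"
  shows "P (a + b) x y = (\<Sum>z\<in>V. P a x z * P b z y)"
  using assms
proof (induction a arbitrary: x)
  case 0
  then show ?case using fin by (simp add: if_distrib[of "\<lambda>z. z * _"] sum.delta cong: if_cong)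
next
  case (Suc a)
  have "P (Suc a + b) x y = (\<Sum>w\<in>V. W x w * (\<Sum>z\<in>V. P a w z * P b z y))"
    using Suc.IH by (simp add: wpow.simps(2))
  also have "\<dots> = (\<Sum>w\<in>V. \<Sum>z\<in>V. W x w * P a w z * P b z y)"
    by (simp add: sum_distrib_left mult_ac)
  also have "\<dots> = (\<Sum>z\<in>V. \<Sum>w\<in>V. W x w * P a w z * P b z y)" by (rule sum.swap)
  finally show ?case by (simp add: sum_distrib_right wpow.simps(2))
qed

lemma wpow_sym: "x \<in> V \<Longrightarrow> y \<in> V \<Longrightarrow> P k x y = P k y x"
proof (induction k arbitrary: x y)
  case (Suc k)
  have "P (Suc k) y x = (\<Sum>z\<in>V. P k y z * P (Suc 0) z x)"
    using wpow_add[OF \<open>y \<in> V\<close>, of k "Suc 0" x] by simp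
  also have "\<dots> = (\<Sum>z\<in>V. W x z * P k z y)"
    using Suc wpow_1[of x] by (intro sum.cong refl) (auto simp: sym[of x] mult.commute)
  finally show ?case by (simp add: wpow.simps(2))
qed auto

text \<open>The squared norm of row \<open>x\<close> of the \<open>m\<close>-th matrix power, or the
  \<open>m\<close>-th moment of the spectral measure at \<open>x\<close> of the squared matrix; this
  is why it is non-negative and log-convex in \<open>m\<close>.\<close>

definition mom :: "nat \<Rightarrow> 'a \<Rightarrow> real" where "mom m x = P (2 * m) x x"

lemma mom_sq: "x \<in> V \<Longrightarrow> mom m x = (\<Sum>z\<in>V. (P m x z)\<^sup>2)"
  using wpow_add[of x m m x] wpow_sym
  by (simp add: mom_def mult_2 power2_eq_square cong: sum.cong)

text \<open>Cauchy-Schwarz for the rows at \<open>x\<close> of two matrix powers. With consecutive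
  \<open>a\<close> and \<open>b\<close> it controls returns of odd length by even moments.\<close>

lemma wpow_cs:
  assumes "x \<in> V"
  shows "(P (a + b) x x)\<^sup>2 \<le> mom a x * mom b x"
proof -
  have "P (a + b) x x = (\<Sum>z\<in>V. P a x z * P b x z)"
    using wpow_add[OF assms, of a b x] wpow_sym[OF assms] by (simp cong: sum.cong)
  then show ?thesis
    using Cauchy_Schwarz_ineq_sum[of "P a x" "P b x" V] assms by (simp add: mom_sq)
qed

lemma mom_nonneg: "mom m x \<ge> 0" by (simp add: mom_def wpow_nonneg)

lemma mom_logconvex: "x \<in> V \<Longrightarrow> (mom (Suc m) x)\<^sup>2 \<le> mom m x * mom (Suc (Suc m)) x"
  using wpow_cs[of x m "Suc (Suc m)"] by (simp add: mom_def mult_2)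

lemma mom_0: "mom 0 x = 1" by (simp add: mom_def)

text \<open>Log-convexity excludes a zero at index \<open>k + 2\<close> once the term at
  \<open>k + 1\<close> is positive.\<close>

lemma mom_pos:
  assumes x: "x \<in> V" and "mom 1 x > 0"
  shows "mom m x > 0"
proof (induction m rule: less_induct)
  case (less m)
  show ?case
  proof (cases "m \<le> 1")
    case True
    then have "m = 0 \<or> m = 1" by auto
    then show ?thesis using assms mom_0[of x] by auto
  next
    case False
    then obtain k where k: "m = Suc (Suc k)" by (metis One_nat_def not0_implies_Suc not_less_eq_eq le0 less_one)
    have "0 < (mom (Suc k) x)\<^sup>2" using less[of "Suc k"] k by simp
    also have "\<dots> \<le> mom k x * mom m x" using mom_logconvex[OF x] k by simp
    finally show ?thesis using mom_nonneg[of m x] by (metis less_eq_real_def mult_zero_right less_irrefl)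
  qed
qed

text \<open>Log-convexity of the even moments makes coincidences at distance two the worst ones.\<close>

lemma wpow_product_le:
  assumes x: "x \<in> V" and pos: "mom 1 x > 0" and loop: "W x x = 0"
    and ab: "a \<ge> 1" "b \<ge> 1" "a + b = 2 * l"
  shows "P a x x * P b x x \<le> mom 1 x * mom (l - 1) x"
proof -
  note sp = logconvex_spread[of "\<lambda>m. mom m x", OF mom_pos[OF x pos] mom_logconvex[OF x]]
  have nn: "0 \<le> mom 1 x * mom (l - 1) x" by (simp add: mom_nonneg)
  show ?thesis
  proof (cases "even a")
    case True
    then have "even b" using ab by (metis dvd_triv_left even_add)
    then obtain i j where ij: "a = 2 * i" "b = 2 * j" using True by (auto elim!: evenE)
    then have "mom i x * mom j x \<le> mom 1 x * mom (i + j - 1) x" using ab by (intro sp) auto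
    moreover have "i + j = l" using ab ij by simp
    ultimately show ?thesis by (simp add: ij mom_def)
  next
    case False
    then have "odd b" using ab by (metis dvd_triv_left even_add)
    \<comment> \<open>A return of odd length \<open>2 * i + 1\<close> is at most the geometric mean
      of the moments \<open>i\<close> and \<open>i + 1\<close>. The four moments are regrouped
      crosswise into index pairs \<open>(i, j + 1)\<close> and \<open>(i + 1, j)\<close>, both of
      sum \<open>l\<close>, to which the spreading inequality applies. It does not cover index 0;
      this corresponds to a return of length 1, which vanishes because there are no loops.\<close>
    then obtain i j where "a = 2 * i + 1" "b = 2 * j + 1" using False by (metis oddE)
    then have ij: "a = i + Suc i" "b = j + Suc j" by simp_all
    have l: "i + j + 1 = l" using ab ij by simp
    show ?thesis
    proof (cases "i = 0 \<or> j = 0")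
      case True
      then have "P a x x = 0 \<or> P b x x = 0" using ij wpow_1[OF x, of x] loop by auto
      then show ?thesis using nn by auto
    next
      case False
      have "(P a x x * P b x x)\<^sup>2 \<le> (mom i x * mom (Suc i) x) * (mom j x * mom (Suc j) x)"
        unfolding power_mult_distrib ij
        by (intro mult_mono wpow_cs x mult_nonneg_nonneg mom_nonneg) auto
      also have "\<dots> = (mom i x * mom (Suc j) x) * (mom (Suc i) x * mom j x)" by (simp add: mult_ac)
      also have "\<dots> \<le> (mom 1 x * mom (l - 1) x) * (mom 1 x * mom (l - 1) x)"
      proof (rule mult_mono)
        show "0 \<le> mom 1 x * mom (l - 1) x" "0 \<le> mom (Suc i) x * mom j x"
          by (simp_all add: mom_nonneg)
        show "mom i x * mom (Suc j) x \<le> mom 1 x * mom (l - 1) x"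
          using sp[of i "Suc j"] False unfolding l[symmetric] by simp
        show "mom (Suc i) x * mom j x \<le> mom 1 x * mom (l - 1) x"
          using sp[of "Suc i" j] False unfolding l[symmetric] by simp
      qed
      finally show ?thesis using nn power2_le_imp_le[of _ "mom 1 x * mom (l - 1) x"]
        by (simp add: power2_eq_square)
    qed
  qed
qed

text \<open>The trace of the \<open>2 * m\<close>-th matrix power, which is also the squared
  Frobenius norm of the \<open>m\<close>-th power.\<close>

definition tr :: "nat \<Rightarrow> real" where "tr m = (\<Sum>x\<in>V. mom m x)"

lemma tr_sq: "tr m = (\<Sum>(x, z)\<in>V \<times> V. (P m x z)\<^sup>2)"
  by (simp add: tr_def mom_sq sum.cartesian_product cong: sum.cong)

lemma tr_logconvex: "(tr (Suc m))\<^sup>2 \<le> tr m * tr (Suc (Suc m))"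
proof -
  have "mom (Suc m) x = (\<Sum>z\<in>V. P m x z * P (Suc (Suc m)) x z)" if "x \<in> V" for x
    using wpow_add[OF that, of m "Suc (Suc m)" x] wpow_sym[OF that]
    by (simp add: mom_def mult_2 cong: sum.cong)
  then have "tr (Suc m) = (\<Sum>(x, z)\<in>V \<times> V. P m x z * P (Suc (Suc m)) x z)"
    by (simp add: tr_def sum.cartesian_product cong: sum.cong)
  then show ?thesis
    using Cauchy_Schwarz_ineq_sum[of "\<lambda>(x, z). P m x z" "\<lambda>(x, z). P (Suc (Suc m)) x z" "V \<times> V"]
    by (simp add: tr_sq case_prod_unfold)
qed

lemma sum_wt: "b \<in> V \<Longrightarrow> (\<Sum>B\<in>lists_of V n. wt W (a # B @ [b])) = P (Suc n) a b"
proof (induction n arbitrary: a)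
  case 0
  then show ?case using wpow_1 by (simp add: lists_of_0)
next
  case (Suc n)
  then show ?case using fin by (simp add: sum_lists_Suc wpow.simps(2)[of _ _ "Suc n"] flip: sum_distrib_left)
qed

definition cwt :: "'a list \<Rightarrow> real" where "cwt xs = wt W (xs @ [hd xs])"

lemma wt_nonneg: "wt W xs \<ge> 0"
  by (rule wt_nonneg') (rule nonneg)

lemma sum_cwt: "(\<Sum>xs\<in>lists_of V (Suc k). cwt xs) = (\<Sum>x\<in>V. P (Suc k) x x)"
  using fin by (simp add: sum_lists_Suc cwt_def sum_wt cong: sum.cong)

text \<open>Cut the closed walk at the repeated vertex: the part between the positions
  \<open>i\<close> and \<open>j\<close> is one closed walk, and the rest, rotated to begin at that
  vertex, is another. The weight is the product of the two weights.\<close>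

lemma sum_cwt_coincidence:
  assumes ij: "i < j" "j < k"
  shows "(\<Sum>xs | xs \<in> lists_of V k \<and> xs ! i = xs ! j. cwt xs) \<le> (\<Sum>x\<in>V. P (j - i) x x * P (k - (j - i)) x x)"
proof -
  let ?S = "{xs. xs \<in> lists_of V k \<and> xs ! i = xs ! j}"
  define p where "p = j - i - 1"
  define q where "q = k - (j - i) - 1"
  \<comment> \<open>\<open>f\<close> records the repeated vertex, the inner loop and the rotated
    outer loop. \<open>g\<close> undoes the rotation, which is possible because the part after
    position \<open>j\<close> has the known length \<open>k - 1 - j\<close>; hence \<open>f\<close>
    is injective.\<close>
  define f where "f xs = (xs ! i, take p (drop (Suc i) xs), drop (Suc j) xs @ take i xs)" for xs :: "'a list"
  define g where "g = (\<lambda>(a, B, C). drop (k - 1 - j) C @ a # B @ a # take (k - 1 - j) C :: 'a list)"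
  have split: "xs = take i xs @ xs ! i # take p (drop (Suc i) xs) @ xs ! i # drop (Suc j) xs"
    if "xs \<in> ?S" for xs
  proof -
    have len: "length xs = k" using that by (simp add: lists_of_def)
    have "xs = take i xs @ xs ! i # drop (Suc i) xs" using ij len by (simp add: id_take_nth_drop)
    moreover have "drop (Suc i) xs = take p (drop (Suc i) xs) @ drop (Suc i) xs ! p # drop (Suc p) (drop (Suc i) xs)"
      using ij len by (intro id_take_nth_drop) (auto simp: p_def)
    moreover have "drop (Suc i) xs ! p = xs ! i" using that ij len by (auto simp: p_def)
    moreover have "drop (Suc p) (drop (Suc i) xs) = drop (Suc j) xs" using ij by (simp add: p_def)
    ultimately show ?thesis by metis
  qed
  have inv: "g (f xs) = xs" if "xs \<in> ?S" for xs
  proof -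
    have "length (drop (Suc j) xs) = k - 1 - j" using that by (simp add: lists_of_def)
    then show ?thesis unfolding f_def g_def using split[OF that] by simp
  qed
  have inj: "inj_on f ?S" using inv by (rule inj_on_inverseI)
  define h where "h = (\<lambda>(a, B, C). wt W (a # B @ [a]) * wt W (a # C @ [a]))"
  have eq: "cwt xs = h (f xs)" if "xs \<in> ?S" for xs
  proof -
    define A a B D where "A = take i xs" and "a = xs ! i" and "B = take p (drop (Suc i) xs)" and "D = drop (Suc j) xs"
    have xs: "xs = A @ a # B @ a # D" using split[OF that] by (simp add: A_def a_def B_def D_def)
    have "f xs = (a, B, D @ A)" by (simp add: f_def A_def a_def B_def D_def)
    then have h: "h (f xs) = wt W (a # B @ [a]) * wt W (a # (D @ A) @ [a])" by (simp add: h_def)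
    show ?thesis
    proof (cases A)
      case Nil
      then have "cwt xs = wt W ((a # B) @ a # (D @ [a]))" unfolding cwt_def xs by simp
      also have "\<dots> = wt W (a # B @ [a]) * wt W (a # D @ [a])" by (subst wt_append) simp
      finally show ?thesis using h Nil by simp
    next
      case (Cons c A')
      have "cwt xs = wt W ((c # A') @ a # (B @ a # D @ [c]))" unfolding cwt_def xs Cons by simp
      also have "\<dots> = wt W ((c # A') @ [a]) * wt W ((a # B) @ a # (D @ [c]))"
        by (subst wt_append) simp
      also have "wt W ((a # B) @ a # (D @ [c])) = wt W (a # B @ [a]) * wt W (a # D @ [c])"
        by (subst wt_append) simp
      finally have 1: "cwt xs = wt W ((c # A') @ [a]) * (wt W (a # B @ [a]) * wt W (a # D @ [c]))" .
      have "wt W (a # (D @ A) @ [a]) = wt W ((a # D) @ c # (A' @ [a]))" using Cons by simp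
      also have "\<dots> = wt W (a # D @ [c]) * wt W ((c # A') @ [a])" by (subst wt_append) simp
      finally show ?thesis using 1 h by simp
    qed
  qed
  have "(\<Sum>xs\<in>?S. cwt xs) = (\<Sum>xs\<in>?S. h (f xs))" using eq by (intro sum.cong refl) auto
  also have "\<dots> = (\<Sum>x\<in>f ` ?S. h x)" using inj by (simp add: sum.reindex)
  also have "\<dots> \<le> (\<Sum>x\<in>V \<times> lists_of V p \<times> lists_of V q. h x)"
  proof (rule sum_mono2)
    show "finite (V \<times> lists_of V p \<times> lists_of V q)" using fin by (simp add: finite_lists_of)
    show "f ` ?S \<subseteq> V \<times> lists_of V p \<times> lists_of V q"
      using ij by (auto simp: f_def lists_of_def p_def q_def dest!: in_set_takeD in_set_dropD)
    show "0 \<le> h x" for x by (cases x) (auto simp: h_def intro!: mult_nonneg_nonneg wt_nonneg)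
  qed
  also have "\<dots> = (\<Sum>a\<in>V. \<Sum>B\<in>lists_of V p. \<Sum>C\<in>lists_of V q. wt W (a # B @ [a]) * wt W (a # C @ [a]))"
    by (simp add: h_def sum.cartesian_product case_prod_unfold)
  also have "\<dots> = (\<Sum>a\<in>V. P (Suc p) a a * P (Suc q) a a)"
    by (intro sum.cong refl) (simp add: sum_product[symmetric] sum_wt)
  also have "\<dots> = (\<Sum>x\<in>V. P (j - i) x x * P (k - (j - i)) x x)"
    using ij by (simp add: p_def q_def Suc_diff_Suc)
  finally show ?thesis .
qed

text \<open>Walks with a repeated vertex are covered by at most \<open>(2 * l) ^ 2\<close> pairs of
  positions. Each pair contributes at most the sum of \<open>mom 1 x * mom (l - 1) x\<close>, hence
  at most \<open>tr (l - 1)\<close>.\<close>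

lemma sum_cwt_distinct:
  assumes l: "l \<ge> 1" and pos: "\<And>x. x \<in> V \<Longrightarrow> mom 1 x > 0" and le1: "\<And>x. x \<in> V \<Longrightarrow> mom 1 x \<le> 1"
    and loop: "\<And>x. W x x = 0"
  shows "(\<Sum>xs | xs \<in> lists_of V (2 * l) \<and> distinct xs. cwt xs) \<ge> tr l - (2 * real l)\<^sup>2 * tr (l - 1)"
proof -
  let ?L = "lists_of V (2 * l)" and ?I = "{(i, j). i < j \<and> j < 2 * l}"
  have finL: "finite ?L" using fin by (rule finite_lists_of)
  have I: "?I \<subseteq> {..<2 * l} \<times> {..<2 * l}" by auto
  then have finI: "finite ?I" by (rule finite_subset) simp
  have "card ?I \<le> card ({..<2 * l} \<times> {..<2 * l})" using I by (intro card_mono) auto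
  then have "card ?I \<le> (2 * l)\<^sup>2" by (simp add: power2_eq_square)
  then have cI: "real (card ?I) \<le> (2 * real l)\<^sup>2" by (metis of_nat_le_iff of_nat_power of_nat_mult of_nat_numeral)
  have nn: "cwt xs \<ge> 0" for xs by (simp add: cwt_def wt_nonneg)
  have "tr l = (\<Sum>x\<in>V. P (2 * l) x x)" by (simp add: tr_def mom_def)
  also have "\<dots> = (\<Sum>xs\<in>?L. cwt xs)"
    using sum_cwt[of "2 * l - 1"] l by simp
  also have "\<dots> = (\<Sum>xs | xs \<in> ?L \<and> distinct xs. cwt xs) + (\<Sum>xs | xs \<in> ?L \<and> \<not> distinct xs. cwt xs)"
    using finL by (subst sum.union_disjoint[symmetric]) (auto intro: sum.cong)
  finally have 1: "tr l = (\<Sum>xs | xs \<in> ?L \<and> distinct xs. cwt xs) + (\<Sum>xs | xs \<in> ?L \<and> \<not> distinct xs. cwt xs)" .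
  have "(\<Sum>xs | xs \<in> ?L \<and> \<not> distinct xs. cwt xs) \<le> (\<Sum>xs\<in>(\<Union>(i, j)\<in>?I. {xs. xs \<in> ?L \<and> xs ! i = xs ! j}). cwt xs)"
  proof (rule sum_mono2)
    show "finite (\<Union>(i, j)\<in>?I. {xs. xs \<in> ?L \<and> xs ! i = xs ! j})" using finI finL by auto
    show "{xs. xs \<in> ?L \<and> \<not> distinct xs} \<subseteq> (\<Union>(i, j)\<in>?I. {xs. xs \<in> ?L \<and> xs ! i = xs ! j})"
    proof
      fix xs assume "xs \<in> {xs. xs \<in> ?L \<and> \<not> distinct xs}"
      then obtain a b where ab: "xs \<in> ?L" "a < length xs" "b < length xs" "a \<noteq> b" "xs ! a = xs ! b"
        by (auto simp: distinct_conv_nth)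
      define i j where "i = min a b" and "j = max a b"
      have "i < j" "j < 2 * l" "xs ! i = xs ! j"
        using ab by (auto simp: i_def j_def min_def max_def lists_of_def)
      then show "xs \<in> (\<Union>(i, j)\<in>?I. {xs. xs \<in> ?L \<and> xs ! i = xs ! j})"
        using ab by auto
    qed
  qed (rule nn)
  also have "\<dots> \<le> (\<Sum>ij\<in>?I. \<Sum>xs\<in>(case ij of (i, j) \<Rightarrow> {xs. xs \<in> ?L \<and> xs ! i = xs ! j}). cwt xs)"
    by (rule sum_UN_le) (use finI finL nn in auto)
  also have "\<dots> \<le> (\<Sum>ij\<in>?I. tr (l - 1))"
  proof (rule sum_mono)
    fix ij assume "ij \<in> ?I"
    then obtain i j where ij: "ij = (i, j)" "i < j" "j < 2 * l" by auto
    have "(\<Sum>xs | xs \<in> ?L \<and> xs ! i = xs ! j. cwt xs) \<le> (\<Sum>x\<in>V. P (j - i) x x * P (2 * l - (j - i)) x x)"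
      by (rule sum_cwt_coincidence) (use ij in auto)
    also have "\<dots> \<le> (\<Sum>x\<in>V. mom (l - 1) x)"
    proof (rule sum_mono)
      fix x assume x: "x \<in> V"
      have "P (j - i) x x * P (2 * l - (j - i)) x x \<le> mom 1 x * mom (l - 1) x"
        by (rule wpow_product_le) (use x ij pos loop in auto)
      also have "\<dots> \<le> 1 * mom (l - 1) x" using le1 x mom_nonneg by (intro mult_right_mono) auto
      finally show "P (j - i) x x * P (2 * l - (j - i)) x x \<le> mom (l - 1) x" by simp
    qed
    finally show "(\<Sum>xs\<in>(case ij of (i, j) \<Rightarrow> {xs. xs \<in> ?L \<and> xs ! i = xs ! j}). cwt xs) \<le> tr (l - 1)"
      using ij by (simp add: tr_def)
  qed
  also have "\<dots> = real (card ?I) * tr (l - 1)" by simp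
  also have "\<dots> \<le> (2 * real l)\<^sup>2 * tr (l - 1)"
    using cI by (intro mult_right_mono) (auto simp: tr_def intro: sum_nonneg mom_nonneg)
  finally show ?thesis using 1 by linarith
qed

end


section \<open>Counting even cycles\<close>

lemma wt_le:
  assumes "\<And>x y. W x y \<le> c" "c \<ge> 0" "\<And>x y. W x y \<ge> 0" "xs \<noteq> []"
  shows "wt W xs \<le> c ^ (length xs - 1)"
  using assms(4)
proof (induction xs rule: induct_list012)
  case (3 x y zs)
  then show ?case using assms by (auto intro!: mult_mono simp: wt_nonneg')
qed auto

lemma wt_zero:
  assumes "\<And>x y. \<not> E x y \<Longrightarrow> W x y = 0" "\<not> successively E xs"
  shows "wt W xs = 0"
  using assms(2) by (induction xs rule: induct_list012) (auto simp: assms(1))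

definition cycles :: "'a set \<Rightarrow> ('a \<Rightarrow> 'a \<Rightarrow> bool) \<Rightarrow> nat \<Rightarrow> 'a list set" where
  "cycles V E k = {xs \<in> lists_of V k. distinct xs \<and> successively E (xs @ [hd xs])}"

lemma finite_cycles: "finite V \<Longrightarrow> finite (cycles V E k)"
  unfolding cycles_def using finite_lists_of[of V k] by simp

text \<open>The weights \<open>1 / sqrt (max (dg x) (dg y))\<close> have three merits: the squares
  in a row sum to at most 1, no entry exceeds \<open>1 / sqrt d\<close>, and the vector
  \<open>u\<close> of square roots of degrees satisfies \<open>W u \<ge> sqrt d * u\<close>. The
  last gives \<open>tr l \<ge> d ^ l\<close>. Since \<open>tr 0 = card V\<close>,
  \<open>large\<close> and log-convexity yield \<open>tr l \<ge> 8 * l ^ 2 * tr (l - 1)\<close>, so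
  walks with repetitions use up at most half of \<open>tr l\<close>. A genuine cycle weighs at most
  \<open>1 / d ^ l\<close>.\<close>

lemma many_cycles_min_degree:
  fixes d :: real
  assumes fin: "finite V" and ne: "V \<noteq> {}" and sym: "\<And>x y. E x y \<Longrightarrow> E y x" and irr: "\<And>x. \<not> E x x"
    and deg: "\<And>x. x \<in> V \<Longrightarrow> real (card {y\<in>V. E x y}) \<ge> d" and d: "d > 0" and l: "l \<ge> 1"
    and large: "(8 * (real l)\<^sup>2) ^ l * real (card V) \<le> d ^ l"
  shows "real (card (cycles V E (2 * l))) \<ge> d ^ (2 * l) / 2"
proof -
  define dg where "dg x = real (card {y\<in>V. E x y})" for x
  define W where "W x y = (if E x y \<and> x \<in> V \<and> y \<in> V then 1 / sqrt (max (dg x) (dg y)) else 0)" for x y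
  have dgd: "dg x \<ge> d" if "x \<in> V" for x using deg that by (simp add: dg_def)
  interpret weighted_graph V W
    by standard (use fin sym in \<open>auto simp: W_def max.commute dg_def\<close>)
  have Wle: "W x y \<le> 1 / sqrt d" for x y
  proof (cases "E x y \<and> x \<in> V \<and> y \<in> V")
    case True
    then have "sqrt d \<le> sqrt (max (dg x) (dg y))" using dgd[of x] by simp
    then show ?thesis using d True by (simp add: W_def frac_le)
  qed (use d in \<open>auto simp: W_def\<close>)
  have mom1: "mom 1 x = (\<Sum>y\<in>V. (W x y)\<^sup>2)" if "x \<in> V" for x
    using that wpow_1 by (simp add: mom_sq cong: sum.cong)
  have Wsq: "(W x y)\<^sup>2 = (if E x y then 1 / max (dg x) (dg y) else 0)" if "x \<in> V" "y \<in> V" for x y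
    using dgd[OF that(1)] d that by (auto simp: W_def power_divide)
  have le1: "mom 1 x \<le> 1" if x: "x \<in> V" for x
  proof -
    have pos: "dg x > 0" using dgd[OF x] d by simp
    have "mom 1 x \<le> (\<Sum>y\<in>V. if E x y then 1 / dg x else 0)"
      unfolding mom1[OF x]
      by (rule sum_mono) (use x pos in \<open>auto simp: Wsq intro!: frac_le\<close>)
    also have "\<dots> = (\<Sum>y\<in>{y\<in>V. E x y}. 1 / dg x)" using fin by (simp add: sum.If_cases Int_def)
    also have "\<dots> = 1" using pos by (simp add: dg_def)
    finally show ?thesis .
  qed
  have pos: "mom 1 x > 0" if x: "x \<in> V" for x
  proof -
    have "dg x > 0" using dgd[OF x] d by simp
    then obtain y where y: "y \<in> V" "E x y" unfolding dg_def by (auto simp: card_gt_0_iff)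
    have "0 < (W x y)\<^sup>2" using Wsq[OF x y(1)] y \<open>dg x > 0\<close> by (simp add: max_def)
    also have "\<dots> \<le> mom 1 x" unfolding mom1[OF x] using y fin by (intro member_le_sum) auto
    finally show ?thesis .
  qed
  \<comment> \<open>An approximate eigenvector: each of the \<open>dg x\<close> neighbours
    \<open>y\<close> contributes at least \<open>sqrt d / sqrt (dg x)\<close> to row
    \<open>x\<close>, whichever of the two degrees is larger.\<close>
  define u where "u x = sqrt (dg x)" for x
  have u0: "u x \<ge> 0" for x by (simp add: u_def dg_def)
  have Wu: "(\<Sum>y\<in>V. W x y * u y) \<ge> sqrt d * u x" if x: "x \<in> V" for x
  proof -
    have px: "dg x > 0" using dgd[OF x] d by simp
    have "sqrt d * u x = (\<Sum>y\<in>{y\<in>V. E x y}. sqrt d / sqrt (dg x))"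
    proof -
      have "(\<Sum>y\<in>{y\<in>V. E x y}. sqrt d / sqrt (dg x)) = dg x * (sqrt d / sqrt (dg x))"
        by (simp add: dg_def)
      also have "\<dots> = sqrt d * (dg x / sqrt (dg x))" by simp
      also have "dg x / sqrt (dg x) = u x" using px by (simp add: u_def real_div_sqrt)
      finally show ?thesis by simp
    qed
    also have "\<dots> = (\<Sum>y\<in>V. if E x y then sqrt d / sqrt (dg x) else 0)"
      using fin by (simp add: sum.If_cases Int_def)
    also have "\<dots> \<le> (\<Sum>y\<in>V. W x y * u y)"
    proof (rule sum_mono)
      fix y assume y: "y \<in> V"
      have py: "dg y > 0" "dg y \<ge> d" using dgd[OF y] d by simp_all
      have "sqrt d / sqrt (dg x) \<le> sqrt (dg y) / sqrt (max (dg x) (dg y))"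
      proof (cases "dg x \<le> dg y")
        case True
        have "sqrt d / sqrt (dg x) \<le> 1" using dgd[OF x] px d by simp
        then show ?thesis using True py by (simp add: max_def)
      next
        case False
        then show ?thesis using py px by (simp add: max_def divide_right_mono)
      qed
      then show "(if E x y then sqrt d / sqrt (dg x) else 0) \<le> W x y * u y"
        using x y by (simp add: W_def u_def)
    qed
    finally show ?thesis .
  qed
  have Pu: "(\<Sum>y\<in>V. P m x y * u y) \<ge> sqrt d ^ m * u x" if "x \<in> V" for m x
    using that
  proof (induction m arbitrary: x)
    case 0
    then show ?case using fin by (simp add: if_distrib[of "\<lambda>z. z * _"] cong: if_cong)
  next
    case (Suc m)
    have "sqrt d ^ Suc m * u x \<le> sqrt d ^ m * (\<Sum>z\<in>V. W x z * u z)"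
      using mult_left_mono[OF Wu[OF Suc.prems], of "sqrt d ^ m"] d by (simp add: mult_ac)
    also have "\<dots> = (\<Sum>z\<in>V. W x z * (sqrt d ^ m * u z))" by (simp add: sum_distrib_left mult_ac)
    also have "\<dots> \<le> (\<Sum>z\<in>V. W x z * (\<Sum>y\<in>V. P m z y * u y))"
      using Suc.IH nonneg by (intro sum_mono mult_left_mono) auto
    also have "\<dots> = (\<Sum>z\<in>V. \<Sum>y\<in>V. W x z * P m z y * u y)" by (simp add: sum_distrib_left mult_ac)
    also have "\<dots> = (\<Sum>y\<in>V. \<Sum>z\<in>V. W x z * P m z y * u y)" by (rule sum.swap)
    also have "\<dots> = (\<Sum>y\<in>V. P (Suc m) x y * u y)" by (simp add: wpow.simps(2) sum_distrib_right)
    finally show ?case .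
  qed
  \<comment> \<open>The quadratic form of the \<open>l\<close>-th matrix power at \<open>u\<close>
    is at least \<open>sqrt d ^ l * U\<close>, and by Cauchy-Schwarz at most \<open>U\<close> times
    the Frobenius norm, whose square is \<open>tr l\<close>.\<close>
  have trl: "tr l \<ge> d ^ l"
  proof -
    define U where "U = (\<Sum>x\<in>V. (u x)\<^sup>2)"
    have u1: "(u x)\<^sup>2 > 0" if "x \<in> V" for x using dgd[OF that] d by (simp add: u_def)
    have Upos: "U > 0" unfolding U_def
      by (rule sum_pos) (use fin ne u1 in auto)
    have "sqrt d ^ l * U = (\<Sum>x\<in>V. u x * (sqrt d ^ l * u x))"
      by (simp add: U_def sum_distrib_left power2_eq_square mult_ac)
    also have "\<dots> \<le> (\<Sum>x\<in>V. u x * (\<Sum>y\<in>V. P l x y * u y))"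
      using Pu u0 by (intro sum_mono mult_left_mono) auto
    also have "\<dots> = (\<Sum>(x, y)\<in>V \<times> V. (u x * u y) * P l x y)"
      by (simp add: sum_distrib_left sum.cartesian_product[symmetric] mult_ac)
    finally have 1: "sqrt d ^ l * U \<le> (\<Sum>(x, y)\<in>V \<times> V. (u x * u y) * P l x y)" .
    have "(sqrt d ^ l * U)\<^sup>2 \<le> (\<Sum>(x, y)\<in>V \<times> V. (u x * u y) * P l x y)\<^sup>2"
      using 1 d Upos by (intro power_mono) auto
    also have "\<dots> \<le> (\<Sum>(x, y)\<in>V \<times> V. (u x * u y)\<^sup>2) * tr l"
      using Cauchy_Schwarz_ineq_sum[of "\<lambda>(x, y). u x * u y" "\<lambda>(x, y). P l x y" "V \<times> V"]
      by (simp add: tr_sq case_prod_unfold)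
    also have "(\<Sum>(x, y)\<in>V \<times> V. (u x * u y)\<^sup>2) = U\<^sup>2"
      by (simp add: U_def sum.cartesian_product[symmetric] power2_eq_square[of "sum _ _"] sum_product power_mult_distrib)
    finally have "(sqrt d ^ l)\<^sup>2 * U\<^sup>2 \<le> tr l * U\<^sup>2" by (simp add: power_mult_distrib mult.commute)
    then have "(sqrt d ^ l)\<^sup>2 \<le> tr l" using Upos by simp
    moreover have "(sqrt d ^ l)\<^sup>2 = d ^ l" using d by (metis less_imp_le power_mult mult.commute real_sqrt_pow2)
    ultimately show ?thesis by simp
  qed
  have trpos: "tr m > 0" for m
    unfolding tr_def by (rule sum_pos) (use fin ne mom_pos pos in auto)
  have tr0: "tr 0 = real (card V)" by (simp add: tr_def mom_0)
  have "tr (Suc (l - 1)) \<ge> (8 * (real l)\<^sup>2) * tr (l - 1)"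
    by (rule logconvex_ratio[of tr, OF trpos tr_logconvex]) (use l large trl tr0 in auto)
  then have ratio: "tr l \<ge> (8 * (real l)\<^sup>2) * tr (l - 1)" using l by simp
  have "tr l / 2 \<le> tr l - (2 * real l)\<^sup>2 * tr (l - 1)" using ratio by (simp add: power_mult_distrib)
  also have "\<dots> \<le> (\<Sum>xs | xs \<in> lists_of V (2 * l) \<and> distinct xs. cwt xs)"
    by (rule sum_cwt_distinct) (use l pos le1 irr in \<open>auto simp: W_def\<close>)
  also have "\<dots> \<le> (\<Sum>xs\<in>cycles V E (2 * l). (1 / sqrt d) ^ (2 * l))"
  proof -
    have z: "cwt xs = 0" if "\<not> successively E (xs @ [hd xs])" for xs
      unfolding cwt_def by (rule wt_zero[of E]) (use that in \<open>auto simp: W_def\<close>)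
    have "(\<Sum>xs | xs \<in> lists_of V (2 * l) \<and> distinct xs. cwt xs) = (\<Sum>xs\<in>cycles V E (2 * l). cwt xs)"
      by (rule sum.mono_neutral_right) (use fin z in \<open>auto simp: cycles_def finite_lists_of\<close>)
    also have "\<dots> \<le> (\<Sum>xs\<in>cycles V E (2 * l). (1 / sqrt d) ^ (2 * l))"
    proof (rule sum_mono)
      fix xs assume "xs \<in> cycles V E (2 * l)"
      then have "length xs = 2 * l" by (simp add: cycles_def lists_of_def)
      then show "cwt xs \<le> (1 / sqrt d) ^ (2 * l)"
        unfolding cwt_def using wt_le[of W "1 / sqrt d" "xs @ [hd xs]"] Wle nonneg d by simp
    qed
    finally show ?thesis .
  qed
  also have "\<dots> = real (card (cycles V E (2 * l))) / d ^ l"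
    using d by (simp add: power_mult power_divide)
  finally have "tr l / 2 \<le> real (card (cycles V E (2 * l))) / d ^ l" .
  then have "d ^ l / 2 \<le> real (card (cycles V E (2 * l))) / d ^ l" using trl by linarith
  then have "d ^ l / 2 * d ^ l \<le> real (card (cycles V E (2 * l)))" using d by (simp add: pos_le_divide_eq)
  then show ?thesis by (simp add: mult_2 power_add)
qed

text \<open>Choose a smallest nonempty vertex set that spans at least \<open>d\<close> edges per
  vertex. Deleting a vertex of degree below \<open>d\<close> would keep this ratio; it cannot empty
  the set, since a single vertex spans no edge.\<close>

lemma min_degree_subgraph:
  assumes fin: "finite U" and G: "G \<subseteq> {e. e \<subseteq> U \<and> card e = 2}" and d: "d > 0"
    and large: "real (card G) \<ge> d * real (card U)" and ne: "U \<noteq> {}"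
  shows "\<exists>V. V \<subseteq> U \<and> V \<noteq> {} \<and> (\<forall>x\<in>V. real (card {y\<in>V. {x, y} \<in> G}) \<ge> d)"
proof -
  define good where "good V \<longleftrightarrow> V \<subseteq> U \<and> V \<noteq> {} \<and> real (card {e\<in>G. e \<subseteq> V}) \<ge> d * real (card V)" for V
  have finG: "finite G" using G fin by (intro finite_subset[of G "Pow U"]) auto
  have "{e\<in>G. e \<subseteq> U} = G" using G by auto
  then have "good U" using ne large by (simp add: good_def)
  then obtain V where V: "good V" and min: "\<And>V'. good V' \<Longrightarrow> card V \<le> card V'"
    using ex_has_least_nat[of good U card] by blast
  have finV: "finite V" using V fin by (auto simp: good_def intro: finite_subset)
  have "real (card {y\<in>V. {x, y} \<in> G}) \<ge> d" if x: "x \<in> V" for x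
  proof (rule ccontr)
    assume less: "\<not> ?thesis"
    have c1: "card (V - {x}) = card V - 1" "card V \<ge> 1"
      using x finV by (auto simp: card_gt_0_iff Suc_le_eq)
    have sub: "{e\<in>G. e \<subseteq> V} \<subseteq> {e\<in>G. e \<subseteq> V - {x}} \<union> (\<lambda>y. {x, y}) ` {y\<in>V. {x, y} \<in> G}"
    proof
      fix e assume e: "e \<in> {e\<in>G. e \<subseteq> V}"
      show "e \<in> {e\<in>G. e \<subseteq> V - {x}} \<union> (\<lambda>y. {x, y}) ` {y\<in>V. {x, y} \<in> G}"
      proof (cases "x \<in> e")
        case True
        have "card e = 2" using e G by auto
        then obtain y where "e = {x, y}" using True by (auto simp: card_2_iff)
        then show ?thesis using e by auto
      qed (use e in auto)
    qed
    have "card {e\<in>G. e \<subseteq> V} \<le> card ({e\<in>G. e \<subseteq> V - {x}} \<union> (\<lambda>y. {x, y}) ` {y\<in>V. {x, y} \<in> G})"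
      by (rule card_mono[OF _ sub]) (use finG finV in auto)
    also have "\<dots> \<le> card {e\<in>G. e \<subseteq> V - {x}} + card ((\<lambda>y. {x, y}) ` {y\<in>V. {x, y} \<in> G})"
      by (rule card_Un_le)
    also have "\<dots> \<le> card {e\<in>G. e \<subseteq> V - {x}} + card {y\<in>V. {x, y} \<in> G}"
      using finV by (intro add_left_mono card_image_le) auto
    finally have "real (card {e\<in>G. e \<subseteq> V}) \<le> real (card {e\<in>G. e \<subseteq> V - {x}}) + real (card {y\<in>V. {x, y} \<in> G})"
      by linarith
    then have gt: "real (card {e\<in>G. e \<subseteq> V - {x}}) > d * real (card (V - {x}))"
      using V less c1 by (simp add: good_def of_nat_diff algebra_simps)
    have "V - {x} \<noteq> {}"
    proof
      assume "V - {x} = {}"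
      moreover have "{e\<in>G. e \<subseteq> {}} = {}" using G by auto
      ultimately have "card {e\<in>G. e \<subseteq> V - {x}} = 0" by (metis card.empty)
      then have "d * real (card (V - {x})) < 0" using gt by simp
      then show False using d by (simp add: mult_less_0_iff)
    qed
    then have "good (V - {x})" using V gt by (auto simp: good_def)
    then show False using min[of "V - {x}"] c1 by simp
  qed
  then show ?thesis using V by (auto simp: good_def)
qed

text \<open>The bound is affine in the number of edges, so that it can be averaged over random
  graphs with a fixed number of vertices. It is non-positive up to density \<open>\<tau>\<close>,
  and above \<open>\<tau>\<close> it is dominated by \<open>d ^ (2 * l) / 2\<close>.\<close>

lemma many_cycles:
  fixes \<tau> :: real
  assumes fin: "finite U" and G: "G \<subseteq> {e. e \<subseteq> U \<and> card e = 2}" and ne: "U \<noteq> {}"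
    and \<tau>: "\<tau> > 0" and l: "l \<ge> 1" and large: "(8 * (real l)\<^sup>2) ^ l * real (card U) \<le> \<tau> ^ l"
  shows "real (card (cycles U (\<lambda>x y. {x, y} \<in> G) (2 * l))) \<ge> \<tau> ^ (2 * l - 1) * (real (card G) / real (card U) - \<tau>) / 2"
proof (cases "real (card G) / real (card U) \<le> \<tau>")
  case True
  then have "\<tau> ^ (2 * l - 1) * (real (card G) / real (card U) - \<tau>) / 2 \<le> 0"
    using \<tau> by (simp add: mult_nonneg_nonpos)
  then show ?thesis by (meson of_nat_0_le_iff order_trans)
next
  case False
  define d where "d = real (card G) / real (card U)"
  have d: "d > \<tau>" "d > 0" using False \<tau> by (auto simp: d_def)
  have cU: "card U > 0" using fin ne by (simp add: card_gt_0_iff)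
  obtain V where V: "V \<subseteq> U" "V \<noteq> {}" "\<And>x. x \<in> V \<Longrightarrow> real (card {y\<in>V. {x, y} \<in> G}) \<ge> d"
    using min_degree_subgraph[OF fin G d(2) _ ne] cU by (auto simp: d_def)
  have "real (card (cycles V (\<lambda>x y. {x, y} \<in> G) (2 * l))) \<ge> d ^ (2 * l) / 2"
  proof (rule many_cycles_min_degree[OF _ V(2) _ _ V(3) d(2) l])
    show "finite V" using V fin finite_subset by blast
    show "{x, y} \<in> G \<Longrightarrow> {y, x} \<in> G" for x y by (simp add: insert_commute)
    show "{x, x} \<notin> G" for x using G by auto
    have "real (card V) \<le> real (card U)" using V fin by (simp add: card_mono)
    then have "(8 * (real l)\<^sup>2) ^ l * real (card V) \<le> (8 * (real l)\<^sup>2) ^ l * real (card U)"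
      by (intro mult_left_mono) auto
    also have "\<dots> \<le> \<tau> ^ l" by (rule large)
    also have "\<dots> \<le> d ^ l" using d \<tau> by (intro power_mono) auto
    finally show "(8 * (real l)\<^sup>2) ^ l * real (card V) \<le> d ^ l" .
  qed
  also have "card (cycles V (\<lambda>x y. {x, y} \<in> G) (2 * l)) \<le> card (cycles U (\<lambda>x y. {x, y} \<in> G) (2 * l))"
    using V finite_cycles[OF fin] by (intro card_mono) (auto simp: cycles_def lists_of_def)
  finally have 1: "d ^ (2 * l) / 2 \<le> real (card (cycles U (\<lambda>x y. {x, y} \<in> G) (2 * l)))" by simp
  have "\<tau> ^ (2 * l - 1) * (d - \<tau>) \<le> d ^ (2 * l - 1) * d"
    using d \<tau> by (intro mult_mono power_mono) auto
  also have "\<dots> = d ^ (2 * l)" using l by (simp flip: power_Suc2)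
  finally show ?thesis using 1 by (simp add: d_def)
qed

section \<open>Random samples, pruning and cyclic pairs\<close>

definition avg :: "'w set \<Rightarrow> ('w \<Rightarrow> real) \<Rightarrow> real" where
  "avg \<Omega> f = (\<Sum>\<omega>\<in>\<Omega>. f \<omega>) / real (card \<Omega>)"

definition freq :: "'w set \<Rightarrow> ('w \<Rightarrow> bool) \<Rightarrow> real" where
  "freq \<Omega> P = real (card {\<omega>\<in>\<Omega>. P \<omega>}) / real (card \<Omega>)"

lemma avg_sum: "avg \<Omega> (\<lambda>\<omega>. \<Sum>x\<in>X. f x \<omega>) = (\<Sum>x\<in>X. avg \<Omega> (f x))"
  unfolding avg_def by (subst sum.swap) (simp add: sum_divide_distrib)

lemma avg_add: "avg \<Omega> (\<lambda>\<omega>. f \<omega> + g \<omega>) = avg \<Omega> f + avg \<Omega> g"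
  by (simp add: avg_def sum.distrib add_divide_distrib)

lemma avg_diff: "avg \<Omega> (\<lambda>\<omega>. f \<omega> - g \<omega>) = avg \<Omega> f - avg \<Omega> g"
  by (simp add: avg_def sum_subtractf diff_divide_distrib)

lemma avg_cmult: "avg \<Omega> (\<lambda>\<omega>. c * f \<omega>) = c * avg \<Omega> f"
  by (simp add: avg_def sum_distrib_left)

lemma avg_const: "finite \<Omega> \<Longrightarrow> \<Omega> \<noteq> {} \<Longrightarrow> avg \<Omega> (\<lambda>_. c) = c"
  by (simp add: avg_def)

lemma avg_mono: "(\<And>\<omega>. \<omega> \<in> \<Omega> \<Longrightarrow> f \<omega> \<le> g \<omega>) \<Longrightarrow> avg \<Omega> f \<le> avg \<Omega> g"
  unfolding avg_def by (intro divide_right_mono sum_mono) auto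

lemma avg_card:
  assumes "finite \<Omega>" "finite X"
  shows "avg \<Omega> (\<lambda>\<omega>. real (card {x\<in>X. R \<omega> x})) = (\<Sum>x\<in>X. freq \<Omega> (\<lambda>\<omega>. R \<omega> x))"
proof -
  have "(\<Sum>\<omega>\<in>\<Omega>. card {x\<in>X. R \<omega> x}) = (\<Sum>x\<in>X. card {\<omega>\<in>\<Omega>. R \<omega> x})"
    using sum.swap_restrict[OF assms, of "\<lambda>_ _. 1::nat" R] by simp
  then have "real (\<Sum>\<omega>\<in>\<Omega>. card {x\<in>X. R \<omega> x}) = real (\<Sum>x\<in>X. card {\<omega>\<in>\<Omega>. R \<omega> x})" by simp
  then have "(\<Sum>\<omega>\<in>\<Omega>. real (card {x\<in>X. R \<omega> x})) = (\<Sum>x\<in>X. real (card {\<omega>\<in>\<Omega>. R \<omega> x}))"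
    unfolding of_nat_sum .
  then show ?thesis by (simp add: avg_def freq_def sum_divide_distrib)
qed

lemma freq_nonneg: "freq \<Omega> P \<ge> 0" by (simp add: freq_def)

lemma freq_mono: "finite \<Omega> \<Longrightarrow> (\<And>\<omega>. \<omega> \<in> \<Omega> \<Longrightarrow> P \<omega> \<Longrightarrow> Q \<omega>) \<Longrightarrow> freq \<Omega> P \<le> freq \<Omega> Q"
  unfolding freq_def by (intro divide_right_mono of_nat_mono card_mono) auto

lemma freq_Times:
  "freq (A \<times> B) (\<lambda>\<omega>. P (fst \<omega>) \<and> Q (snd \<omega>)) = freq A P * freq B Q"
proof -
  have "{\<omega>\<in>A \<times> B. P (fst \<omega>) \<and> Q (snd \<omega>)} = {a\<in>A. P a} \<times> {b\<in>B. Q b}" by auto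
  then show ?thesis by (simp add: freq_def card_cartesian_product)
qed

section \<open>Random sets of fixed size\<close>

definition subsets_of_size :: "'a set \<Rightarrow> nat \<Rightarrow> 'a set set" where
  "subsets_of_size V M = {U. U \<subseteq> V \<and> card U = M}"

lemma finite_subsets_of_size: "finite V \<Longrightarrow> finite (subsets_of_size V M)"
  unfolding subsets_of_size_def by simp

lemma subsets_of_size_nonempty:
  assumes "M \<le> card V"
  shows "subsets_of_size V M \<noteq> {}"
proof -
  obtain U where "U \<subseteq> V" "card U = M" using obtain_subset_with_card_n[OF assms] by blast
  then show ?thesis by (auto simp: subsets_of_size_def)
qed

lemma card_supersets:
  assumes fin: "finite V" and W: "W \<subseteq> V" "card W \<le> M"
  shows "card {U \<in> subsets_of_size V M. W \<subseteq> U} = (card V - card W) choose (M - card W)"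
proof -
  have finW: "finite W" using W fin finite_subset by blast
  have "{U \<in> subsets_of_size V M. W \<subseteq> U} = (\<lambda>B. B \<union> W) ` {B. B \<subseteq> V - W \<and> card B = M - card W}"
  proof (intro equalityI subsetI)
    fix U assume U: "U \<in> {U \<in> subsets_of_size V M. W \<subseteq> U}"
    then have "U = (U - W) \<union> W" "U - W \<subseteq> V - W" "card (U - W) = M - card W"
      using finW by (auto simp: subsets_of_size_def card_Diff_subset)
    then show "U \<in> (\<lambda>B. B \<union> W) ` {B. B \<subseteq> V - W \<and> card B = M - card W}" by blast
  next
    fix U assume "U \<in> (\<lambda>B. B \<union> W) ` {B. B \<subseteq> V - W \<and> card B = M - card W}"
    then obtain B where B: "U = B \<union> W" "B \<subseteq> V - W" "card B = M - card W" by blast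
    have "card U = card B + card W" unfolding B(1)
      by (rule card_Un_disjoint) (use B fin finW in \<open>auto intro: finite_subset\<close>)
    then show "U \<in> {U \<in> subsets_of_size V M. W \<subseteq> U}"
      using B W by (auto simp: subsets_of_size_def)
  qed
  moreover have "inj_on (\<lambda>B. B \<union> W) {B. B \<subseteq> V - W \<and> card B = M - card W}"
    by (auto simp: inj_on_def)
  ultimately show ?thesis
    using fin W finW by (simp add: card_image n_subsets card_Diff_subset)
qed

text \<open>The binomial coefficients change by factors \<open>(M - w) / (n - w)\<close>, each at
  most \<open>M / n\<close> and, as long as less than half of \<open>M\<close> is used up, at least
  half of that.\<close>

lemma binomial_ratio_bounds:
  assumes "w \<le> M" "M \<le> n" "n > 0"
  shows "real ((n - w) choose (M - w)) \<le> (real M / real n) ^ w * real (n choose M)"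
    and "2 * w \<le> M \<Longrightarrow> (real M / (2 * real n)) ^ w * real (n choose M) \<le> real ((n - w) choose (M - w))"
proof -
  have step: "real (n - w) * real ((n - Suc w) choose (M - Suc w)) = real (M - w) * real ((n - w) choose (M - w))"
    if "Suc w \<le> M" for w
  proof -
    define a b where "a = M - Suc w" and "b = n - Suc w"
    have a: "M - w = Suc a" "M - Suc w = a" and b: "n - w = Suc b" "n - Suc w = b"
      using that assms(2) by (auto simp: a_def b_def)
    have "Suc a * (Suc b choose Suc a) = Suc b * (b choose a)" by (rule Suc_times_binomial)
    then show ?thesis unfolding a b by (metis of_nat_mult)
  qed
  show "real ((n - w) choose (M - w)) \<le> (real M / real n) ^ w * real (n choose M)"
    using assms(1)
  proof (induction w)
    case (Suc w)
    have nw: "real (n - w) > 0" using Suc assms by simp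
    have "real (M - w) / real (n - w) \<le> real M / real n"
    proof -
      have "real M * real w \<le> real n * real w" using assms by (intro mult_right_mono) auto
      then have "real (M - w) * real n \<le> real M * real (n - w)"
        using Suc.prems assms by (simp add: of_nat_diff algebra_simps)
      then show ?thesis using nw assms by (simp add: frac_le_eq divide_le_eq le_divide_eq mult.commute)
    qed
    moreover have "real ((n - Suc w) choose (M - Suc w)) = real (M - w) / real (n - w) * real ((n - w) choose (M - w))"
      using step[OF Suc.prems] nw by (simp add: nonzero_eq_divide_eq mult.commute)
    ultimately have "real ((n - Suc w) choose (M - Suc w)) \<le> real M / real n * real ((n - w) choose (M - w))"
      by (simp only:) (rule mult_right_mono, auto)
    also have "\<dots> \<le> real M / real n * ((real M / real n) ^ w * real (n choose M))"
      using Suc.IH Suc.prems by (intro mult_left_mono) (linarith, simp)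
    finally show ?case by (simp add: mult_ac)
  qed simp
  show "(real M / (2 * real n)) ^ w * real (n choose M) \<le> real ((n - w) choose (M - w))" if "2 * w \<le> M"
    using that
  proof (induction w)
    case (Suc w)
    have nw: "real (n - w) > 0" using Suc assms by simp
    have "real M / (2 * real n) \<le> real (M - w) / real (n - w)"
    proof -
      have "real M / 2 \<le> real (M - w)" using Suc by simp
      then have "(real M / 2) / real n \<le> real (M - w) / real (n - w)"
        by (intro frac_le) (use nw in auto)
      then show ?thesis by simp
    qed
    then have "real M / (2 * real n) * real ((n - w) choose (M - w)) \<le> real (M - w) / real (n - w) * real ((n - w) choose (M - w))"
      by (intro mult_right_mono) auto
    also have "\<dots> = real ((n - Suc w) choose (M - Suc w))"
      using step[of w] Suc.prems nw by (simp add: field_simps)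
    finally have 1: "real M / (2 * real n) * real ((n - w) choose (M - w)) \<le> real ((n - Suc w) choose (M - Suc w))" .
    have "(real M / (2 * real n)) ^ Suc w * real (n choose M) \<le> real M / (2 * real n) * real ((n - w) choose (M - w))"
      using Suc mult_left_mono[OF Suc.IH, of "real M / (2 * real n)"] by (simp add: mult_ac)
    then show ?case using 1 by linarith
  qed simp
qed

lemma freq_superset_le:
  assumes fin: "finite V" and W: "W \<subseteq> V" and M: "M \<le> card V" "card V > 0"
  shows "freq (subsets_of_size V M) (\<lambda>U. W \<subseteq> U) \<le> (real M / real (card V)) ^ card W"
proof (cases "card W \<le> M")
  case True
  have c: "card (subsets_of_size V M) = card V choose M"
    using fin by (simp add: subsets_of_size_def n_subsets)
  have "real (card V choose M) > 0" using M by simp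
  then show ?thesis
    unfolding freq_def card_supersets[OF fin W True] c
    using binomial_ratio_bounds(1)[OF True M] by (simp add: divide_le_eq)
next
  case False
  have "{U \<in> subsets_of_size V M. W \<subseteq> U} = {}"
    using False fin by (auto simp: subsets_of_size_def) (meson card_mono finite_subset)
  then show ?thesis unfolding freq_def by (metis card.empty divide_eq_0_iff of_nat_0 of_nat_0_le_iff zero_le_power divide_nonneg_nonneg)
qed

lemma freq_superset_ge:
  assumes fin: "finite V" and W: "W \<subseteq> V" and M: "M \<le> card V" "2 * card W \<le> M" "M > 0"
  shows "freq (subsets_of_size V M) (\<lambda>U. W \<subseteq> U) \<ge> (real M / (2 * real (card V))) ^ card W"
proof -
  have c: "card (subsets_of_size V M) = card V choose M"
    using fin by (simp add: subsets_of_size_def n_subsets)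
  have W': "card W \<le> M" using M by simp
  have V0: "card V > 0" using M by simp
  have "real (card V choose M) > 0" using M by simp
  then show ?thesis
    unfolding freq_def card_supersets[OF fin W W'] c
    using binomial_ratio_bounds(2)[OF W' M(1) V0 M(2)] by (simp add: le_divide_eq)
qed

lemma freq_PiE:
  assumes fin: "finite I" and Q: "Q \<subseteq> I" and S: "\<And>i. i \<in> I \<Longrightarrow> finite (S i) \<and> S i \<noteq> {}"
  shows "freq (PiE I S) (\<lambda>\<phi>. \<forall>i\<in>Q. \<phi> i = f i) =
    (if \<forall>i\<in>Q. f i \<in> S i then (\<Prod>i\<in>Q. 1 / real (card (S i))) else 0)"
proof (cases "\<forall>i\<in>Q. f i \<in> S i")
  case True
  let ?T = "\<lambda>i. if i \<in> Q then {f i} else S i"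
  have eq: "{\<phi>\<in>PiE I S. \<forall>i\<in>Q. \<phi> i = f i} = PiE I ?T"
  proof (intro equalityI subsetI)
    fix \<phi> assume "\<phi> \<in> {\<phi>\<in>PiE I S. \<forall>i\<in>Q. \<phi> i = f i}"
    then show "\<phi> \<in> PiE I ?T" unfolding PiE_iff by simp
  next
    fix \<phi> assume \<phi>: "\<phi> \<in> PiE I ?T"
    have "\<phi> i \<in> S i" if "i \<in> I" for i using PiE_mem[OF \<phi> that] True by (auto split: if_splits)
    moreover have "\<phi> i = f i" if "i \<in> Q" for i using PiE_mem[OF \<phi>, of i] Q that by auto
    ultimately show "\<phi> \<in> {\<phi>\<in>PiE I S. \<forall>i\<in>Q. \<phi> i = f i}" using \<phi> by (auto simp: PiE_def)
  qed
  have c0: "real (card (S i)) > 0" if "i \<in> I" for i using S[OF that] by (simp add: card_gt_0_iff)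
  have "real (card (PiE I ?T)) = (\<Prod>i\<in>I. real (card (?T i)))" using fin by (simp add: card_PiE)
  moreover have "real (card (PiE I S)) = (\<Prod>i\<in>I. real (card (S i)))" using fin by (simp add: card_PiE)
  ultimately have "freq (PiE I S) (\<lambda>\<phi>. \<forall>i\<in>Q. \<phi> i = f i) = (\<Prod>i\<in>I. real (card (?T i)) / real (card (S i)))"
    unfolding freq_def eq by (simp add: prod_dividef)
  also have "\<dots> = (\<Prod>i\<in>I. if i \<in> Q then 1 / real (card (S i)) else 1)"
    using c0 by (intro prod.cong refl) (auto simp: less_imp_neq[symmetric])
  also have "\<dots> = (\<Prod>i\<in>Q. 1 / real (card (S i)))"
    using fin Q by (simp add: prod.inter_restrict[symmetric] Int_absorb1 Int_commute)
  finally show ?thesis using True by simp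
next
  case False
  then obtain j where j: "j \<in> Q" "f j \<notin> S j" by blast
  have emp: "{\<phi>\<in>PiE I S. \<forall>i\<in>Q. \<phi> i = f i} = {}"
  proof (rule ccontr)
    assume "\<not> ?thesis"
    then obtain \<phi> where "\<phi> \<in> PiE I S" "\<phi> j = f j" using j(1) by blast
    then show False using j Q PiE_mem[of \<phi> I S j] by auto
  qed
  show ?thesis unfolding if_not_P[OF False] freq_def emp by simp
qed

text \<open>Traces of degree at most \<open>\<theta>\<close> are removed one after the other, together with everything they
  touch; a removed element is charged to the trace that was responsible.\<close>

lemma prune:
  fixes \<theta> :: real
  assumes "finite H"
  shows "\<exists>H' \<pi>. H' \<subseteq> H \<and> (\<forall>e\<in>H'. \<forall>\<tau>\<in>Tr e. real (card {e'\<in>H'. \<tau> \<in> Tr e'}) > \<theta>) \<and>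
    (\<forall>e\<in>H - H'. \<pi> e \<in> Tr e) \<and> (\<forall>\<tau>. \<theta> \<ge> 0 \<longrightarrow> real (card {e\<in>H - H'. \<pi> e = \<tau>}) \<le> \<theta>)"
  using assms
proof (induction H rule: finite_psubset_induct)
  case (psubset H)
  show ?case
  proof (cases "\<forall>e\<in>H. \<forall>\<tau>\<in>Tr e. real (card {e'\<in>H. \<tau> \<in> Tr e'}) > \<theta>")
    case True
    then show ?thesis by (intro exI[of _ H]) auto
  next
    case False
    then obtain e0 \<tau>0 where e0: "e0 \<in> H" "\<tau>0 \<in> Tr e0" "real (card {e'\<in>H. \<tau>0 \<in> Tr e'}) \<le> \<theta>"
      by (auto simp: not_less)
    define H1 where "H1 = {e\<in>H. \<tau>0 \<notin> Tr e}"
    have "H1 \<subset> H" using e0 by (auto simp: H1_def)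
    from psubset.IH[OF this] obtain H' \<pi> where IH: "H' \<subseteq> H1"
      "\<forall>e\<in>H'. \<forall>\<tau>\<in>Tr e. real (card {e'\<in>H'. \<tau> \<in> Tr e'}) > \<theta>"
      "\<forall>e\<in>H1 - H'. \<pi> e \<in> Tr e" "\<forall>\<tau>. \<theta> \<ge> 0 \<longrightarrow> real (card {e\<in>H1 - H'. \<pi> e = \<tau>}) \<le> \<theta>" by blast
    define \<pi>' where "\<pi>' e = (if \<tau>0 \<in> Tr e then \<tau>0 else \<pi> e)" for e
    show ?thesis
    proof (intro exI[of _ H'] exI[of _ \<pi>'] conjI allI impI)
      show "H' \<subseteq> H" using IH by (auto simp: H1_def)
      show "\<forall>e\<in>H'. \<forall>\<tau>\<in>Tr e. real (card {e'\<in>H'. \<tau> \<in> Tr e'}) > \<theta>" by (rule IH(2))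
      show "\<forall>e\<in>H - H'. \<pi>' e \<in> Tr e" using IH(3) by (auto simp: \<pi>'_def H1_def)
      fix \<tau> assume nn: "\<theta> \<ge> 0"
      show "real (card {e\<in>H - H'. \<pi>' e = \<tau>}) \<le> \<theta>"
      proof (cases "\<tau> = \<tau>0")
        case True
        \<comment> \<open>Once removed, \<open>\<tau>0\<close> belongs to no remaining element, so
          all its charges come from this single step.\<close>
        have "{e\<in>H - H'. \<pi>' e = \<tau>} \<subseteq> {e'\<in>H. \<tau>0 \<in> Tr e'}"
          using IH(3) True by (auto simp: \<pi>'_def H1_def split: if_splits)
        then have "card {e\<in>H - H'. \<pi>' e = \<tau>} \<le> card {e'\<in>H. \<tau>0 \<in> Tr e'}"
          by (intro card_mono) (use psubset.hyps in auto)
        then show ?thesis using e0(3) by linarith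
      next
        case False
        have "{e\<in>H - H'. \<pi>' e = \<tau>} \<subseteq> {e\<in>H1 - H'. \<pi> e = \<tau>}"
          using False by (auto simp: \<pi>'_def H1_def split: if_splits)
        then have "card {e\<in>H - H'. \<pi>' e = \<tau>} \<le> card {e\<in>H1 - H'. \<pi> e = \<tau>}"
          by (intro card_mono) (use psubset.hyps in \<open>auto simp: H1_def\<close>)
        then show ?thesis using IH(4) nn by (meson of_nat_le_iff order_trans)
      qed
    qed
  qed
qed

lemma card_le_fibres:
  fixes \<theta> :: real
  assumes "finite H" "finite T" "\<And>e. e \<in> H \<Longrightarrow> \<pi> e \<in> T" "\<And>\<tau>. real (card {e\<in>H. \<pi> e = \<tau>}) \<le> \<theta>"
  shows "real (card H) \<le> real (card T) * \<theta>"
proof -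
  have "H = (\<Union>\<tau>\<in>T. {e\<in>H. \<pi> e = \<tau>})" using assms(3) by auto
  then have "card H \<le> (\<Sum>\<tau>\<in>T. card {e\<in>H. \<pi> e = \<tau>})" using card_UN_le[OF assms(2)] by metis
  then have "real (card H) \<le> (\<Sum>\<tau>\<in>T. real (card {e\<in>H. \<pi> e = \<tau>}))" by (metis of_nat_le_iff of_nat_sum)
  also have "\<dots> \<le> real (card T) * \<theta>" using assms(4) by (intro sum_bounded_above) auto
  finally show ?thesis .
qed

section \<open>Cycles as lists of cyclic pairs\<close>

definition cpair :: "'a list \<Rightarrow> nat \<Rightarrow> 'a set" where
  "cpair xs i = {xs ! i, xs ! (Suc i mod length xs)}"

lemma successively_cyclic:
  assumes "xs \<noteq> []"
  shows "successively E (xs @ [hd xs]) \<longleftrightarrow> (\<forall>i<length xs. E (xs ! i) (xs ! (Suc i mod length xs)))"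
proof -
  have "(xs @ [hd xs]) ! Suc i = xs ! (Suc i mod length xs)" if "i < length xs" for i
    using that assms by (cases "Suc i = length xs") (auto simp: nth_append hd_conv_nth)
  moreover have "(xs @ [hd xs]) ! i = xs ! i" if "i < length xs" for i using that by (simp add: nth_append)
  ultimately show ?thesis unfolding successively_conv_nth by auto
qed

lemma cpair_card:
  assumes "distinct xs" "length xs \<ge> 2" "i < length xs"
  shows "card (cpair xs i) = 2"
proof -
  have "Suc i mod length xs \<noteq> i"
    using assms by (cases "Suc i = length xs") auto
  moreover have "Suc i mod length xs < length xs" using assms by (intro mod_less_divisor) auto
  ultimately have "xs ! i \<noteq> xs ! (Suc i mod length xs)" using assms by (simp add: nth_eq_iff_index_eq)
  then show ?thesis by (simp add: cpair_def)
qed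

text \<open>If two positions had the same pair, each would be the cyclic successor of the other,
  which happens only for length 2.\<close>

lemma cpair_inj:
  assumes "distinct xs" "length xs \<ge> 3"
  shows "inj_on (cpair xs) {..<length xs}"
proof (rule inj_onI)
  fix i j assume ij: "i \<in> {..<length xs}" "j \<in> {..<length xs}" and eq: "cpair xs i = cpair xs j"
  let ?k = "length xs"
  have lt: "Suc i mod ?k < ?k" "Suc j mod ?k < ?k" using assms by (auto intro: mod_less_divisor)
  show "i = j"
  proof (rule ccontr)
    assume "i \<noteq> j"
    then have "xs ! i \<noteq> xs ! j" using ij assms by (simp add: nth_eq_iff_index_eq)
    then have "xs ! i = xs ! (Suc j mod ?k)" "xs ! j = xs ! (Suc i mod ?k)"
      using eq by (auto simp: cpair_def doubleton_eq_iff)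
    then have "i = Suc j mod ?k" "j = Suc i mod ?k"
      using ij lt assms by (auto simp: nth_eq_iff_index_eq)
    moreover have "Suc m mod ?k = Suc m \<or> Suc m = ?k \<and> Suc m mod ?k = 0" if "m < ?k" for m
      using that by (cases "Suc m = ?k") auto
    ultimately have "i = Suc j \<or> Suc j = ?k \<and> i = 0" "j = Suc i \<or> Suc i = ?k \<and> j = 0"
      using ij by (metis lessThan_iff)+
    then show False using assms(2) by arith
  qed
qed

text \<open>The pairs with index in \<open>J\<close> cover the positions in \<open>J\<close> and
  their cyclic successors. A proper nonempty \<open>J\<close> is not closed under the successor, so
  at least one position is gained.\<close>

lemma card_UN_cpair:
  assumes xs: "distinct xs" "length xs \<ge> 3" and J: "J \<subseteq> {..<length xs}" "J \<noteq> {}"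
  shows "card (\<Union>i\<in>J. cpair xs i) \<ge> (if card J = length xs then length xs else card J + 1)"
proof -
  let ?k = "length xs" and ?s = "\<lambda>i. Suc i mod length xs"
  have k: "?k > 0" using xs(2) by linarith
  have sub: "J \<union> ?s ` J \<subseteq> {..<?k}" using J k by auto
  have "(\<Union>i\<in>J. cpair xs i) = (!) xs ` (J \<union> ?s ` J)" by (auto simp: cpair_def)
  moreover have "inj_on ((!) xs) (J \<union> ?s ` J)"
    by (rule inj_on_nth[OF xs(1)]) (use sub in auto)
  ultimately have c: "card (\<Union>i\<in>J. cpair xs i) = card (J \<union> ?s ` J)" by (simp add: card_image)
  have finJ: "finite (J \<union> ?s ` J)" using sub finite_subset by blast
  show ?thesis
  proof (cases "card J = ?k")
    case True
    then show ?thesis using c card_mono[OF finJ, of J] by auto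
  next
    case False
    have "\<not> ?s ` J \<subseteq> J"
    proof
      assume cl: "?s ` J \<subseteq> J"
      obtain i where i: "i \<in> J" using J by auto
      have "(i + m) mod ?k \<in> J" for m
      proof (induction m)
        case 0
        then show ?case using i J by auto
      next
        case (Suc m)
        then have "Suc ((i + m) mod ?k) mod ?k \<in> J" using cl by auto
        then show ?case by (simp add: mod_Suc_eq)
      qed
      moreover have "j = (i + (j + ?k - i)) mod ?k" if "j < ?k" for j
        using that i J by auto
      ultimately have "{..<?k} \<subseteq> J" by (metis lessThan_iff subsetI)
      then show False using J False by (metis card_lessThan subset_antisym)
    qed
    then have "J \<subset> J \<union> ?s ` J" by auto
    then have "card J < card (J \<union> ?s ` J)" using finJ by (rule psubset_card_mono[rotated])
    then show ?thesis using c False by simp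
  qed
qed

text \<open>Inserting a common neighbour \<open>x\<close> of the first two vertices replaces one
  pair of the cycle by two pairs of \<open>G\<close> and lengthens the cycle by one.\<close>

lemma cycle_from_triangles:
  assumes "{u, v} \<in> G" "u \<noteq> v"
    and ext: "\<And>u v X. {u, v} \<in> G \<Longrightarrow> finite X \<Longrightarrow> card X < k \<Longrightarrow> \<exists>x. x \<notin> X \<and> {u, x} \<in> G \<and> {v, x} \<in> G"
    and s: "2 \<le> s" "s \<le> k"
  shows "\<exists>xs. length xs = s \<and> distinct xs \<and> successively (\<lambda>x y. {x, y} \<in> G) (xs @ [hd xs])"
  using s
proof (induction s rule: dec_induct)
  case base
  \<comment> \<open>The start is the degenerate cycle that runs through one pair back and
    forth.\<close>
  show ?case by (intro exI[of _ "[u, v]"]) (use assms(1,2) in \<open>auto simp: insert_commute\<close>)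
next
  case (step s)
  have "s \<le> k" using step.prems by simp
  from step.IH[OF this] obtain xs where xs: "length xs = s" "distinct xs"
    "successively (\<lambda>x y. {x, y} \<in> G) (xs @ [hd xs])" by blast
  then obtain a b ys where ab: "xs = a # b # ys" using step(1) by (metis Suc_le_length_iff numeral_2_eq_2)
  have "card (set xs) < k" using xs step distinct_card by fastforce
  moreover have "{a, b} \<in> G" using xs ab by simp
  ultimately obtain x where x: "x \<notin> set xs" "{a, x} \<in> G" "{b, x} \<in> G" using ext[of a b "set xs"] by auto
  show ?case
    by (intro exI[of _ "a # x # b # ys"]) (use xs ab x in \<open>auto simp: insert_commute\<close>)
qed

text \<open>A property of the edge set alone: for the containers the edges of \<open>H\<close> play
  the role of vertices, so a Berge cycle has to be a set of them.\<close>

definition is_berge :: "nat \<Rightarrow> 'a set set \<Rightarrow> bool" where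
  "is_berge k B \<longleftrightarrow> (\<exists>(e :: nat \<Rightarrow> 'a set) (v :: nat \<Rightarrow> 'a).
     inj_on e {1..k} \<and> B = e ` {1..k} \<and> inj_on v {1..k} \<and> v 0 = v k \<and>
     (\<forall>i \<in> {1..k}. v (i - 1) \<in> e i \<and> v i \<in> e i))"

text \<open>Lists count from 0, while the definition counts edges from 1; hence the shift in
  \<open>h\<close>. Reducing vertex indices modulo the length also identifies vertex 0 with the last
  one.\<close>

lemma is_bergeI:
  assumes xs: "distinct xs" "length xs \<ge> 1" and h: "inj_on h {..<length xs}"
    and sub: "\<And>i. i < length xs \<Longrightarrow> cpair xs i \<subseteq> h i"
  shows "is_berge (length xs) (h ` {..<length xs})"
  unfolding is_berge_def
proof (intro exI[of _ "\<lambda>i. h (i - 1)"] exI[of _ "\<lambda>i. xs ! (i mod length xs)"] conjI ballI)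
  let ?k = "length xs"
  have im: "(\<lambda>i. i - 1) ` {1..?k} = {..<?k}"
  proof (intro equalityI subsetI)
    fix i assume "i \<in> {..<?k}"
    then show "i \<in> (\<lambda>i. i - 1) ` {1..?k}" by (intro image_eqI[of _ _ "Suc i"]) auto
  qed auto
  show "inj_on (\<lambda>i. h (i - 1)) {1..?k}"
  proof (rule inj_onI)
    fix i j assume ij: "i \<in> {1..?k}" "j \<in> {1..?k}" "h (i - 1) = h (j - 1)"
    then have "i - 1 = j - 1" by (intro inj_onD[OF h]) auto
    then show "i = j" using ij by auto
  qed
  show "h ` {..<?k} = (\<lambda>i. h (i - 1)) ` {1..?k}" unfolding im[symmetric] by (simp add: image_image)
  show "xs ! (0 mod ?k) = xs ! (?k mod ?k)" by simp
  show "inj_on (\<lambda>i. xs ! (i mod ?k)) {1..?k}"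
  proof (rule inj_onI)
    fix i j assume ij: "i \<in> {1..?k}" "j \<in> {1..?k}" "xs ! (i mod ?k) = xs ! (j mod ?k)"
    moreover have "i mod ?k < ?k" "j mod ?k < ?k" using xs(2) by (auto intro: mod_less_divisor)
    ultimately have "i mod ?k = j mod ?k" using xs(1) by (simp add: nth_eq_iff_index_eq)
    then show "i = j" using ij by (cases "i = ?k"; cases "j = ?k") auto
  qed
  fix i assume i: "i \<in> {1..?k}"
  then have "i - 1 < ?k" by auto
  then have "cpair xs (i - 1) \<subseteq> h (i - 1)" by (rule sub)
  moreover have "(i - 1) mod ?k = i - 1" "Suc (i - 1) = i" using i by auto
  ultimately show "xs ! ((i - 1) mod ?k) \<in> h (i - 1)" "xs ! (i mod ?k) \<in> h (i - 1)"
    by (auto simp: cpair_def)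
qed

section \<open>Pairs of small codegree\<close>

text \<open>Edges charged to the same pair get distinct slots below \<open>D\<close>. Drawing one
  slot uniformly for each pair then selects every edge with probability exactly \<open>1 / D\<close>
  and never two edges of one pair, even when fewer than \<open>D\<close> edges are charged to
  it.\<close>

lemma exists_slots:
  assumes "finite H" "\<And>P. card {e\<in>H. \<pi> e = P} \<le> D"
  shows "\<exists>s. (\<forall>e\<in>H. s e < D) \<and> (\<forall>e\<in>H. \<forall>e'\<in>H. \<pi> e = \<pi> e' \<longrightarrow> s e = s e' \<longrightarrow> e = e')"
proof -
  have "\<exists>f. f ` {e\<in>H. \<pi> e = P} \<subseteq> {..<D} \<and> inj_on f {e\<in>H. \<pi> e = P}" for P
    using card_le_inj[of "{e\<in>H. \<pi> e = P}" "{..<D}"] assms by simp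
  then obtain f where f: "\<And>P. f P ` {e\<in>H. \<pi> e = P} \<subseteq> {..<D}" "\<And>P. inj_on (f P) {e\<in>H. \<pi> e = P}"
    by metis
  show ?thesis
  proof (intro exI[of _ "\<lambda>e. f (\<pi> e) e"] conjI ballI impI)
    show "f (\<pi> e) e < D" if "e \<in> H" for e using f(1)[of "\<pi> e"] that by auto
    show "e = e'" if "e \<in> H" "e' \<in> H" "\<pi> e = \<pi> e'" "f (\<pi> e) e = f (\<pi> e') e'" for e e'
      using inj_onD[OF f(2)[of "\<pi> e"], of e e'] that by auto
  qed
qed

text \<open>Suppose that every cycle contains a forbidden set, and delete from the random graph one
  edge of each small forbidden set that survives. Every cycle left must come from a full forbidden
  set of size \<open>2 * l\<close>. On average, however, enough edges are left for
  \<open>many_cycles\<close> to produce more cycles than the full sets can account for.\<close>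

lemma cycle_in_light_graph:
  fixes H :: "'e set" and \<pi> :: "'e \<Rightarrow> 'a set" and F :: "'e set set" and l D M :: nat
  assumes V: "finite V" and H: "finite H" and \<pi>: "\<And>e. e \<in> H \<Longrightarrow> \<pi> e \<subseteq> V \<and> card (\<pi> e) = 2"
    and fib: "\<And>P. card {e\<in>H. \<pi> e = P} \<le> D" and D: "D \<ge> 1" and l: "l \<ge> 2"
    and M: "4 \<le> M" "M \<le> card V" and F: "\<And>S. S \<in> F \<Longrightarrow> S \<subseteq> H \<and> S \<noteq> {} \<and> card S \<le> 2 * l"
  defines "q \<equiv> real M / real (card V)"
  defines "\<tau> \<equiv> real (card H) * q\<^sup>2 / (16 * real D * real M)"
  assumes large: "(8 * (real l)\<^sup>2) ^ l * real M \<le> \<tau> ^ l" "\<tau> > 0"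
    and few: "(\<Sum>S | S \<in> F \<and> card S < 2 * l. q ^ (card S + 1) / real D ^ card S) \<le> real (card H) * q\<^sup>2 / (8 * real D)"
    and few': "real (card {S\<in>F. card S = 2 * l}) * (2 * real l) ^ (2 * l) * (q / real D) ^ (2 * l) < \<tau> ^ (2 * l) / 2"
  shows "\<exists>xs h. distinct xs \<and> length xs = 2 * l \<and> (\<forall>i<2 * l. h i \<in> H \<and> \<pi> (h i) = cpair xs i) \<and>
    (\<forall>S\<in>F. \<not> S \<subseteq> h ` {..<2 * l})"
proof (rule ccontr)
  assume contra: "\<not> ?thesis"
  have contra': "\<exists>S\<in>F. S \<subseteq> h ` {..<2 * l}"
    if "distinct xs" "length xs = 2 * l" "\<And>i. i < 2 * l \<Longrightarrow> h i \<in> H \<and> \<pi> (h i) = cpair xs i" for xs h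
  proof (rule ccontr)
    assume no: "\<not> ?thesis"
    show False
      by (rule notE[OF contra], rule exI[of _ xs], rule exI[of _ h]) (use that no in auto)
  qed
  obtain s where s: "\<And>e. e \<in> H \<Longrightarrow> s e < D" "\<And>e e'. e \<in> H \<Longrightarrow> e' \<in> H \<Longrightarrow> \<pi> e = \<pi> e' \<Longrightarrow> s e = s e' \<Longrightarrow> e = e'"
    using exists_slots[of H \<pi> D] H fib by blast
  have n0: "card V > 0" using M by simp
  have q: "q > 0" "q \<le> 1" using M n0 by (auto simp: q_def)
  have F_fin: "finite F" using F H by (intro finite_subset[of F "Pow H"]) auto
  define I where "I = \<pi> ` H"
  define A where "A = subsets_of_size V M"
  define B where "B = PiE I (\<lambda>_. {..<D})"
  define \<Omega> where "\<Omega> = A \<times> B"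
  have finI: "finite I" using H by (simp add: I_def)
  have finA: "finite A" "A \<noteq> {}" using V M by (auto simp: A_def finite_subsets_of_size subsets_of_size_nonempty)
  have "{..<D} \<noteq> {}" using D by (auto simp: lessThan_empty_iff)
  then have finB: "finite B" "B \<noteq> {}" using finI by (auto simp: B_def PiE_eq_empty_iff intro!: finite_PiE)
  have fin\<Omega>: "finite \<Omega>" "\<Omega> \<noteq> {}" using finA finB by (auto simp: \<Omega>_def)
  \<comment> \<open>The edges whose pair lies in the sampled vertex set and whose slot is drawn.
    \<open>\<pi>\<close> is injective on them, so they can be regarded as the edges of a simple
    graph.\<close>
  define R where "R \<omega> = {e\<in>H. snd \<omega> (\<pi> e) = s e \<and> \<pi> e \<subseteq> fst \<omega>}" for \<omega> :: "'a set \<times> ('a set \<Rightarrow> nat)"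
  have finR: "finite (R \<omega>)" for \<omega> using H by (simp add: R_def)
  have injR: "inj_on \<pi> (R \<omega>)" for \<omega> using s(2) by (auto simp: inj_on_def R_def)
  have fr_le: "freq \<Omega> (\<lambda>\<omega>. S \<subseteq> R \<omega>) \<le> (1 / real D) ^ card S * q ^ card (\<Union>(\<pi> ` S))" if S: "S \<subseteq> H" for S
  proof (cases "inj_on \<pi> S")
    case True
    have "freq \<Omega> (\<lambda>\<omega>. S \<subseteq> R \<omega>) \<le> freq \<Omega> (\<lambda>\<omega>. \<Union>(\<pi> ` S) \<subseteq> fst \<omega> \<and> (\<forall>P\<in>\<pi> ` S. snd \<omega> P = s (the_inv_into S \<pi> P)))"
      using True by (intro freq_mono fin\<Omega>) (auto simp: R_def the_inv_into_f_f)
    also have "\<dots> = freq A (\<lambda>U. \<Union>(\<pi> ` S) \<subseteq> U) * freq B (\<lambda>\<phi>. \<forall>P\<in>\<pi> ` S. \<phi> P = s (the_inv_into S \<pi> P))"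
      unfolding \<Omega>_def by (rule freq_Times)
    also have "\<dots> \<le> q ^ card (\<Union>(\<pi> ` S)) * (\<Prod>P\<in>\<pi> ` S. 1 / real D)"
    proof (rule mult_mono)
      show "freq A (\<lambda>U. \<Union>(\<pi> ` S) \<subseteq> U) \<le> q ^ card (\<Union>(\<pi> ` S))"
        unfolding A_def q_def by (rule freq_superset_le) (use V \<pi> S M n0 in auto)
      have "freq B (\<lambda>\<phi>. \<forall>P\<in>\<pi> ` S. \<phi> P = s (the_inv_into S \<pi> P)) =
        (if \<forall>P\<in>\<pi> ` S. s (the_inv_into S \<pi> P) \<in> {..<D} then \<Prod>P\<in>\<pi> ` S. 1 / real (card {..<D}) else 0)"
        unfolding B_def by (rule freq_PiE[where S = "\<lambda>_. {..<D}"]) (use finI S D in \<open>auto simp: I_def lessThan_empty_iff\<close>)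
      also have "\<dots> \<le> (\<Prod>P\<in>\<pi> ` S. 1 / real D)" by (auto intro: prod_nonneg)
      finally show "freq B (\<lambda>\<phi>. \<forall>P\<in>\<pi> ` S. \<phi> P = s (the_inv_into S \<pi> P)) \<le> (\<Prod>P\<in>\<pi> ` S. 1 / real D)" .
    qed (use q in \<open>auto simp: freq_nonneg\<close>)
    also have "(\<Prod>P\<in>\<pi> ` S. 1 / real D) = (1 / real D) ^ card S" using True by (simp add: card_image)
    finally show ?thesis by (simp add: mult.commute)
  next
    case False
    \<comment> \<open>Two edges with the same pair occupy different slots and never survive
      together.\<close>
    have "\<not> S \<subseteq> R \<omega>" for \<omega> using False injR inj_on_subset by blast
    then have "freq \<Omega> (\<lambda>\<omega>. S \<subseteq> R \<omega>) = 0" by (simp add: freq_def)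
    then show ?thesis using q by simp
  qed
  have fr_ge: "freq \<Omega> (\<lambda>\<omega>. e \<in> R \<omega>) \<ge> q\<^sup>2 / (4 * real D)" if e: "e \<in> H" for e
  proof -
    have "freq \<Omega> (\<lambda>\<omega>. e \<in> R \<omega>) = freq \<Omega> (\<lambda>\<omega>. \<pi> e \<subseteq> fst \<omega> \<and> (\<forall>P\<in>{\<pi> e}. snd \<omega> P = s e))"
      using e by (simp add: R_def conj_commute)
    also have "\<dots> = freq A (\<lambda>U. \<pi> e \<subseteq> U) * freq B (\<lambda>\<phi>. \<forall>P\<in>{\<pi> e}. \<phi> P = s e)"
      unfolding \<Omega>_def by (rule freq_Times)
    also have "freq B (\<lambda>\<phi>. \<forall>P\<in>{\<pi> e}. \<phi> P = s e) =
        (if \<forall>P\<in>{\<pi> e}. s e \<in> {..<D} then \<Prod>P\<in>{\<pi> e}. 1 / real (card {..<D}) else 0)"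
      unfolding B_def by (rule freq_PiE[where S = "\<lambda>_. {..<D}"]) (use finI e D in \<open>auto simp: I_def lessThan_empty_iff\<close>)
    also have "\<dots> = 1 / real D" using s(1)[OF e] by simp
    finally have 1: "freq \<Omega> (\<lambda>\<omega>. e \<in> R \<omega>) = freq A (\<lambda>U. \<pi> e \<subseteq> U) * (1 / real D)" .
    have "(real M / (2 * real (card V))) ^ card (\<pi> e) \<le> freq A (\<lambda>U. \<pi> e \<subseteq> U)"
      unfolding A_def by (rule freq_superset_ge) (use V \<pi>[OF e] M in auto)
    then have "q\<^sup>2 / 4 \<le> freq A (\<lambda>U. \<pi> e \<subseteq> U)"
      using \<pi>[OF e] by (simp add: q_def power_divide power_mult_distrib)
    then have "q\<^sup>2 / 4 * (1 / real D) \<le> freq A (\<lambda>U. \<pi> e \<subseteq> U) * (1 / real D)"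
      using D by (intro mult_right_mono) auto
    then show ?thesis unfolding 1 by simp
  qed
  \<comment> \<open>A small set that spans no more vertices than it has elements cannot lie in a
    cycle and may be ignored. The others survive with the better probability involving
    \<open>q ^ (card S + 1)\<close>; a full set in a cycle spans exactly \<open>2 * l\<close>
    vertices.\<close>
  define F1 where "F1 = {S\<in>F. card S < 2 * l \<and> card (\<Union>(\<pi> ` S)) \<ge> card S + 1}"
  define F2 where "F2 = {S\<in>F. card S = 2 * l \<and> card (\<Union>(\<pi> ` S)) = 2 * l}"
  have finF: "finite F1" "finite F2" using F_fin by (auto simp: F1_def F2_def)
  have "\<forall>S\<in>F. \<exists>e. e \<in> S" using F by blast
  then obtain rep where rep: "\<And>S. S \<in> F \<Longrightarrow> rep S \<in> S" by metis
  define X where "X \<omega> = {S\<in>F1. S \<subseteq> R \<omega>}" for \<omega>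
  define R' where "R' \<omega> = R \<omega> - rep ` X \<omega>" for \<omega>
  define G where "G \<omega> = \<pi> ` R' \<omega>" for \<omega>
  have cG: "real (card (G \<omega>)) \<ge> real (card (R \<omega>)) - real (card (X \<omega>))" for \<omega>
  proof -
    have "finite (X \<omega>)" using finF by (simp add: X_def)
    then have "card (rep ` X \<omega>) \<le> card (X \<omega>)" by (rule card_image_le)
    moreover have "card (R \<omega>) \<le> card (R' \<omega>) + card (rep ` X \<omega>)"
      unfolding R'_def using \<open>finite (X \<omega>)\<close> by (metis card_Diff1_le diff_card_le_card_Diff finite_imageI le_diff_conv)
    moreover have "card (G \<omega>) = card (R' \<omega>)" unfolding G_def R'_def
      by (rule card_image) (use injR inj_on_diff in blast)
    ultimately show ?thesis by linarith
  qed
  \<comment> \<open>A full forbidden set determines the vertex set of its cycle, so at most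
    \<open>(2 * l) ^ (2 * l)\<close> vertex lists lead to it.\<close>
  have cyc: "real (card (cycles (fst \<omega>) (\<lambda>x y. {x, y} \<in> G \<omega>) (2 * l)))
      \<le> (2 * real l) ^ (2 * l) * real (card {S\<in>F2. S \<subseteq> R \<omega>})" for \<omega>
  proof -
    have "cycles (fst \<omega>) (\<lambda>x y. {x, y} \<in> G \<omega>) (2 * l) \<subseteq> (\<Union>S\<in>{S\<in>F2. S \<subseteq> R \<omega>}. lists_of (\<Union>(\<pi> ` S)) (2 * l))"
    proof
      fix xs assume "xs \<in> cycles (fst \<omega>) (\<lambda>x y. {x, y} \<in> G \<omega>) (2 * l)"
      then have xs: "length xs = 2 * l" "distinct xs" "successively (\<lambda>x y. {x, y} \<in> G \<omega>) (xs @ [hd xs])"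
        by (auto simp: cycles_def lists_of_def)
      have "xs \<noteq> []" using xs l by auto
      then have "\<forall>i<2 * l. cpair xs i \<in> G \<omega>" using xs by (simp add: successively_cyclic cpair_def)
      then have "\<forall>i<2 * l. \<exists>e. e \<in> R' \<omega> \<and> \<pi> e = cpair xs i" unfolding G_def by (metis imageE)
      then obtain h where h: "\<And>i. i < 2 * l \<Longrightarrow> h i \<in> R' \<omega> \<and> \<pi> (h i) = cpair xs i" by metis
      have hH: "h i \<in> H" if "i < 2 * l" for i using h[OF that] by (auto simp: R'_def R_def)
      have "\<exists>S\<in>F. S \<subseteq> h ` {..<2 * l}" by (rule contra'[OF xs(2,1)]) (use h hH in auto)
      then obtain S where S: "S \<in> F" "S \<subseteq> h ` {..<2 * l}" by blast
      have SR: "S \<subseteq> R \<omega>" using S h by (auto simp: R'_def)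
      obtain J where J: "J \<subseteq> {..<2 * l}" "S = h ` J" using S(2) by (metis subset_imageE)
      have inj: "inj_on h {..<2 * l}"
      proof (rule inj_onI)
        fix i j assume ij: "i \<in> {..<2 * l}" "j \<in> {..<2 * l}" "h i = h j"
        then have "cpair xs i = cpair xs j" using h by (metis lessThan_iff)
        then show "i = j" using cpair_inj[OF xs(2)] ij xs l by (auto simp: inj_on_def)
      qed
      have cJ: "card J = card S" using inj J by (metis card_image inj_on_subset)
      have "\<pi> ` S = (\<lambda>i. \<pi> (h i)) ` J" unfolding J(2) by (simp add: image_image)
      also have "\<dots> = cpair xs ` J" by (rule image_cong) (use h J(1) in auto)
      finally have "\<pi> ` S = cpair xs ` J" .
      then have un: "\<Union>(\<pi> ` S) = (\<Union>i\<in>J. cpair xs i)" by simp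
      have Jne: "J \<noteq> {}" using F S(1) J by auto
      have span: "card (\<Union>(\<pi> ` S)) \<ge> (if card S = 2 * l then 2 * l else card S + 1)"
      proof -
        have "card (\<Union>i\<in>J. cpair xs i) \<ge> (if card J = length xs then length xs else card J + 1)"
          by (rule card_UN_cpair) (use xs l J Jne in auto)
        then show ?thesis unfolding un cJ xs(1) .
      qed
      have "card S = 2 * l"
      proof (rule ccontr)
        assume ne: "card S \<noteq> 2 * l"
        then have "card S < 2 * l" using F S(1) by (simp add: le_neq_implies_less)
        then have "S \<in> X \<omega>" using S span ne SR by (auto simp: X_def F1_def)
        then have "rep S \<notin> R' \<omega>" by (auto simp: R'_def)
        moreover have "rep S \<in> R' \<omega>" using rep[OF S(1)] S(2) h by auto
        ultimately show False by simp
      qed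
      have "J = {..<2 * l}" using J cJ \<open>card S = 2 * l\<close> by (intro card_subset_eq) auto
      have sub: "(\<Union>i\<in>J. cpair xs i) = set xs"
      proof
        show "(\<Union>i\<in>J. cpair xs i) \<subseteq> set xs" using J xs l by (auto simp: cpair_def)
        show "set xs \<subseteq> (\<Union>i\<in>J. cpair xs i)"
          using \<open>J = {..<2 * l}\<close> xs by (auto simp: cpair_def in_set_conv_nth)
      qed
      have "card (\<Union>(\<pi> ` S)) = 2 * l" using un sub xs by (simp add: distinct_card)
      then have "S \<in> F2" using S \<open>card S = 2 * l\<close> by (simp add: F2_def)
      moreover have "xs \<in> lists_of (\<Union>(\<pi> ` S)) (2 * l)" using un sub xs by (simp add: lists_of_def)
      ultimately show "xs \<in> (\<Union>S\<in>{S\<in>F2. S \<subseteq> R \<omega>}. lists_of (\<Union>(\<pi> ` S)) (2 * l))" using SR by blast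
    qed
    moreover have finS: "finite (\<Union>(\<pi> ` S))" if "S \<in> F2" for S
      using that l card.infinite[of "\<Union>(\<pi> ` S)"] by (auto simp: F2_def)
    moreover have "finite (\<Union>S\<in>{S\<in>F2. S \<subseteq> R \<omega>}. lists_of (\<Union>(\<pi> ` S)) (2 * l))"
    proof (rule finite_UN_I)
      show "finite {S\<in>F2. S \<subseteq> R \<omega>}" using finF by simp
      show "finite (lists_of (\<Union>(\<pi> ` S)) (2 * l))" if "S \<in> {S\<in>F2. S \<subseteq> R \<omega>}" for S
        by (rule finite_lists_of) (use that finS in blast)
    qed
    ultimately have "card (cycles (fst \<omega>) (\<lambda>x y. {x, y} \<in> G \<omega>) (2 * l)) \<le> card (\<Union>S\<in>{S\<in>F2. S \<subseteq> R \<omega>}. lists_of (\<Union>(\<pi> ` S)) (2 * l))"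
      by (intro card_mono)
    also have "\<dots> \<le> (\<Sum>S\<in>{S\<in>F2. S \<subseteq> R \<omega>}. card (lists_of (\<Union>(\<pi> ` S)) (2 * l)))"
      by (rule card_UN_le) (use finF in auto)
    also have "\<dots> = (\<Sum>S\<in>{S\<in>F2. S \<subseteq> R \<omega>}. (2 * l) ^ (2 * l))"
    proof (rule sum.cong[OF refl])
      fix S assume "S \<in> {S\<in>F2. S \<subseteq> R \<omega>}"
      then have S: "S \<in> F2" by blast
      then have "card (\<Union>(\<pi> ` S)) = 2 * l" by (simp add: F2_def)
      then show "card (lists_of (\<Union>(\<pi> ` S)) (2 * l)) = (2 * l) ^ (2 * l)"
        unfolding lists_of_def by (simp only: card_lists_length_eq[OF finS[OF S]])
    qed
    finally have "card (cycles (fst \<omega>) (\<lambda>x y. {x, y} \<in> G \<omega>) (2 * l)) \<le> (2 * l) ^ (2 * l) * card {S\<in>F2. S \<subseteq> R \<omega>}"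
      by (simp add: mult.commute)
    then have "real (card (cycles (fst \<omega>) (\<lambda>x y. {x, y} \<in> G \<omega>) (2 * l))) \<le> real ((2 * l) ^ (2 * l) * card {S\<in>F2. S \<subseteq> R \<omega>})"
      by (rule of_nat_mono)
    then show ?thesis by simp
  qed
  have lower: "\<tau> ^ (2 * l - 1) / 2 * (1 / real M * (real (card (R \<omega>)) - real (card (X \<omega>))) - \<tau>)
      \<le> (2 * real l) ^ (2 * l) * real (card {S\<in>F2. S \<subseteq> R \<omega>})" if \<omega>: "\<omega> \<in> \<Omega>" for \<omega>
  proof -
    have U: "fst \<omega> \<subseteq> V" "card (fst \<omega>) = M" using \<omega> by (auto simp: \<Omega>_def A_def subsets_of_size_def)
    have "real (card (cycles (fst \<omega>) (\<lambda>x y. {x, y} \<in> G \<omega>) (2 * l))) \<ge>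
        \<tau> ^ (2 * l - 1) * (real (card (G \<omega>)) / real (card (fst \<omega>)) - \<tau>) / 2"
    proof (rule many_cycles)
      show "finite (fst \<omega>)" using U V finite_subset by blast
      show "G \<omega> \<subseteq> {e. e \<subseteq> fst \<omega> \<and> card e = 2}" using \<pi> by (auto simp: G_def R'_def R_def)
      show "fst \<omega> \<noteq> {}" using U M by auto
    qed (use large l U in auto)
    moreover have "(real (card (R \<omega>)) - real (card (X \<omega>))) / real M \<le> real (card (G \<omega>)) / real M"
      using cG[of \<omega>] by (intro divide_right_mono) auto
    then have "\<tau> ^ (2 * l - 1) * ((real (card (R \<omega>)) - real (card (X \<omega>))) / real M - \<tau>)
      \<le> \<tau> ^ (2 * l - 1) * (real (card (G \<omega>)) / real M - \<tau>)"
      using large(2) by (intro mult_left_mono) auto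
    ultimately show ?thesis using cyc[of \<omega>] U by simp
  qed
  have avR: "avg \<Omega> (\<lambda>\<omega>. real (card (R \<omega>))) \<ge> real (card H) * (q\<^sup>2 / (4 * real D))"
  proof -
    have "avg \<Omega> (\<lambda>\<omega>. real (card (R \<omega>))) = (\<Sum>e\<in>H. freq \<Omega> (\<lambda>\<omega>. snd \<omega> (\<pi> e) = s e \<and> \<pi> e \<subseteq> fst \<omega>))"
      unfolding R_def by (rule avg_card) (use fin\<Omega> H in auto)
    also have "\<dots> \<ge> (\<Sum>e\<in>H. q\<^sup>2 / (4 * real D))"
      using fr_ge by (intro sum_mono) (simp add: R_def)
    finally show ?thesis by simp
  qed
  have avX: "avg \<Omega> (\<lambda>\<omega>. real (card (X \<omega>))) \<le> real (card H) * q\<^sup>2 / (8 * real D)"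
  proof -
    have "avg \<Omega> (\<lambda>\<omega>. real (card (X \<omega>))) = (\<Sum>S\<in>F1. freq \<Omega> (\<lambda>\<omega>. S \<subseteq> R \<omega>))"
      unfolding X_def by (rule avg_card) (use fin\<Omega> finF in auto)
    also have "\<dots> \<le> (\<Sum>S\<in>F1. q ^ (card S + 1) / real D ^ card S)"
    proof (rule sum_mono)
      fix S assume S: "S \<in> F1"
      then have "freq \<Omega> (\<lambda>\<omega>. S \<subseteq> R \<omega>) \<le> (1 / real D) ^ card S * q ^ card (\<Union>(\<pi> ` S))"
        using F by (intro fr_le) (auto simp: F1_def)
      also have "\<dots> \<le> (1 / real D) ^ card S * q ^ (card S + 1)"
        using q S by (intro mult_left_mono power_decreasing) (auto simp: F1_def)
      finally show "freq \<Omega> (\<lambda>\<omega>. S \<subseteq> R \<omega>) \<le> q ^ (card S + 1) / real D ^ card S"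
        by (simp add: power_divide)
    qed
    also have "\<dots> \<le> (\<Sum>S | S \<in> F \<and> card S < 2 * l. q ^ (card S + 1) / real D ^ card S)"
      using q F_fin by (intro sum_mono2) (auto simp: F1_def)
    finally show ?thesis using few by linarith
  qed
  have avF: "avg \<Omega> (\<lambda>\<omega>. real (card {S\<in>F2. S \<subseteq> R \<omega>})) \<le> real (card {S\<in>F. card S = 2 * l}) * (q / real D) ^ (2 * l)"
  proof -
    have "avg \<Omega> (\<lambda>\<omega>. real (card {S\<in>F2. S \<subseteq> R \<omega>})) = (\<Sum>S\<in>F2. freq \<Omega> (\<lambda>\<omega>. S \<subseteq> R \<omega>))"
      by (rule avg_card) (use fin\<Omega> finF in auto)
    also have "\<dots> \<le> real (card F2) * (q / real D) ^ (2 * l)"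
    proof (rule sum_bounded_above)
      fix S assume S: "S \<in> F2"
      then have "freq \<Omega> (\<lambda>\<omega>. S \<subseteq> R \<omega>) \<le> (1 / real D) ^ card S * q ^ card (\<Union>(\<pi> ` S))"
        using F by (intro fr_le) (auto simp: F2_def)
      then show "freq \<Omega> (\<lambda>\<omega>. S \<subseteq> R \<omega>) \<le> (q / real D) ^ (2 * l)"
        using S by (simp add: F2_def power_divide)
    qed
    also have "\<dots> \<le> real (card {S\<in>F. card S = 2 * l}) * (q / real D) ^ (2 * l)"
      using q F_fin by (intro mult_right_mono of_nat_mono card_mono) (auto simp: F2_def)
    finally show ?thesis .
  qed
  have "avg \<Omega> (\<lambda>\<omega>. \<tau> ^ (2 * l - 1) / 2 * (1 / real M * (real (card (R \<omega>)) - real (card (X \<omega>))) - \<tau>))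
      \<le> avg \<Omega> (\<lambda>\<omega>. (2 * real l) ^ (2 * l) * real (card {S\<in>F2. S \<subseteq> R \<omega>}))"
    by (rule avg_mono) (rule lower)
  then have "\<tau> ^ (2 * l - 1) / 2 * (1 / real M * (avg \<Omega> (\<lambda>\<omega>. real (card (R \<omega>))) - avg \<Omega> (\<lambda>\<omega>. real (card (X \<omega>)))) - \<tau>)
      \<le> (2 * real l) ^ (2 * l) * avg \<Omega> (\<lambda>\<omega>. real (card {S\<in>F2. S \<subseteq> R \<omega>}))"
    unfolding avg_cmult avg_diff avg_const[OF fin\<Omega>] .
  also have "\<dots> \<le> (2 * real l) ^ (2 * l) * (real (card {S\<in>F. card S = 2 * l}) * (q / real D) ^ (2 * l))"
    using avF by (intro mult_left_mono) auto
  also have "\<dots> < \<tau> ^ (2 * l) / 2" using few' by (simp add: mult_ac)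
  finally have up: "\<tau> ^ (2 * l - 1) / 2 * (1 / real M * (avg \<Omega> (\<lambda>\<omega>. real (card (R \<omega>))) - avg \<Omega> (\<lambda>\<omega>. real (card (X \<omega>)))) - \<tau>) < \<tau> ^ (2 * l) / 2" .
  have "real (card H) * q\<^sup>2 / (8 * real D) \<le> avg \<Omega> (\<lambda>\<omega>. real (card (R \<omega>))) - avg \<Omega> (\<lambda>\<omega>. real (card (X \<omega>)))"
    using avR avX by simp
  then have "1 / real M * (real (card H) * q\<^sup>2 / (8 * real D)) \<le> 1 / real M * (avg \<Omega> (\<lambda>\<omega>. real (card (R \<omega>))) - avg \<Omega> (\<lambda>\<omega>. real (card (X \<omega>))))"
    by (intro mult_left_mono) auto
  \<comment> \<open>The expected edges exceed the expected deletions by a factor of at least two,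
    and \<open>\<tau>\<close> is normalised so that the difference per vertex is at least
    \<open>2 * \<tau>\<close>; one \<open>\<tau>\<close> is left after the subtraction.\<close>
  moreover have "1 / real M * (real (card H) * q\<^sup>2 / (8 * real D)) = 2 * \<tau>" by (simp add: \<tau>_def)
  ultimately have "\<tau> ^ (2 * l - 1) / 2 * \<tau> \<le> \<tau> ^ (2 * l - 1) / 2 * (1 / real M * (avg \<Omega> (\<lambda>\<omega>. real (card (R \<omega>))) - avg \<Omega> (\<lambda>\<omega>. real (card (X \<omega>)))) - \<tau>)"
    using large(2) by (intro mult_left_mono) auto
  moreover have "\<tau> ^ (2 * l - 1) / 2 * \<tau> = \<tau> ^ (2 * l) / 2" using l by (simp flip: power_Suc2)
  ultimately show False using up by linarith
qed

section \<open>Pairs of large codegree\<close>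

text \<open>\<open>g\<close> is a partial assignment of edges to pairs. A forbidden set turns into
  such an event once it is fixed for which pairs its edges are drawn.\<close>

definition occurs :: "('a set \<times> 'h) set \<Rightarrow> 'a set \<Rightarrow> ('a set \<Rightarrow> 'h) \<Rightarrow> bool" where
  "occurs g U \<phi> \<longleftrightarrow> \<Union>(fst ` g) \<subseteq> U \<and> (\<forall>(P, h)\<in>g. \<phi> P = h)"

text \<open>Prune the pairs that lie in at most \<open>k * \<theta>\<close> triples; by
  \<open>large\<close> something remains. A remaining pair lies in more than
  \<open>k * \<theta>\<close> triples, at most \<open>\<theta>\<close> of which share the same third
  vertex. So it has a third vertex outside any given set of fewer than \<open>k\<close> vertices, as
  the growth of a cycle requires.\<close>

lemma triple_system_cycle:
  fixes R :: "'e set" and T :: "'e \<Rightarrow> 'a set" and \<theta> :: real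
  assumes R: "finite R" and T: "\<And>e. e \<in> R \<Longrightarrow> card (T e) = 3" and \<theta>: "\<theta> > 0"
    and mult: "\<And>Y. real (card {e\<in>R. T e = Y}) \<le> \<theta>" and k: "k \<ge> 2"
    and large: "real (card R) > real k * \<theta> * real (card {P. card P = 2 \<and> (\<exists>e\<in>R. P \<subseteq> T e)})"
  shows "\<exists>xs. length xs = k \<and> distinct xs \<and> (\<forall>i<k. \<exists>e\<in>R. cpair xs i \<subseteq> T e)"
proof -
  define Pr where "Pr = {P. card P = 2 \<and> (\<exists>e\<in>R. P \<subseteq> T e)}"
  define Tr where "Tr e = {P. P \<subseteq> T e \<and> card P = 2}" for e
  have finT: "finite (T e)" if "e \<in> R" for e using T[OF that] card.infinite by fastforce
  have "Pr \<subseteq> (\<Union>e\<in>R. Pow (T e))" by (auto simp: Pr_def)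
  then have finPr: "finite Pr" by (rule finite_subset) (use R finT in auto)
  obtain R2 \<pi> where R2: "R2 \<subseteq> R" "\<forall>e\<in>R2. \<forall>\<tau>\<in>Tr e. real (card {e'\<in>R2. \<tau> \<in> Tr e'}) > real k * \<theta>"
    "\<forall>e\<in>R - R2. \<pi> e \<in> Tr e" "\<forall>\<tau>. real k * \<theta> \<ge> 0 \<longrightarrow> real (card {e\<in>R - R2. \<pi> e = \<tau>}) \<le> real k * \<theta>"
    using prune[OF R, of Tr "real k * \<theta>"] by auto
  have finR2: "finite R2" using R R2 finite_subset by blast
  have "R2 \<noteq> {}"
  proof
    assume "R2 = {}"
    have "real (card R) \<le> real (card Pr) * (real k * \<theta>)"
      by (rule card_le_fibres[OF R finPr, of \<pi>])
        (use R2 \<theta> \<open>R2 = {}\<close> in \<open>auto simp: Tr_def Pr_def\<close>)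
    then show False using large unfolding Pr_def[symmetric] by (simp add: mult_ac)
  qed
  then obtain e0 where e0: "e0 \<in> R2" by auto
  define G where "G = (\<Union>e\<in>R2. Tr e)"
  have "card (T e0) = 3" using T e0 R2 by auto
  then obtain a b c where abc: "T e0 = {a, b, c}" "a \<noteq> b" by (auto simp: card_3_iff)
  have "{a, b} \<in> G" using e0 abc by (auto simp: G_def Tr_def)
  moreover have "\<exists>x. x \<notin> X \<and> {u, x} \<in> G \<and> {v, x} \<in> G"
    if uv: "{u, v} \<in> G" and X: "finite X" "card X < k" for u v X
  proof -
    obtain e1 where e1: "e1 \<in> R2" "{u, v} \<in> Tr e1" using uv by (auto simp: G_def)
    have uvne: "u \<noteq> v" using e1 by (auto simp: Tr_def)
    define Q where "Q = {e'\<in>R2. {u, v} \<in> Tr e'}"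
    have big: "real (card Q) > real k * \<theta>" using R2(2) e1 by (auto simp: Q_def)
    have third: "\<exists>x. T e = {u, v, x} \<and> x \<noteq> u \<and> x \<noteq> v" if "e \<in> Q" for e
    proof -
      have e: "{u, v} \<subseteq> T e" "card (T e) = 3" using that R2(1) T by (auto simp: Q_def Tr_def)
      then have "card (T e - {u, v}) = 1" using uvne by (subst card_Diff_subset) auto
      then obtain x where "T e - {u, v} = {x}" using card_1_singletonE by blast
      then show ?thesis using e by blast
    qed
    have "\<exists>e\<in>Q. \<exists>x. T e = {u, v, x} \<and> x \<notin> X \<and> x \<noteq> u \<and> x \<noteq> v"
    proof (rule ccontr)
      assume no: "\<not> ?thesis"
      have "Q \<subseteq> (\<Union>x\<in>X. {e\<in>R. T e = {u, v, x}})"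
      proof
        fix e assume e: "e \<in> Q"
        then obtain x where "T e = {u, v, x}" "x \<noteq> u" "x \<noteq> v" using third by blast
        then show "e \<in> (\<Union>x\<in>X. {e\<in>R. T e = {u, v, x}})" using no e R2(1) by (auto simp: Q_def)
      qed
      then have "card Q \<le> card (\<Union>x\<in>X. {e\<in>R. T e = {u, v, x}})" by (rule card_mono[rotated]) (use X R in auto)
      also have "\<dots> \<le> (\<Sum>x\<in>X. card {e\<in>R. T e = {u, v, x}})" using X by (intro card_UN_le) auto
      finally have "real (card Q) \<le> real (\<Sum>x\<in>X. card {e\<in>R. T e = {u, v, x}})" by (rule of_nat_mono)
      also have "\<dots> = (\<Sum>x\<in>X. real (card {e\<in>R. T e = {u, v, x}}))" by (rule of_nat_sum)
      also have "\<dots> \<le> real (card X) * \<theta>" using mult by (intro sum_bounded_above) auto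
      also have "\<dots> \<le> real k * \<theta>" using X \<theta> by (intro mult_right_mono) auto
      finally show False using big by simp
    qed
    then obtain e x where ex: "e \<in> Q" "T e = {u, v, x}" "x \<notin> X" "x \<noteq> u" "x \<noteq> v" by blast
    then have "{u, x} \<in> Tr e" "{v, x} \<in> Tr e" "e \<in> R2" by (auto simp: Tr_def Q_def)
    then show ?thesis using ex(3) by (auto simp: G_def)
  qed
  ultimately obtain xs where xs: "length xs = k" "distinct xs" "successively (\<lambda>x y. {x, y} \<in> G) (xs @ [hd xs])"
    using cycle_from_triangles[of a b G k k] abc(2) k by blast
  have "xs \<noteq> []" using xs k by auto
  then have "\<forall>i<k. cpair xs i \<in> G" using xs by (simp add: successively_cyclic cpair_def)
  then have "\<forall>i<k. \<exists>e\<in>R. cpair xs i \<subseteq> T e" using R2(1) unfolding G_def Tr_def by blast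
  then show ?thesis using xs by blast
qed

text \<open>Every bad event that occurs kills the sampled triples over its representative pair. If
  more than \<open>k * \<theta>\<close> triples per pair were left, they would contain a cycle;
  \<open>bad\<close> supplies an event among its pairs, which occurs, and the triple of the cycle
  over its representative pair should have been killed. Averaging the resulting inequality over all
  samples gives the claim.\<close>

lemma triple_sampling:
  fixes R :: "'e set" and T :: "'e \<Rightarrow> 'a set" and \<theta> \<mu> :: real and E :: "'a set \<Rightarrow> 'h set"
  assumes V: "finite V" and R: "finite R" and T: "\<And>e. e \<in> R \<Longrightarrow> T e \<subseteq> V \<and> card (T e) = 3"
    and \<theta>: "\<theta> > 0" and \<mu>: "\<mu> > 0" and k: "k \<ge> 2" and M: "6 \<le> M" "M \<le> card V"
    and mult: "\<And>Y. real (card {e\<in>R. T e = Y}) \<le> \<theta>"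
    and heavy: "\<And>P e. e \<in> R \<Longrightarrow> P \<subseteq> T e \<Longrightarrow> card P = 2 \<Longrightarrow> real (card {e\<in>R. P \<subseteq> T e}) \<ge> \<mu> * \<theta>"
    and I: "finite I" "\<And>P. P \<in> I \<Longrightarrow> P \<subseteq> V \<and> card P = 2" "\<And>P e. e \<in> R \<Longrightarrow> P \<subseteq> T e \<Longrightarrow> card P = 2 \<Longrightarrow> P \<in> I"
    and E: "\<And>P. P \<in> I \<Longrightarrow> finite (E P) \<and> E P \<noteq> {}"
    and \<G>: "finite \<G>" "\<And>g. g \<in> \<G> \<Longrightarrow> finite g \<and> inj_on fst g \<and> fst ` g \<subseteq> I \<and> card (\<Union>(fst ` g)) \<le> 2 * k \<and> rep g \<in> g"
    and bad: "\<And>\<phi> xs. \<phi> \<in> PiE I E \<Longrightarrow> distinct xs \<Longrightarrow> length xs = k \<Longrightarrow> (\<forall>i<k. \<exists>e\<in>R. cpair xs i \<subseteq> T e) \<Longrightarrow>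
        \<exists>g\<in>\<G>. \<forall>(P, h)\<in>g. P \<in> cpair xs ` {..<k} \<and> \<phi> P = h"
  defines "q \<equiv> real M / real (card V)"
  assumes \<mu>q: "\<mu> * q \<ge> 1"
  shows "real (card R) * (q / 2) ^ 3 \<le>
     real k * \<theta> * real (card {P. card P = 2 \<and> (\<exists>e\<in>R. P \<subseteq> T e)}) * q\<^sup>2 +
     (\<Sum>g\<in>\<G>. (1 + 2 * real k) * q ^ (card (\<Union>(fst ` g)) + 1) * real (card {e\<in>R. fst (rep g) \<subseteq> T e}) *
        (\<Prod>P\<in>fst ` g. 1 / real (card (E P))))"
proof -
  define Pr where "Pr = {P. card P = 2 \<and> (\<exists>e\<in>R. P \<subseteq> T e)}"
  have PrI: "Pr \<subseteq> I" using I(3) by (auto simp: Pr_def)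
  have finPr: "finite Pr" using PrI I(1) finite_subset by blast
  have n0: "card V > 0" using M by simp
  have q: "q > 0" using M n0 by (auto simp: q_def)
  define A where "A = subsets_of_size V M"
  define B where "B = PiE I E"
  define \<Omega> where "\<Omega> = A \<times> B"
  have finA: "finite A" "A \<noteq> {}" using V M by (auto simp: A_def finite_subsets_of_size subsets_of_size_nonempty)
  have finB: "finite B" "B \<noteq> {}" using I(1) E by (auto simp: B_def PiE_eq_empty_iff intro!: finite_PiE)
  have fin\<Omega>: "finite \<Omega>" "\<Omega> \<noteq> {}" using finA finB by (auto simp: \<Omega>_def)
  define RU where "RU \<omega> = {e\<in>R. T e \<subseteq> fst \<omega>}" for \<omega> :: "'a set \<times> ('a set \<Rightarrow> 'h)"
  define kill where "kill g \<omega> = {e\<in>{e\<in>R. fst (rep g) \<subseteq> T e}. T e \<subseteq> fst \<omega> \<and> occurs g (fst \<omega>) (snd \<omega>)}" for g and \<omega> :: "'a set \<times> ('a set \<Rightarrow> 'h)"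
  have pointwise: "real (card (RU \<omega>)) \<le> real k * \<theta> * real (card {P\<in>Pr. P \<subseteq> fst \<omega>}) + (\<Sum>g\<in>\<G>. real (card (kill g \<omega>)))"
    if \<omega>: "\<omega> \<in> \<Omega>" for \<omega>
  proof (rule ccontr)
    assume contra: "\<not> ?thesis"
    define R1 where "R1 = RU \<omega> - (\<Union>g\<in>\<G>. kill g \<omega>)"
    have finkill: "finite (kill g \<omega>)" for g using R by (simp add: kill_def)
    have "card (RU \<omega>) \<le> card (R1 \<union> (\<Union>g\<in>\<G>. kill g \<omega>))"
      by (rule card_mono) (use R \<G> finkill in \<open>auto simp: R1_def RU_def\<close>)
    also have "\<dots> \<le> card R1 + card (\<Union>g\<in>\<G>. kill g \<omega>)" by (rule card_Un_le)
    also have "\<dots> \<le> card R1 + (\<Sum>g\<in>\<G>. card (kill g \<omega>))" using \<G> by (intro add_left_mono card_UN_le) auto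
    finally have "real (card (RU \<omega>)) \<le> real (card R1 + (\<Sum>g\<in>\<G>. card (kill g \<omega>)))" by (rule of_nat_mono)
    then have gt: "real (card R1) > real k * \<theta> * real (card {P\<in>Pr. P \<subseteq> fst \<omega>})" using contra by simp
    have R1: "R1 \<subseteq> R" "finite R1" using R by (auto simp: R1_def RU_def)
    have "card {P. card P = 2 \<and> (\<exists>e\<in>R1. P \<subseteq> T e)} \<le> card {P\<in>Pr. P \<subseteq> fst \<omega>}"
    proof (rule card_mono)
      show "finite {P\<in>Pr. P \<subseteq> fst \<omega>}" using finPr by simp
    qed (auto simp: Pr_def R1_def RU_def)
    then have "real k * \<theta> * real (card {P. card P = 2 \<and> (\<exists>e\<in>R1. P \<subseteq> T e)}) \<le> real k * \<theta> * real (card {P\<in>Pr. P \<subseteq> fst \<omega>})"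
      using \<theta> by (intro mult_left_mono) auto
    then have gt': "real (card R1) > real k * \<theta> * real (card {P. card P = 2 \<and> (\<exists>e\<in>R1. P \<subseteq> T e)})" using gt by linarith
    have mult1: "real (card {e\<in>R1. T e = Y}) \<le> \<theta>" for Y
    proof -
      have "card {e\<in>R1. T e = Y} \<le> card {e\<in>R. T e = Y}" using R R1 by (intro card_mono) auto
      then show ?thesis using mult[of Y] by linarith
    qed
    obtain xs where xs: "length xs = k" "distinct xs" "\<And>i. i < k \<Longrightarrow> \<exists>e\<in>R1. cpair xs i \<subseteq> T e"
      using triple_system_cycle[OF R1(2) _ \<theta> mult1 k gt'] T R1(1) by blast
    have "\<exists>g\<in>\<G>. \<forall>(P, h)\<in>g. P \<in> cpair xs ` {..<k} \<and> snd \<omega> P = h"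
    proof (rule bad[OF _ xs(2,1)])
      show "snd \<omega> \<in> PiE I E" using \<omega> by (auto simp: \<Omega>_def B_def)
      show "\<forall>i<k. \<exists>e\<in>R. cpair xs i \<subseteq> T e" using xs(3) R1(1) by blast
    qed
    then obtain g where g: "g \<in> \<G>" "\<And>P h. (P, h) \<in> g \<Longrightarrow> P \<in> cpair xs ` {..<k} \<and> snd \<omega> P = h" by fastforce
    have "P \<subseteq> fst \<omega>" if Ph: "(P, h) \<in> g" for P h
    proof -
      obtain i where "i < k" "P = cpair xs i" using g(2)[OF Ph] by auto
      then obtain e where "e \<in> R1" "P \<subseteq> T e" using xs(3) by blast
      then show ?thesis by (auto simp: R1_def RU_def)
    qed
    then have occ: "occurs g (fst \<omega>) (snd \<omega>)" using g(2) by (force simp: occurs_def)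
    have "rep g \<in> g" using \<G>(2) g(1) by blast
    then have "fst (rep g) \<in> cpair xs ` {..<k}" using g(2)[of "fst (rep g)" "snd (rep g)"] by simp
    then obtain i where "i < k" "fst (rep g) = cpair xs i" by auto
    then obtain e where e: "e \<in> R1" "fst (rep g) \<subseteq> T e" using xs(3) by metis
    then have "e \<in> kill g \<omega>" using occ by (auto simp: kill_def R1_def RU_def)
    then show False using e g(1) by (auto simp: R1_def)
  qed
  have av1: "avg \<Omega> (\<lambda>\<omega>. real (card (RU \<omega>))) \<ge> real (card R) * (q / 2) ^ 3"
  proof -
    have "avg \<Omega> (\<lambda>\<omega>. real (card (RU \<omega>))) = (\<Sum>e\<in>R. freq \<Omega> (\<lambda>\<omega>. T e \<subseteq> fst \<omega>))"
      unfolding RU_def by (rule avg_card) (use fin\<Omega> R in auto)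
    also have "\<dots> \<ge> (\<Sum>e\<in>R. (q / 2) ^ 3)"
    proof (rule sum_mono)
      fix e assume e: "e \<in> R"
      have "freq \<Omega> (\<lambda>\<omega>. T e \<subseteq> fst \<omega>) = freq A (\<lambda>U. T e \<subseteq> U) * freq B (\<lambda>_. True)"
        unfolding \<Omega>_def freq_Times[symmetric] by simp
      also have "freq B (\<lambda>_. True) = 1" using finB by (simp add: freq_def)
      finally have eq: "freq \<Omega> (\<lambda>\<omega>. T e \<subseteq> fst \<omega>) = freq A (\<lambda>U. T e \<subseteq> U)" by simp
      have "freq A (\<lambda>U. T e \<subseteq> U) \<ge> (real M / (2 * real (card V))) ^ card (T e)"
        unfolding A_def by (rule freq_superset_ge) (use V T[OF e] M in auto)
      then show "(q / 2) ^ 3 \<le> freq \<Omega> (\<lambda>\<omega>. T e \<subseteq> fst \<omega>)"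
        unfolding eq using T[OF e] by (simp add: q_def mult.commute)
    qed
    finally show ?thesis by simp
  qed
  have av2: "avg \<Omega> (\<lambda>\<omega>. real (card {P\<in>Pr. P \<subseteq> fst \<omega>})) \<le> real (card Pr) * q\<^sup>2"
  proof -
    have "avg \<Omega> (\<lambda>\<omega>. real (card {P\<in>Pr. P \<subseteq> fst \<omega>})) = (\<Sum>P\<in>Pr. freq \<Omega> (\<lambda>\<omega>. P \<subseteq> fst \<omega>))"
      by (rule avg_card) (use fin\<Omega> finPr in auto)
    also have "\<dots> \<le> real (card Pr) * q\<^sup>2"
    proof (rule sum_bounded_above)
      fix P assume "P \<in> Pr"
      then have P: "P \<subseteq> V" "card P = 2" using PrI I(2) by auto
      have "freq \<Omega> (\<lambda>\<omega>. P \<subseteq> fst \<omega>) = freq A (\<lambda>U. P \<subseteq> U) * freq B (\<lambda>_. True)"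
        unfolding \<Omega>_def freq_Times[symmetric] by simp
      also have "freq B (\<lambda>_. True) = 1" using finB by (simp add: freq_def)
      also have "freq A (\<lambda>U. P \<subseteq> U) \<le> (real M / real (card V)) ^ card P"
        unfolding A_def by (rule freq_superset_le) (use V P M n0 in auto)
      finally show "freq \<Omega> (\<lambda>\<omega>. P \<subseteq> fst \<omega>) \<le> q\<^sup>2" using P by (simp add: q_def)
    qed
    finally show ?thesis .
  qed
  have av3: "avg \<Omega> (\<lambda>\<omega>. real (card (kill g \<omega>))) \<le>
      (1 + 2 * real k) * q ^ (card (\<Union>(fst ` g)) + 1) * real (card {e\<in>R. fst (rep g) \<subseteq> T e}) * (\<Prod>P\<in>fst ` g. 1 / real (card (E P)))"
    if g: "g \<in> \<G>" for g
  proof -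
    note gg = \<G>(2)[OF g]
    define W where "W = \<Union>(fst ` g)"
    define Pg where "Pg = fst (rep g)"
    define Rg where "Rg = {e\<in>R. Pg \<subseteq> T e}"
    define pw where "pw = (\<Prod>P\<in>fst ` g. 1 / real (card (E P)))"
    have pw_nonneg: "pw \<ge> 0" unfolding pw_def by (intro prod_nonneg) auto
    have PgI: "Pg \<in> I" "Pg \<subseteq> W" using gg by (auto simp: Pg_def W_def)
    have Pg2: "card Pg = 2" using I(2) PgI by auto
    have "P \<subseteq> V" if "P \<in> fst ` g" for P using that gg I(2) by blast
    then have WV: "W \<subseteq> V" unfolding W_def by (rule Union_least)
    have finW: "finite W" using WV V finite_subset by blast
    have finRg: "finite Rg" using R by (simp add: Rg_def)
    define f where "f P = snd (THE x. x \<in> g \<and> fst x = P)" for P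
    have f: "f P = h" if "(P, h) \<in> g" for P h
    proof -
      have "(THE x. x \<in> g \<and> fst x = P) = (P, h)"
        using that gg by (intro the_equality) (auto simp: inj_on_def)
      then show ?thesis by (simp add: f_def)
    qed
    have fr: "freq \<Omega> (\<lambda>\<omega>. T e \<subseteq> fst \<omega> \<and> occurs g (fst \<omega>) (snd \<omega>)) \<le> q ^ card (T e \<union> W) * pw" if e: "e \<in> R" for e
    proof -
      have "freq \<Omega> (\<lambda>\<omega>. T e \<subseteq> fst \<omega> \<and> occurs g (fst \<omega>) (snd \<omega>)) \<le> freq \<Omega> (\<lambda>\<omega>. T e \<union> W \<subseteq> fst \<omega> \<and> (\<forall>P\<in>fst ` g. snd \<omega> P = f P))"
        by (intro freq_mono fin\<Omega>) (auto simp: occurs_def W_def f)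
      also have "\<dots> = freq A (\<lambda>U. T e \<union> W \<subseteq> U) * freq B (\<lambda>\<phi>. \<forall>P\<in>fst ` g. \<phi> P = f P)"
        unfolding \<Omega>_def by (rule freq_Times)
      also have "\<dots> \<le> q ^ card (T e \<union> W) * pw"
      proof (rule mult_mono)
        show "freq A (\<lambda>U. T e \<union> W \<subseteq> U) \<le> q ^ card (T e \<union> W)"
          unfolding A_def q_def by (rule freq_superset_le) (use V T[OF e] WV M n0 in auto)
        have "freq B (\<lambda>\<phi>. \<forall>P\<in>fst ` g. \<phi> P = f P) = (if \<forall>P\<in>fst ` g. f P \<in> E P then pw else 0)"
          unfolding B_def pw_def by (rule freq_PiE) (use I(1) gg E in auto)
        then show "freq B (\<lambda>\<phi>. \<forall>P\<in>fst ` g. \<phi> P = f P) \<le> pw" using pw_nonneg by auto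
      qed (use q in \<open>auto simp: freq_nonneg\<close>)
      finally show ?thesis .
    qed
    have "avg \<Omega> (\<lambda>\<omega>. real (card (kill g \<omega>))) = (\<Sum>e\<in>Rg. freq \<Omega> (\<lambda>\<omega>. T e \<subseteq> fst \<omega> \<and> occurs g (fst \<omega>) (snd \<omega>)))"
      unfolding kill_def Rg_def Pg_def by (rule avg_card) (use fin\<Omega> R in auto)
    also have "\<dots> \<le> (\<Sum>e\<in>Rg. q ^ card (T e \<union> W) * pw)"
      using fr by (intro sum_mono) (auto simp: Rg_def)
    also have "\<dots> = (\<Sum>e\<in>Rg. q ^ card (T e \<union> W)) * pw" by (simp add: sum_distrib_right)
    \<comment> \<open>A triple over the representative pair normally brings a new vertex and thus an
      additional factor \<open>q\<close>. Those with third vertex in \<open>W\<close> number at most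
      \<open>2 * k * \<theta>\<close>; heaviness and \<open>\<mu> * q \<ge> 1\<close> bound
      \<open>\<theta>\<close> by \<open>card Rg * q\<close>, which supplies the missing
      factor.\<close>
    also have "(\<Sum>e\<in>Rg. q ^ card (T e \<union> W)) \<le> (1 + 2 * real k) * q ^ (card W + 1) * real (card Rg)"
    proof (cases "Rg = {}")
      case False
      define Rin where "Rin = {e\<in>Rg. T e \<subseteq> W}"
      have third: "\<exists>x. T e = insert x Pg \<and> x \<notin> Pg" if "e \<in> Rg" for e
      proof -
        have e: "Pg \<subseteq> T e" "card (T e) = 3" using that T by (auto simp: Rg_def)
        have "finite Pg" using Pg2 card.infinite by fastforce
        then have "card (T e - Pg) = 1" using e Pg2 by (simp add: card_Diff_subset)
        then obtain x where "T e - Pg = {x}" using card_1_singletonE by blast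
        then show ?thesis using e by blast
      qed
      have out: "card (T e \<union> W) = card W + 1" if e: "e \<in> Rg" "\<not> T e \<subseteq> W" for e
      proof -
        obtain x where x: "T e = insert x Pg" using third e by blast
        then have "T e \<union> W = insert x W" "x \<notin> W" using PgI e by auto
        then show ?thesis using finW by simp
      qed
      have cin: "real (card Rin) \<le> real (card W) * \<theta>"
      proof -
        have "Rin \<subseteq> (\<Union>x\<in>W. {e\<in>R. T e = insert x Pg})"
        proof
          fix e assume e: "e \<in> Rin"
          then obtain x where "T e = insert x Pg" using third[of e] unfolding Rin_def by blast
          then show "e \<in> (\<Union>x\<in>W. {e\<in>R. T e = insert x Pg})" using e by (auto simp: Rin_def Rg_def)
        qed
        then have "card Rin \<le> card (\<Union>x\<in>W. {e\<in>R. T e = insert x Pg})" by (rule card_mono[rotated]) (use finW R in auto)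
        also have "\<dots> \<le> (\<Sum>x\<in>W. card {e\<in>R. T e = insert x Pg})" using finW by (intro card_UN_le) auto
        finally have "real (card Rin) \<le> real (\<Sum>x\<in>W. card {e\<in>R. T e = insert x Pg})" by (rule of_nat_mono)
        also have "\<dots> = (\<Sum>x\<in>W. real (card {e\<in>R. T e = insert x Pg}))" by (rule of_nat_sum)
        also have "\<dots> \<le> real (card W) * \<theta>" using mult by (intro sum_bounded_above) auto
        finally show ?thesis .
      qed
      have "\<theta> \<le> real (card Rg) * q"
      proof -
        obtain e1 where "e1 \<in> R" "Pg \<subseteq> T e1" using False by (auto simp: Rg_def)
        then have "\<mu> * \<theta> \<le> real (card Rg)" unfolding Rg_def using Pg2 by (rule heavy)
        then have "\<mu> * \<theta> * q \<le> real (card Rg) * q" using q by (intro mult_right_mono) auto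
        moreover have "1 * \<theta> \<le> (\<mu> * q) * \<theta>" using \<mu>q \<theta> by (intro mult_right_mono) auto
        ultimately show ?thesis by (simp add: mult_ac)
      qed
      then have "real (card W) * \<theta> \<le> real (2 * k) * (real (card Rg) * q)"
        using gg \<theta> unfolding W_def by (intro mult_mono) (auto simp flip: of_nat_mult)
      then have cin': "real (card Rin) \<le> 2 * real k * real (card Rg) * q" using cin by simp
      have "(\<Sum>e\<in>Rg. q ^ card (T e \<union> W)) = (\<Sum>e\<in>Rin. q ^ card (T e \<union> W)) + (\<Sum>e\<in>Rg - Rin. q ^ card (T e \<union> W))"
        by (rule sum.subset_diff[THEN trans]) (use finRg in \<open>auto simp: Rin_def add.commute\<close>)
      also have "(\<Sum>e\<in>Rin. q ^ card (T e \<union> W)) = (\<Sum>e\<in>Rin. q ^ card W)"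
        by (intro sum.cong refl) (auto simp: Rin_def Un_absorb1)
      also have "\<dots> = real (card Rin) * q ^ card W" by simp
      also have "(\<Sum>e\<in>Rg - Rin. q ^ card (T e \<union> W)) \<le> real (card Rg) * q ^ (card W + 1)"
      proof -
        have "(\<Sum>e\<in>Rg - Rin. q ^ card (T e \<union> W)) = (\<Sum>e\<in>Rg - Rin. q ^ (card W + 1))"
          by (intro sum.cong refl) (use out in \<open>auto simp: Rin_def\<close>)
        also have "\<dots> \<le> real (card Rg) * q ^ (card W + 1)"
          using finRg q by (simp only: sum_constant) (intro mult_right_mono of_nat_mono card_mono, auto)
        finally show ?thesis .
      qed
      also have "real (card Rin) * q ^ card W \<le> (2 * real k * real (card Rg) * q) * q ^ card W"
        using cin' q by (intro mult_right_mono) auto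
      finally show ?thesis by (simp add: algebra_simps)
    qed simp
    finally show ?thesis using pw_nonneg unfolding W_def Rg_def Pg_def pw_def by (simp add: mult_right_mono)
  qed
  have "real (card R) * (q / 2) ^ 3 \<le> avg \<Omega> (\<lambda>\<omega>. real (card (RU \<omega>)))" by (rule av1)
  also have "\<dots> \<le> avg \<Omega> (\<lambda>\<omega>. real k * \<theta> * real (card {P\<in>Pr. P \<subseteq> fst \<omega>}) + (\<Sum>g\<in>\<G>. real (card (kill g \<omega>))))"
    by (rule avg_mono) (rule pointwise)
  also have "\<dots> = real k * \<theta> * avg \<Omega> (\<lambda>\<omega>. real (card {P\<in>Pr. P \<subseteq> fst \<omega>})) + (\<Sum>g\<in>\<G>. avg \<Omega> (\<lambda>\<omega>. real (card (kill g \<omega>))))"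
    by (simp only: avg_add avg_cmult avg_sum)
  also have "\<dots> \<le> real k * \<theta> * (real (card Pr) * q\<^sup>2) + (\<Sum>g\<in>\<G>. (1 + 2 * real k) * q ^ (card (\<Union>(fst ` g)) + 1) * real (card {e\<in>R. fst (rep g) \<subseteq> T e}) * (\<Prod>P\<in>fst ` g. 1 / real (card (E P))))"
    using av2 av3 \<theta> by (intro add_mono mult_left_mono sum_mono) auto
  finally show ?thesis unfolding Pr_def by (simp add: mult.assoc)
qed

text \<open>Removing a set \<open>Z\<close> of \<open>i - 2\<close> vertices from the sets
  \<open>A e\<close> containing it leaves triples, and a pair \<open>P\<close> in this link has the
  degree of the \<open>i\<close>-set \<open>Z \<union> P\<close>. Summing
  \<open>triple_sampling\<close> over all \<open>Z\<close> counts each element of \<open>R\<close>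
  at least once and at most \<open>2 ^ Suc i\<close> times.\<close>

lemma link_sampling:
  fixes R :: "'e set" and A :: "'e \<Rightarrow> 'a set" and \<theta> \<mu> :: real and E :: "'a set \<Rightarrow> 'h set"
  assumes V: "finite V" and R: "finite R" and i: "i \<ge> 2" and A: "\<And>e. e \<in> R \<Longrightarrow> A e \<subseteq> V \<and> card (A e) = Suc i"
    and \<theta>: "\<theta> > 0" and \<mu>: "\<mu> > 0" and k: "k \<ge> 2" and M: "6 \<le> M" "M \<le> card V"
    and mult: "\<And>Y. real (card {e\<in>R. A e = Y}) \<le> \<theta>"
    and heavy: "\<And>\<tau> e. e \<in> R \<Longrightarrow> \<tau> \<subseteq> A e \<Longrightarrow> card \<tau> = i \<Longrightarrow> real (card {e\<in>R. \<tau> \<subseteq> A e}) \<ge> \<mu> * \<theta>"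
    and I: "finite I" "\<And>P. P \<in> I \<Longrightarrow> P \<subseteq> V \<and> card P = 2" "\<And>P e. e \<in> R \<Longrightarrow> P \<subseteq> A e \<Longrightarrow> card P = 2 \<Longrightarrow> P \<in> I"
    and E: "\<And>P. P \<in> I \<Longrightarrow> finite (E P) \<and> E P \<noteq> {}"
    and \<G>: "finite \<G>" "\<And>g. g \<in> \<G> \<Longrightarrow> finite g \<and> inj_on fst g \<and> fst ` g \<subseteq> I \<and> card (\<Union>(fst ` g)) \<le> 2 * k \<and> rep g \<in> g"
    and bad: "\<And>\<phi> xs. \<phi> \<in> PiE I E \<Longrightarrow> distinct xs \<Longrightarrow> length xs = k \<Longrightarrow> (\<forall>i<k. \<exists>e\<in>R. cpair xs i \<subseteq> A e) \<Longrightarrow>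
        \<exists>g\<in>\<G>. \<forall>(P, h)\<in>g. P \<in> cpair xs ` {..<k} \<and> \<phi> P = h"
  defines "q \<equiv> real M / real (card V)"
  assumes \<mu>q: "\<mu> * q \<ge> 1"
  shows "real (card R) * (q / 2) ^ 3 \<le>
     real k * 4 ^ Suc i * real (card R) * q\<^sup>2 / \<mu> +
     (\<Sum>g\<in>\<G>. (1 + 2 * real k) * 2 ^ Suc i * q ^ (card (\<Union>(fst ` g)) + 1) * real (card {e\<in>R. fst (rep g) \<subseteq> A e}) *
        (\<Prod>P\<in>fst ` g. 1 / real (card (E P))))"
proof -
  define ZZ where "ZZ = {Z. Z \<subseteq> V \<and> card Z = i - 2}"
  have finZZ: "finite ZZ" using V by (simp add: ZZ_def)
  have n0: "card V > 0" using M by simp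
  have q: "q > 0" using M n0 by (auto simp: q_def)
  define RZ where "RZ Z = {e\<in>R. Z \<subseteq> A e}" for Z
  define TZ where "TZ Z e = A e - Z" for Z e
  define PZ where "PZ Z = {P. card P = 2 \<and> (\<exists>e\<in>RZ Z. P \<subseteq> TZ Z e)}" for Z
  define wZ where "wZ Z P = real (card {e\<in>RZ Z. P \<subseteq> TZ Z e})" for Z P
  define pw where "pw g = (\<Prod>P\<in>fst ` g. 1 / real (card (E P)))" for g :: "('a set \<times> 'h) set"
  define cst where "cst g = (1 + 2 * real k) * q ^ (card (\<Union>(fst ` g)) + 1)" for g :: "('a set \<times> 'h) set"
  have pw0: "pw g \<ge> 0" for g unfolding pw_def by (intro prod_nonneg) auto
  have cst0: "cst g \<ge> 0" for g using q by (simp add: cst_def)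
  have finA: "finite (A e)" if "e \<in> R" for e using A[OF that] V finite_subset by blast
  have PZI: "PZ Z \<subseteq> I" for Z using I(3) by (auto simp: PZ_def RZ_def TZ_def)
  have finPZ: "finite (PZ Z)" for Z using PZI I(1) finite_subset by blast
  have wheavy: "wZ Z P \<ge> \<mu> * \<theta>" if Z: "Z \<in> ZZ" and P: "P \<in> PZ Z" for Z P
  proof -
    obtain e where e: "e \<in> R" "Z \<subseteq> A e" "P \<subseteq> A e - Z" "card P = 2" using P by (auto simp: PZ_def RZ_def TZ_def)
    have "card (Z \<union> P) = card Z + card P"
      by (rule card_Un_disjoint) (use e finA[OF e(1)] in \<open>auto intro: finite_subset\<close>)
    then have c: "card (Z \<union> P) = i" using Z e(4) i by (simp add: ZZ_def)
    have "{e\<in>RZ Z. P \<subseteq> TZ Z e} = {e\<in>R. Z \<union> P \<subseteq> A e}" using e(3) by (auto simp: RZ_def TZ_def)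
    then show ?thesis using heavy[OF e(1) _ c] e by (auto simp: wZ_def)
  qed
  have each: "real (card (RZ Z)) * (q / 2) ^ 3 \<le> real k * \<theta> * real (card (PZ Z)) * q\<^sup>2 + (\<Sum>g\<in>\<G>. cst g * wZ Z (fst (rep g)) * pw g)"
    if Z: "Z \<in> ZZ" for Z
    unfolding cst_def wZ_def pw_def PZ_def q_def
  proof (rule triple_sampling[OF V _ _ \<theta> \<mu> k M _ _ I(1,2) _ E \<G>])
    show "finite (RZ Z)" using R by (simp add: RZ_def)
    show "TZ Z e \<subseteq> V \<and> card (TZ Z e) = 3" if "e \<in> RZ Z" for e
    proof -
      have e: "e \<in> R" "Z \<subseteq> A e" using that by (auto simp: RZ_def)
      have "card (A e - Z) = card (A e) - card Z"
        by (rule card_Diff_subset) (use e finA[OF e(1)] in \<open>auto intro: finite_subset\<close>)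
      then show ?thesis using A[OF e(1)] Z i by (auto simp: TZ_def ZZ_def)
    qed
    show "real (card {e\<in>RZ Z. TZ Z e = Y}) \<le> \<theta>" for Y
    proof -
      have "card {e\<in>RZ Z. TZ Z e = Y} \<le> card {e\<in>R. A e = Z \<union> Y}"
        by (rule card_mono) (use R in \<open>auto simp: RZ_def TZ_def\<close>)
      then show ?thesis using mult[of "Z \<union> Y"] by linarith
    qed
    show "\<mu> * \<theta> \<le> real (card {e\<in>RZ Z. P \<subseteq> TZ Z e})" if "e \<in> RZ Z" "P \<subseteq> TZ Z e" "card P = 2" for P e
      using wheavy[OF Z, of P] that by (auto simp: wZ_def PZ_def)
    show "P \<in> I" if "e \<in> RZ Z" "P \<subseteq> TZ Z e" "card P = 2" for P e
      by (rule I(3)[of e]) (use that in \<open>auto simp: RZ_def TZ_def\<close>)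
    show "\<exists>g\<in>\<G>. \<forall>(P, h)\<in>g. P \<in> cpair xs ` {..<k} \<and> \<phi> P = h"
      if "\<phi> \<in> PiE I E" "distinct xs" "length xs = k" "\<forall>i<k. \<exists>e\<in>RZ Z. cpair xs i \<subseteq> TZ Z e" for \<phi> xs
    proof (rule bad[OF that(1-3)])
      show "\<forall>i<k. \<exists>e\<in>R. cpair xs i \<subseteq> A e" using that(4) unfolding RZ_def TZ_def by blast
    qed
    show "1 \<le> \<mu> * (real M / real (card V))" using \<mu>q by (simp add: q_def)
  qed
  have tot: "real (card R) \<le> (\<Sum>Z\<in>ZZ. real (card (RZ Z)))"
  proof -
    have "(\<Sum>Z\<in>ZZ. card (RZ Z)) = (\<Sum>e\<in>R. card {Z\<in>ZZ. Z \<subseteq> A e})"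
      unfolding RZ_def using sum.swap_restrict[OF finZZ R, of "\<lambda>_ _. 1::nat" "\<lambda>Z e. Z \<subseteq> A e"] by simp
    also have "\<dots> \<ge> (\<Sum>e\<in>R. 1)"
    proof (rule sum_mono)
      fix e assume e: "e \<in> R"
      have le: "i - 2 \<le> card (A e)" using A[OF e] by simp
      obtain Z where Z: "Z \<subseteq> A e" "card Z = i - 2" by (rule obtain_subset_with_card_n[OF le]) (rule that)
      have "Z \<subseteq> V" using Z(1) A[OF e] by blast
      then have "Z \<in> {Z\<in>ZZ. Z \<subseteq> A e}" using Z by (simp add: ZZ_def)
      then have "card {Z\<in>ZZ. Z \<subseteq> A e} > 0" using finZZ by (auto simp: card_gt_0_iff)
      then show "1 \<le> card {Z\<in>ZZ. Z \<subseteq> A e}" by simp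
    qed
    finally have "card R \<le> (\<Sum>Z\<in>ZZ. card (RZ Z))" by simp
    then have "real (card R) \<le> real (\<Sum>Z\<in>ZZ. card (RZ Z))" by (rule of_nat_mono)
    then show ?thesis by (simp only: of_nat_sum)
  qed
  \<comment> \<open>Every pair of a link has weight at least \<open>\<mu> * \<theta>\<close>, so
    there are few of them. \<open>4 ^ Suc i\<close> arises from bounding by \<open>2 ^ Suc i\<close>
    both the pairs and the sets \<open>Z\<close> inside one \<open>A e\<close>.\<close>
  have pairs: "\<theta> * (\<Sum>Z\<in>ZZ. real (card (PZ Z))) \<le> 4 ^ Suc i * real (card R) / \<mu>"
  proof -
    have "\<mu> * \<theta> * real (card (PZ Z)) \<le> (\<Sum>e\<in>R. if Z \<subseteq> A e then 2 ^ Suc i else 0)" if Z: "Z \<in> ZZ" for Z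
    proof -
      have "\<mu> * \<theta> * real (card (PZ Z)) = (\<Sum>P\<in>PZ Z. \<mu> * \<theta>)" by simp
      also have "\<dots> \<le> (\<Sum>P\<in>PZ Z. wZ Z P)" using wheavy[OF Z] by (rule sum_mono)
      also have "\<dots> = real (\<Sum>P\<in>PZ Z. card {e\<in>RZ Z. P \<subseteq> TZ Z e})" by (simp add: wZ_def)
      also have "(\<Sum>P\<in>PZ Z. card {e\<in>RZ Z. P \<subseteq> TZ Z e}) = (\<Sum>e\<in>RZ Z. card {P\<in>PZ Z. P \<subseteq> TZ Z e})"
        using sum.swap_restrict[OF finPZ[of Z], of "RZ Z" "\<lambda>_ _. 1::nat" "\<lambda>P e. P \<subseteq> TZ Z e"] R by (simp add: RZ_def)
      also have "\<dots> \<le> (\<Sum>e\<in>RZ Z. 2 ^ Suc i)"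
      proof (rule sum_mono)
        fix e assume "e \<in> RZ Z"
        then have e: "e \<in> R" by (simp add: RZ_def)
        have "card {P\<in>PZ Z. P \<subseteq> TZ Z e} \<le> card (Pow (A e))"
          by (rule card_mono) (use finA[OF e] in \<open>auto simp: TZ_def\<close>)
        then show "card {P\<in>PZ Z. P \<subseteq> TZ Z e} \<le> 2 ^ Suc i" using finA[OF e] A[OF e] by (simp add: card_Pow)
      qed
      also have "real (\<Sum>e\<in>RZ Z. 2 ^ Suc i) = (\<Sum>e\<in>R. if Z \<subseteq> A e then 2 ^ Suc i else 0)"
        using R by (simp add: RZ_def sum.inter_filter[symmetric])
      finally show ?thesis by simp
    qed
    then have "(\<Sum>Z\<in>ZZ. \<mu> * \<theta> * real (card (PZ Z))) \<le> (\<Sum>Z\<in>ZZ. \<Sum>e\<in>R. if Z \<subseteq> A e then 2 ^ Suc i else 0)"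
      by (rule sum_mono)
    also have "\<dots> = (\<Sum>e\<in>R. \<Sum>Z\<in>ZZ. if Z \<subseteq> A e then 2 ^ Suc i else 0)" by (rule sum.swap)
    also have "\<dots> \<le> (\<Sum>e\<in>R. 2 ^ Suc i * 2 ^ Suc i)"
    proof (rule sum_mono)
      fix e assume e: "e \<in> R"
      have "card {Z\<in>ZZ. Z \<subseteq> A e} \<le> card (Pow (A e))" by (rule card_mono) (use finA[OF e] in auto)
      then have "card {Z\<in>ZZ. Z \<subseteq> A e} \<le> 2 ^ Suc i" using finA[OF e] A[OF e] by (simp add: card_Pow)
      then have "real (card {Z\<in>ZZ. Z \<subseteq> A e}) \<le> real (2 ^ Suc i)" by (rule of_nat_mono)
      then have "real (card {Z\<in>ZZ. Z \<subseteq> A e}) * 2 ^ Suc i \<le> 2 ^ Suc i * 2 ^ Suc i" by (intro mult_right_mono) auto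
      moreover have "(\<Sum>Z\<in>ZZ. if Z \<subseteq> A e then 2 ^ Suc i else (0::real)) = real (card {Z\<in>ZZ. Z \<subseteq> A e}) * 2 ^ Suc i"
        using finZZ by (simp add: sum.inter_filter[symmetric])
      ultimately show "(\<Sum>Z\<in>ZZ. if Z \<subseteq> A e then 2 ^ Suc i else (0::real)) \<le> 2 ^ Suc i * 2 ^ Suc i" by linarith
    qed
    also have "\<dots> = 4 ^ Suc i * real (card R)" by (simp flip: power_mult_distrib)
    finally have "\<mu> * (\<theta> * (\<Sum>Z\<in>ZZ. real (card (PZ Z)))) \<le> 4 ^ Suc i * real (card R)"
      by (simp add: sum_distrib_left mult.assoc)
    then show ?thesis using \<mu> by (simp add: pos_le_divide_eq mult.commute)
  qed
  have wsum: "(\<Sum>Z\<in>ZZ. wZ Z P) \<le> 2 ^ Suc i * real (card {e\<in>R. P \<subseteq> A e})" for P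
  proof -
    have "(\<Sum>Z\<in>ZZ. card {e\<in>RZ Z. P \<subseteq> TZ Z e}) \<le> (\<Sum>Z\<in>ZZ. card {e\<in>{e\<in>R. P \<subseteq> A e}. Z \<subseteq> A e})"
      by (intro sum_mono card_mono) (use R in \<open>auto simp: RZ_def TZ_def\<close>)
    also have "\<dots> = (\<Sum>e\<in>{e\<in>R. P \<subseteq> A e}. card {Z\<in>ZZ. Z \<subseteq> A e})"
      using sum.swap_restrict[OF finZZ, of "{e\<in>R. P \<subseteq> A e}" "\<lambda>_ _. 1::nat" "\<lambda>Z e. Z \<subseteq> A e"] R by simp
    also have "\<dots> \<le> (\<Sum>e\<in>{e\<in>R. P \<subseteq> A e}. 2 ^ Suc i)"
    proof (rule sum_mono)
      fix e assume "e \<in> {e\<in>R. P \<subseteq> A e}"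
      then have e: "e \<in> R" by simp
      have "card {Z\<in>ZZ. Z \<subseteq> A e} \<le> card (Pow (A e))" by (rule card_mono) (use finA[OF e] in auto)
      then show "card {Z\<in>ZZ. Z \<subseteq> A e} \<le> 2 ^ Suc i" using finA[OF e] A[OF e] by (simp add: card_Pow)
    qed
    also have "\<dots> = 2 ^ Suc i * card {e\<in>R. P \<subseteq> A e}" by simp
    finally have "real (\<Sum>Z\<in>ZZ. card {e\<in>RZ Z. P \<subseteq> TZ Z e}) \<le> real (2 ^ Suc i * card {e\<in>R. P \<subseteq> A e})"
      by (rule of_nat_mono)
    then show ?thesis by (simp add: wZ_def)
  qed
  have "real (card R) * (q / 2) ^ 3 \<le> (\<Sum>Z\<in>ZZ. real (card (RZ Z))) * (q / 2) ^ 3"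
    using tot q by (intro mult_right_mono) auto
  also have "\<dots> = (\<Sum>Z\<in>ZZ. real (card (RZ Z)) * (q / 2) ^ 3)" by (rule sum_distrib_right)
  also have "\<dots> \<le> (\<Sum>Z\<in>ZZ. real k * \<theta> * real (card (PZ Z)) * q\<^sup>2 + (\<Sum>g\<in>\<G>. cst g * wZ Z (fst (rep g)) * pw g))"
    using each by (rule sum_mono)
  also have "\<dots> = real k * q\<^sup>2 * (\<theta> * (\<Sum>Z\<in>ZZ. real (card (PZ Z)))) + (\<Sum>g\<in>\<G>. cst g * (\<Sum>Z\<in>ZZ. wZ Z (fst (rep g))) * pw g)"
  proof -
    have "(\<Sum>Z\<in>ZZ. \<Sum>g\<in>\<G>. cst g * wZ Z (fst (rep g)) * pw g) = (\<Sum>g\<in>\<G>. \<Sum>Z\<in>ZZ. cst g * wZ Z (fst (rep g)) * pw g)"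
      by (rule sum.swap)
    then show ?thesis by (simp add: sum.distrib sum_distrib_left sum_distrib_right mult_ac)
  qed
  also have "\<dots> \<le> real k * q\<^sup>2 * (4 ^ Suc i * real (card R) / \<mu>) +
      (\<Sum>g\<in>\<G>. cst g * (2 ^ Suc i * real (card {e\<in>R. fst (rep g) \<subseteq> A e})) * pw g)"
    using pairs wsum pw0 cst0 by (intro add_mono mult_left_mono sum_mono mult_right_mono) auto
  also have "\<dots> = real k * 4 ^ Suc i * real (card R) * q\<^sup>2 / \<mu> +
     (\<Sum>g\<in>\<G>. (1 + 2 * real k) * 2 ^ Suc i * q ^ (card (\<Union>(fst ` g)) + 1) * real (card {e\<in>R. fst (rep g) \<subseteq> A e}) * pw g)"
    by (simp add: cst_def mult_ac)
  finally show ?thesis unfolding pw_def .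
qed

text \<open>\<open>\<kappa>\<close> says for which pair each edge of \<open>S\<close> is drawn. The
  edge is kept as second component, so different edges stay different even where
  \<open>\<kappa>\<close> repeats a pair.\<close>

definition event :: "'a set set \<Rightarrow> ('a set \<Rightarrow> 'a set) \<Rightarrow> ('a set \<times> 'a set) set" where
  "event S \<kappa> = (\<lambda>h. (\<kappa> h, h)) ` S"

lemma card_event: "card (event S \<kappa>) = card S"
  unfolding event_def by (rule card_image) (auto simp: inj_on_def)

text \<open>For each pair draw a random edge of \<open>H\<close> through it. A cycle of pairs fails
  to yield the desired Berge cycle only if the drawn edges contain a forbidden set or two of them
  coincide. Both failures are bad events for \<open>link_sampling\<close>, and \<open>few\<close>
  contradicts the inequality obtained there.\<close>

lemma cycle_in_heavy_graph:
  fixes H R :: "'a set set" and A :: "'a set \<Rightarrow> 'a set" and \<theta> \<mu> D :: real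
  assumes V: "finite V" and H: "\<And>h. h \<in> H \<Longrightarrow> h \<subseteq> V \<and> card h = r" and R: "R \<subseteq> H"
    and i: "i \<ge> 2" "Suc i \<le> r" and A: "\<And>e. e \<in> R \<Longrightarrow> A e \<subseteq> e \<and> card (A e) = Suc i"
    and \<theta>: "\<theta> > 0" and \<mu>: "\<mu> > 0" and k: "k \<ge> 3" and M: "6 \<le> M" "M \<le> card V" and D: "D > 0"
    and codeg: "\<And>P e. e \<in> R \<Longrightarrow> P \<subseteq> A e \<Longrightarrow> card P = 2 \<Longrightarrow> real (card {h\<in>H. P \<subseteq> h}) \<ge> D"
    and mult: "\<And>Y. real (card {e\<in>R. A e = Y}) \<le> \<theta>"
    and heavy: "\<And>\<tau> e. e \<in> R \<Longrightarrow> \<tau> \<subseteq> A e \<Longrightarrow> card \<tau> = i \<Longrightarrow> real (card {e\<in>R. \<tau> \<subseteq> A e}) \<ge> \<mu> * \<theta>"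
    and F: "\<And>S. S \<in> F \<Longrightarrow> S \<subseteq> H \<and> S \<noteq> {} \<and> card S \<le> k"
  defines "q \<equiv> real M / real (card V)"
  assumes \<mu>q: "\<mu> * q \<ge> 1"
    and few: "real k * 4 ^ r * real (card R) * q\<^sup>2 / \<mu> + (1 + 2 * real k) * 2 ^ r * 2 ^ (r * k) *
       ((\<Sum>S | S \<in> F \<and> card S < k. q ^ (card S + 2) / D ^ (card S - 1)) +
        real (card {S\<in>F. card S = k}) * q ^ (k + 1) / D ^ (k - 1) + real (card H) * q ^ 4 / D)
      < real (card R) * (q / 2) ^ 3"
  shows "\<exists>xs h. distinct xs \<and> length xs = k \<and> inj_on h {..<k} \<and> (\<forall>i<k. h i \<in> H \<and> cpair xs i \<subseteq> h i) \<and>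
    (\<forall>S\<in>F. \<not> S \<subseteq> h ` {..<k})"
proof (rule ccontr)
  assume contra: "\<not> ?thesis"
  have contra': "\<exists>S\<in>F. S \<subseteq> h ` {..<k}"
    if "distinct xs" "length xs = k" "inj_on h {..<k}" "\<And>i. i < k \<Longrightarrow> h i \<in> H \<and> cpair xs i \<subseteq> h i" for xs h
  proof (rule ccontr)
    assume no: "\<not> ?thesis"
    show False
      by (rule notE[OF contra], rule exI[of _ xs], rule exI[of _ h]) (use that no in auto)
  qed
  have n0: "card V > 0" using M by simp
  have q: "q > 0" "q \<le> 1" using M n0 by (auto simp: q_def)
  have finH: "finite H" using H V by (intro finite_subset[of H "Pow V"]) auto
  have finR: "finite R" using R finH finite_subset by blast
  have finh: "finite h" if "h \<in> H" for h using H[OF that] V finite_subset by blast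
  have finF: "finite F" using F finH by (intro finite_subset[of F "Pow H"]) auto
  define I where "I = {P. card P = 2 \<and> (\<exists>e\<in>R. P \<subseteq> A e)}"
  define E where "E P = {h\<in>H. P \<subseteq> h}" for P
  have I: "P \<subseteq> V \<and> card P = 2" if "P \<in> I" for P
    using that A R H unfolding I_def by blast
  have finI: "finite I" using I V by (intro finite_subset[of I "Pow V"]) auto
  have ED: "real (card (E P)) \<ge> D" if "P \<in> I" for P using that codeg by (auto simp: I_def E_def)
  have E: "finite (E P) \<and> E P \<noteq> {}" if "P \<in> I" for P
  proof -
    have "card (E P) > 0" using ED[OF that] D by linarith
    then show ?thesis by (simp add: card_gt_0_iff)
  qed
  \<comment> \<open>The shape of every event arising from a cycle: distinct pairs, spanning more
    vertices than there are pairs unless the whole cycle is used. Events of any other shape might be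
    too likely and are left out.\<close>
  define ok where "ok g \<longleftrightarrow> inj_on fst g \<and> fst ` g \<subseteq> I \<and> card (\<Union>(fst ` g)) \<ge> (if card g = k then k else card g + 1)"
    for g :: "('a set \<times> 'a set) set"
  define S1 where "S1 = (SIGMA S:F. PiE S (\<lambda>h. Pow h))"
  define S2 where "S2 = (SIGMA h:H. Pow h \<times> Pow h)"
  define f1 where "f1 = (\<lambda>(S :: 'a set set, \<kappa>). event S \<kappa>)"
  define f2 where "f2 = (\<lambda>(h, P, P'). {(P, h), (P', h)} :: ('a set \<times> 'a set) set)"
  \<comment> \<open>\<open>G1\<close> holds the ways of drawing a forbidden set, \<open>G2\<close>
    those of drawing one edge for two different pairs.\<close>
  define G1 where "G1 = {g \<in> f1 ` S1. ok g}"
  define G2 where "G2 = {g \<in> f2 ` S2. ok g \<and> card g = 2}"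
  define \<G> where "\<G> = G1 \<union> G2"
  define rep where "rep g = (SOME x. x \<in> g)" for g :: "('a set \<times> 'a set) set"
  have finP: "finite (PiE S (\<lambda>h. Pow h))" if "S \<in> F" for S
  proof (rule finite_PiE)
    show "finite S" using F[OF that] finH finite_subset by blast
    show "finite (Pow h)" if "h \<in> S" for h using F[OF \<open>S \<in> F\<close>] finh that by auto
  qed
  have finS1: "finite S1" unfolding S1_def by (rule finite_SigmaI[OF finF finP])
  have finS2: "finite S2" unfolding S2_def
    by (intro finite_SigmaI finite_cartesian_product) (use finH finh in auto)
  have finG: "finite G1" "finite G2" using finS1 finS2 by (auto simp: G1_def G2_def)
  have g1: "\<exists>S\<in>F. card g = card S \<and> finite g \<and> g \<noteq> {}" if g1: "g \<in> G1" for g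
  proof -
    obtain S \<kappa> where S: "S \<in> F" "g = event S \<kappa>" using g1 by (auto simp: G1_def f1_def S1_def)
    have "finite S" using F[OF S(1)] finH finite_subset by blast
    then show ?thesis using S F[OF S(1)] by (auto simp: card_event) (auto simp: event_def)
  qed
  have gprop: "finite g \<and> g \<noteq> {} \<and> card g \<le> k \<and> ok g" if "g \<in> \<G>" for g
  proof (cases "g \<in> G1")
    case True
    then show ?thesis using g1[OF True] F by (auto simp: G1_def)
  next
    case False
    then have "g \<in> G2" using that by (simp add: \<G>_def)
    then have "ok g" "card g = 2" by (auto simp: G2_def)
    moreover from \<open>card g = 2\<close> have "finite g" "g \<noteq> {}" using card.infinite by fastforce+
    ultimately show ?thesis using k by simp
  qed
  have \<G>: "finite g \<and> inj_on fst g \<and> fst ` g \<subseteq> I \<and> card (\<Union>(fst ` g)) \<le> 2 * k \<and> rep g \<in> g" if "g \<in> \<G>" for g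
  proof -
    note gg = gprop[OF that]
    have "card (\<Union>(fst ` g)) \<le> (\<Sum>P\<in>fst ` g. card P)"
      using card_Union_le_sum_card by blast
    also have "\<dots> = (\<Sum>P\<in>fst ` g. 2)" using gg I by (intro sum.cong refl) (auto simp: ok_def)
    also have "\<dots> \<le> 2 * card g" using gg card_image_le[of g fst] by simp
    finally have "card (\<Union>(fst ` g)) \<le> 2 * k" using gg by simp
    moreover have "rep g \<in> g" unfolding rep_def using gg by (simp add: some_in_eq)
    ultimately show ?thesis using gg by (auto simp: ok_def)
  qed
  have bad: "\<exists>g\<in>\<G>. \<forall>(P, h)\<in>g. P \<in> cpair xs ` {..<k} \<and> \<phi> P = h"
    if \<phi>: "\<phi> \<in> PiE I E" and xs: "distinct xs" "length xs = k" "\<forall>i<k. \<exists>e\<in>R. cpair xs i \<subseteq> A e" for \<phi> xs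
  proof -
    define h where "h j = \<phi> (cpair xs j)" for j
    have cI: "cpair xs j \<in> I" if "j < k" for j
      using xs that k cpair_card[OF xs(1), of j] by (auto simp: I_def)
    have hE: "h j \<in> H \<and> cpair xs j \<subseteq> h j" if "j < k" for j
      using PiE_mem[OF \<phi> cI[OF that]] by (auto simp: h_def E_def)
    have cinj: "inj_on (cpair xs) {..<k}" using cpair_inj[OF xs(1)] xs(2) k by simp
    have span: "card (\<Union>j\<in>J. cpair xs j) \<ge> (if card J = k then k else card J + 1)"
      if J: "J \<subseteq> {..<k}" "J \<noteq> {}" for J
    proof -
      have "card (\<Union>j\<in>J. cpair xs j) \<ge> (if card J = length xs then length xs else card J + 1)"
        by (rule card_UN_cpair) (use xs(1,2) k J in auto)
      then show ?thesis unfolding xs(2) .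
    qed
    have okJ: "ok ((\<lambda>j. (cpair xs j, h j)) ` J) \<and> card ((\<lambda>j. (cpair xs j, h j)) ` J) = card J"
      if J: "J \<subseteq> {..<k}" "J \<noteq> {}" for J
    proof -
      let ?g = "(\<lambda>j. (cpair xs j, h j)) ` J"
      have fst: "fst ` ?g = cpair xs ` J" by (simp add: image_image)
      have "inj_on (cpair xs) J" using cinj J inj_on_subset by blast
      then have c: "card ?g = card J" by (intro card_image) (auto simp: inj_on_def)
      have "inj_on fst ?g" using \<open>inj_on (cpair xs) J\<close> by (auto simp: inj_on_def)
      moreover have "fst ` ?g \<subseteq> I" unfolding fst using cI J by auto
      ultimately show ?thesis using span[OF J] unfolding ok_def fst c by blast
    qed
    show ?thesis
    proof (cases "inj_on h {..<k}")
      case True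
      obtain S where S: "S \<in> F" "S \<subseteq> h ` {..<k}" using contra'[OF xs(1,2) True] hE by blast
      obtain J where J: "J \<subseteq> {..<k}" "S = h ` J" using S(2) by (metis subset_imageE)
      have Jne: "J \<noteq> {}" using F[OF S(1)] J by auto
      define g where "g = (\<lambda>j. (cpair xs j, h j)) ` J"
      define \<kappa> where "\<kappa> = restrict (\<lambda>x. cpair xs (the_inv_into {..<k} h x)) S"
      have kap: "\<kappa> (h j) = cpair xs j" if "j \<in> J" for j
      proof -
        have "j \<in> {..<k}" "h j \<in> S" using that J by auto
        then show ?thesis using True by (simp add: \<kappa>_def the_inv_into_f_f)
      qed
      have "event S \<kappa> = (\<lambda>j. (\<kappa> (h j), h j)) ` J" unfolding event_def J(2) by (simp add: image_image)
      also have "\<dots> = g" unfolding g_def by (rule image_cong) (use kap in auto)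
      finally have "g = f1 (S, \<kappa>)" by (simp add: f1_def)
      moreover have "(S, \<kappa>) \<in> S1"
      proof -
        have "\<kappa> x \<in> Pow x" if "x \<in> S" for x
        proof -
          obtain j where "j \<in> J" "x = h j" using \<open>x \<in> S\<close> J by auto
          then show ?thesis using kap hE J by auto
        qed
        moreover have "\<kappa> \<in> extensional S" by (simp add: \<kappa>_def)
        ultimately show ?thesis using S by (auto simp: S1_def PiE_iff)
      qed
      ultimately have "g \<in> G1" using okJ[OF J(1) Jne] by (auto simp: G1_def g_def[symmetric])
      moreover have "\<forall>(P, x)\<in>g. P \<in> cpair xs ` {..<k} \<and> \<phi> P = x" using J by (auto simp: g_def h_def)
      ultimately show ?thesis unfolding \<G>_def by blast
    next
      case False
      then obtain a b where ab: "a < k" "b < k" "a \<noteq> b" "h a = h b" by (auto simp: inj_on_def)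
      define g where "g = (\<lambda>j. (cpair xs j, h j)) ` {a, b}"
      have "g = f2 (h a, cpair xs a, cpair xs b)" using ab by (auto simp: g_def f2_def)
      moreover have "(h a, cpair xs a, cpair xs b) \<in> S2" using hE[of a] hE[of b] ab by (auto simp: S2_def)
      ultimately have "g \<in> f2 ` S2" by blast
      moreover have "ok g \<and> card g = card {a, b}" unfolding g_def by (rule okJ) (use ab in auto)
      ultimately have "g \<in> G2" using ab unfolding G2_def by simp
      moreover have "\<forall>(P, x)\<in>g. P \<in> cpair xs ` {..<k} \<and> \<phi> P = x" using ab by (auto simp: g_def h_def)
      ultimately show ?thesis unfolding \<G>_def by blast
    qed
  qed
  have main: "real (card R) * (q / 2) ^ 3 \<le>
     real k * 4 ^ Suc i * real (card R) * q\<^sup>2 / \<mu> +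
     (\<Sum>g\<in>\<G>. (1 + 2 * real k) * 2 ^ Suc i * q ^ (card (\<Union>(fst ` g)) + 1) * real (card {e\<in>R. fst (rep g) \<subseteq> A e}) *
        (\<Prod>P\<in>fst ` g. 1 / real (card (E P))))"
    unfolding q_def
  proof (rule link_sampling[OF V finR i(1) _ \<theta> \<mu> _ M mult heavy finI I _ E _ \<G> bad \<mu>q[unfolded q_def]])
    show "A e \<subseteq> V \<and> card (A e) = Suc i" if "e \<in> R" for e using A[OF that] H R that by blast
    show "finite \<G>" using finG by (simp add: \<G>_def)
  qed (use k in \<open>auto simp: I_def\<close>)
  \<comment> \<open>An event of \<open>m\<close> pairs spans at least \<open>m + 1\<close> vertices,
    or \<open>k\<close> if \<open>m = k\<close>, and the additional vertex of a triple gives one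
    more factor \<open>q\<close>. Only \<open>m - 1\<close> factors \<open>1 / D\<close> occur: at
    most as many elements of \<open>R\<close> lie over the representative pair as there are edges
    through it, which cancels the probability of the draw there.\<close>
  define cost where "cost m = (1 + 2 * real k) * 2 ^ r * (if m = k then q ^ (k + 1) else q ^ (m + 2)) / D ^ (m - 1)" for m
  have cost0: "cost m \<ge> 0" for m using q D by (simp add: cost_def)
  have costle: "(1 + 2 * real k) * 2 ^ Suc i * q ^ (card (\<Union>(fst ` g)) + 1) * real (card {e\<in>R. fst (rep g) \<subseteq> A e}) *
        (\<Prod>P\<in>fst ` g. 1 / real (card (E P))) \<le> cost (card g)" if g: "g \<in> \<G>" for g
  proof -
    note gg = gprop[OF g] \<G>[OF g]
    define Pg where "Pg = fst (rep g)"
    have Pg: "Pg \<in> fst ` g" using gg by (auto simp: Pg_def)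
    have PgI: "Pg \<in> I" using Pg gg by auto
    have fing: "finite (fst ` g)" using gg by simp
    have cfst: "card (fst ` g) = card g" using gg by (simp add: card_image)
    have w: "real (card {e\<in>R. Pg \<subseteq> A e}) \<le> real (card (E Pg))"
      using E[OF PgI] A R by (intro of_nat_mono card_mono) (auto simp: E_def)
    have EPg: "real (card (E Pg)) > 0" using ED[OF PgI] D by simp
    define X where "X = (\<Prod>P\<in>fst ` g - {Pg}. 1 / real (card (E P)))"
    have all: "(\<Prod>P\<in>fst ` g. 1 / real (card (E P))) = 1 / real (card (E Pg)) * X"
      unfolding X_def using fing Pg by (rule prod.remove)
    have X0: "X \<ge> 0" unfolding X_def by (intro prod_nonneg) auto
    have "X \<le> (\<Prod>P\<in>fst ` g - {Pg}. 1 / D)"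
      unfolding X_def
    proof (rule prod_mono)
      fix P assume "P \<in> fst ` g - {Pg}"
      then have "P \<in> I" using gg by auto
      then show "0 \<le> 1 / real (card (E P)) \<and> 1 / real (card (E P)) \<le> 1 / D"
        using ED[of P] D by (auto intro!: frac_le)
    qed
    also have "(\<Prod>P\<in>fst ` g - {Pg}. 1 / D) = 1 / D ^ (card g - 1)"
      using fing Pg cfst by (simp add: card_Diff_singleton power_divide)
    finally have X: "1 / real (card (E Pg)) * X \<le> 1 / real (card (E Pg)) * (1 / D ^ (card g - 1))"
      using EPg by (intro mult_left_mono) auto
    have "real (card {e\<in>R. Pg \<subseteq> A e}) * (\<Prod>P\<in>fst ` g. 1 / real (card (E P)))
        \<le> real (card (E Pg)) * (1 / real (card (E Pg)) * (1 / D ^ (card g - 1)))"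
      unfolding all by (rule mult_mono[OF w X]) (use X0 in auto)
    then have 1: "real (card {e\<in>R. Pg \<subseteq> A e}) * (\<Prod>P\<in>fst ` g. 1 / real (card (E P))) \<le> 1 / D ^ (card g - 1)"
      using EPg by simp
    have 2: "q ^ (card (\<Union>(fst ` g)) + 1) \<le> (if card g = k then q ^ (k + 1) else q ^ (card g + 2))"
    proof (cases "card g = k")
      case True
      then have "k \<le> card (\<Union>(fst ` g))" using gg by (simp add: ok_def)
      then have "q ^ (card (\<Union>(fst ` g)) + 1) \<le> q ^ (k + 1)" using q by (intro power_decreasing) auto
      then show ?thesis using True by simp
    next
      case False
      then have "card g + 1 \<le> card (\<Union>(fst ` g))" using gg by (simp add: ok_def)
      then have "q ^ (card (\<Union>(fst ` g)) + 1) \<le> q ^ (card g + 2)" using q by (intro power_decreasing) auto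
      then show ?thesis using False by simp
    qed
    have 3: "(2::real) ^ Suc i \<le> 2 ^ r" using i by (intro power_increasing) auto
    have "(1 + 2 * real k) * 2 ^ Suc i * q ^ (card (\<Union>(fst ` g)) + 1) * (real (card {e\<in>R. Pg \<subseteq> A e}) *
        (\<Prod>P\<in>fst ` g. 1 / real (card (E P)))) \<le>
        (1 + 2 * real k) * 2 ^ r * (if card g = k then q ^ (k + 1) else q ^ (card g + 2)) * (1 / D ^ (card g - 1))"
    proof -
      have "0 \<le> real (card {e\<in>R. Pg \<subseteq> A e}) * (\<Prod>P\<in>fst ` g. 1 / real (card (E P)))"
        by (intro mult_nonneg_nonneg prod_nonneg) auto
      then show ?thesis using 1 2 3 q by (intro mult_mono) auto
    qed
    then show ?thesis by (simp add: cost_def Pg_def mult.assoc)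
  qed
  \<comment> \<open>An edge has \<open>2 ^ r\<close> subsets that could serve as its pair, so one
    forbidden set gives at most \<open>2 ^ (r * k)\<close> events.\<close>
  have sum1: "(\<Sum>g\<in>G1. cost (card g)) \<le> 2 ^ (r * k) * (\<Sum>S\<in>F. cost (card S))"
  proof -
    have "(\<Sum>g\<in>G1. cost (card g)) \<le> (\<Sum>g\<in>f1 ` S1. cost (card g))"
      using finS1 cost0 by (intro sum_mono2) (auto simp: G1_def)
    also have "\<dots> \<le> (\<Sum>x\<in>S1. cost (card (f1 x)))"
      using sum_image_le[OF finS1, of "\<lambda>g. cost (card g)" f1] cost0 by (simp add: o_def)
    also have "\<dots> = (\<Sum>S\<in>F. \<Sum>\<kappa>\<in>PiE S (\<lambda>h. Pow h). cost (card S))"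
      unfolding S1_def f1_def
      by (subst sum.Sigma) (use finF finP in \<open>auto simp: card_event case_prod_unfold\<close>)
    also have "\<dots> \<le> (\<Sum>S\<in>F. 2 ^ (r * k) * cost (card S))"
    proof (rule sum_mono)
      fix S assume S: "S \<in> F"
      have finS: "finite S" using F[OF S] finH finite_subset by blast
      have "card (PiE S (\<lambda>h. Pow h)) = (\<Prod>h\<in>S. card (Pow h))" using finS by (rule card_PiE)
      also have "\<dots> = (\<Prod>h\<in>S. 2 ^ r)"
        using F[OF S] H finh by (intro prod.cong refl) (metis card_Pow subsetD)
      also have "\<dots> = 2 ^ (r * card S)" by (simp add: power_mult)
      also have "\<dots> \<le> (2::nat) ^ (r * k)" using F[OF S] by (intro power_increasing) auto
      finally have "real (card (PiE S (\<lambda>h. Pow h))) \<le> real (2 ^ (r * k))" by (rule of_nat_mono)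
      then have "real (card (PiE S (\<lambda>h. Pow h))) * cost (card S) \<le> 2 ^ (r * k) * cost (card S)"
        using cost0 by (intro mult_right_mono) auto
      then show "(\<Sum>\<kappa>\<in>PiE S (\<lambda>h. Pow h). cost (card S)) \<le> 2 ^ (r * k) * cost (card S)" by simp
    qed
    finally show ?thesis by (simp add: sum_distrib_left)
  qed
  have sum2: "(\<Sum>g\<in>G2. cost (card g)) \<le> 2 ^ (r * k) * (real (card H) * cost 2)"
  proof -
    have "(\<Sum>g\<in>G2. cost (card g)) = real (card G2) * cost 2" by (simp add: G2_def)
    moreover have "card G2 \<le> card H * 2 ^ (r * k)"
    proof -
      have "card G2 \<le> card (f2 ` S2)" using finS2 by (intro card_mono) (auto simp: G2_def)
      also have "\<dots> \<le> card S2" using finS2 by (rule card_image_le)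
      also have "\<dots> = (\<Sum>h\<in>H. card (Pow h \<times> Pow h))" unfolding S2_def by (rule card_SigmaI) (use finH finh in auto)
      also have "\<dots> = (\<Sum>h\<in>H. 2 ^ (r * 2))"
      proof (rule sum.cong[OF refl])
        fix h assume h: "h \<in> H"
        then show "card (Pow h \<times> Pow h) = 2 ^ (r * 2)"
          using finh[OF h] H[OF h] by (simp add: card_cartesian_product card_Pow mult_2_right power_add)
      qed
      also have "\<dots> \<le> card H * 2 ^ (r * k)" using k by simp
      finally show ?thesis .
    qed
    then have "real (card G2) \<le> real (card H * 2 ^ (r * k))" by (rule of_nat_mono)
    then have "real (card G2) * cost 2 \<le> real (card H * 2 ^ (r * k)) * cost 2"
      using cost0 by (intro mult_right_mono) auto
    ultimately show ?thesis by (simp add: mult_ac)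
  qed
  have cost2: "cost 2 = (1 + 2 * real k) * 2 ^ r * (q ^ 4 / D)" using k by (simp add: cost_def)
  have costF: "(\<Sum>S\<in>F. cost (card S)) = (1 + 2 * real k) * 2 ^ r *
     ((\<Sum>S | S \<in> F \<and> card S < k. q ^ (card S + 2) / D ^ (card S - 1)) + real (card {S\<in>F. card S = k}) * q ^ (k + 1) / D ^ (k - 1))"
  proof -
    have "F = {S\<in>F. card S < k} \<union> {S\<in>F. card S = k}" using F by (auto simp: le_less)
    then have "(\<Sum>S\<in>F. cost (card S)) = (\<Sum>S\<in>{S\<in>F. card S < k} \<union> {S\<in>F. card S = k}. cost (card S))" by simp
    also have "\<dots> = (\<Sum>S\<in>{S\<in>F. card S < k}. cost (card S)) + (\<Sum>S\<in>{S\<in>F. card S = k}. cost (card S))"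
      using finF by (intro sum.union_disjoint) auto
    also have "(\<Sum>S\<in>{S\<in>F. card S = k}. cost (card S)) = real (card {S\<in>F. card S = k}) * cost k" by simp
    also have "(\<Sum>S\<in>{S\<in>F. card S < k}. cost (card S)) = (\<Sum>S\<in>{S\<in>F. card S < k}. (1 + 2 * real k) * 2 ^ r * (q ^ (card S + 2) / D ^ (card S - 1)))"
      by (intro sum.cong refl) (auto simp: cost_def)
    also have "\<dots> = (1 + 2 * real k) * 2 ^ r * (\<Sum>S\<in>{S\<in>F. card S < k}. q ^ (card S + 2) / D ^ (card S - 1))"
      by (simp only: sum_distrib_left)
    finally show ?thesis by (simp add: cost_def distrib_left mult_ac)
  qed
  have "(\<Sum>g\<in>\<G>. (1 + 2 * real k) * 2 ^ Suc i * q ^ (card (\<Union>(fst ` g)) + 1) * real (card {e\<in>R. fst (rep g) \<subseteq> A e}) *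
        (\<Prod>P\<in>fst ` g. 1 / real (card (E P)))) \<le> (\<Sum>g\<in>\<G>. cost (card g))"
    using costle by (rule sum_mono)
  also have "\<dots> \<le> (\<Sum>g\<in>G1. cost (card g)) + (\<Sum>g\<in>G2. cost (card g))"
    unfolding \<G>_def using finG cost0 by (subst sum_Un) (auto intro!: sum_nonneg)
  also have "\<dots> \<le> 2 ^ (r * k) * (\<Sum>S\<in>F. cost (card S)) + 2 ^ (r * k) * (real (card H) * cost 2)"
    using sum1 sum2 by (rule add_mono)
  also have "\<dots> = (1 + 2 * real k) * 2 ^ r * 2 ^ (r * k) *
       ((\<Sum>S | S \<in> F \<and> card S < k. q ^ (card S + 2) / D ^ (card S - 1)) +
        real (card {S\<in>F. card S = k}) * q ^ (k + 1) / D ^ (k - 1) + real (card H) * q ^ 4 / D)"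
    unfolding costF cost2 by (simp add: ring_distribs add_divide_distrib mult_ac)
  finally have up: "(\<Sum>g\<in>\<G>. (1 + 2 * real k) * 2 ^ Suc i * q ^ (card (\<Union>(fst ` g)) + 1) * real (card {e\<in>R. fst (rep g) \<subseteq> A e}) *
        (\<Prod>P\<in>fst ` g. 1 / real (card (E P)))) \<le> (1 + 2 * real k) * 2 ^ r * 2 ^ (r * k) *
       ((\<Sum>S | S \<in> F \<and> card S < k. q ^ (card S + 2) / D ^ (card S - 1)) +
        real (card {S\<in>F. card S = k}) * q ^ (k + 1) / D ^ (k - 1) + real (card H) * q ^ 4 / D)" .
  have "(4::real) ^ Suc i \<le> 4 ^ r" using i by (intro power_increasing) auto
  then have "real k * 4 ^ Suc i * real (card R) * q\<^sup>2 / \<mu> \<le> real k * 4 ^ r * real (card R) * q\<^sup>2 / \<mu>"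
    using \<mu> by (intro divide_right_mono mult_right_mono mult_left_mono) auto
  then show False using main up few by linarith
qed

section \<open>Balanced supersaturation for Berge cycles\<close>

text \<open>Level \<open>j\<close> is the one at which degrees stop being large:
  \<open>j\<close>-sets inside \<open>B\<close> still have degree above \<open>m ^ (r - j)\<close>,
  but half of \<open>B\<close> can be charged to \<open>(j + 1)\<close>-sets with few charges each.
  \<open>2 ^ (r - i)\<close> pays for one halving per level passed.\<close>

definition concentrated :: "real \<Rightarrow> nat \<Rightarrow> nat \<Rightarrow> 'a set set \<Rightarrow> bool" where
  "concentrated m r i H \<longleftrightarrow> (\<exists>j B R A. i \<le> j \<and> Suc j \<le> r \<and> B \<subseteq> H \<and> B \<noteq> {} \<and> real (card B) * 2 ^ (r - i) \<ge> real (card H) \<and>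
      (\<forall>h\<in>B. \<forall>\<tau>. \<tau> \<subseteq> h \<longrightarrow> card \<tau> = j \<longrightarrow> real (card {h\<in>B. \<tau> \<subseteq> h}) > m ^ (r - j)) \<and>
      R \<subseteq> B \<and> 2 * card R \<ge> card B \<and> (\<forall>e\<in>R. A e \<subseteq> e \<and> card (A e) = Suc j) \<and>
      (\<forall>Y. real (card {e\<in>R. A e = Y}) \<le> m ^ (r - Suc j)))"

text \<open>Prune the \<open>(i + 1)\<close>-sets of degree at most \<open>m ^ (r - Suc i)\<close>.
  If this removes half of the edges, level \<open>i\<close> is the one sought; otherwise the
  survivors satisfy the hypothesis at level \<open>i + 1\<close>. Level \<open>r\<close> is
  impossible, because an edge, taken as an \<open>r\<close>-set, has degree 1.\<close>

lemma heavy_chain: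
  fixes m :: real
  assumes m: "m \<ge> 1" and i: "i \<le> r"
  shows "finite H \<Longrightarrow> H \<noteq> {} \<Longrightarrow> (\<And>h. h \<in> H \<Longrightarrow> finite h \<and> card h = r) \<Longrightarrow>
    (\<And>h \<tau>. h \<in> H \<Longrightarrow> \<tau> \<subseteq> h \<Longrightarrow> card \<tau> = i \<Longrightarrow> real (card {h\<in>H. \<tau> \<subseteq> h}) > m ^ (r - i)) \<Longrightarrow>
    concentrated m r i H"
  using i
proof (induction i arbitrary: H rule: inc_induct)
  case base
  obtain h where h: "h \<in> H" using base(2) by auto
  have "{h'\<in>H. h \<subseteq> h'} = {h}"
  proof (intro equalityI subsetI)
    fix h' assume h': "h' \<in> {h'\<in>H. h \<subseteq> h'}"
    then have "h = h'" using base(3)[of h] base(3)[of h'] h by (intro card_subset_eq) auto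
    then show "h' \<in> {h}" by simp
  qed (use h in auto)
  then have "real (card {h'\<in>H. h \<subseteq> h'}) = 1" by simp
  moreover have "real (card {h'\<in>H. h \<subseteq> h'}) > m ^ (r - r)" by (rule base(4)[OF h]) (use base(3) h in auto)
  ultimately show ?case by simp
next
  case (step i)
  note fin = step.prems(1) and ne = step.prems(2) and sz = step.prems(3) and dg = step.prems(4)
  define Tr where "Tr h = {\<tau>. \<tau> \<subseteq> h \<and> card \<tau> = Suc i}" for h :: "'a set"
  obtain H' \<pi> where H': "H' \<subseteq> H" "\<forall>e\<in>H'. \<forall>\<tau>\<in>Tr e. real (card {e'\<in>H'. \<tau> \<in> Tr e'}) > m ^ (r - Suc i)"
    "\<forall>e\<in>H - H'. \<pi> e \<in> Tr e" "\<forall>\<tau>. m ^ (r - Suc i) \<ge> 0 \<longrightarrow> real (card {e\<in>H - H'. \<pi> e = \<tau>}) \<le> m ^ (r - Suc i)"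
    using prune[OF fin, of Tr "m ^ (r - Suc i)"] by auto
  have cH: "card H = card H' + card (H - H')"
    using H'(1) fin by (metis add.commute card_Diff_subset card_mono finite_subset le_add_diff_inverse2)
  show ?case
  proof (cases "card H \<le> 2 * card (H - H')")
    case True
    show ?thesis unfolding concentrated_def
    proof (rule exI[of _ i], rule exI[of _ H], rule exI[of _ "H - H'"], rule exI[of _ \<pi>], intro conjI)
      have "(1::real) \<le> 2 ^ (r - i)" by simp
      then show "real (card H) \<le> real (card H) * 2 ^ (r - i)" by (simp add: mult_le_cancel_left1)
      show "\<forall>h\<in>H. \<forall>\<tau>. \<tau> \<subseteq> h \<longrightarrow> card \<tau> = i \<longrightarrow> real (card {h\<in>H. \<tau> \<subseteq> h}) > m ^ (r - i)" using dg by blast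
      show "\<forall>e\<in>H - H'. \<pi> e \<subseteq> e \<and> card (\<pi> e) = Suc i" using H'(3) by (auto simp: Tr_def)
      show "\<forall>Y. real (card {e\<in>H - H'. \<pi> e = Y}) \<le> m ^ (r - Suc i)" using H'(4) m by auto
    qed (use True step.hyps ne in auto)
  next
    case False
    have ne': "H' \<noteq> {}"
    proof
      assume "H' = {}"
      then have "card (H - H') = card H" by simp
      then show False using False by linarith
    qed
    have dg': "real (card {h\<in>H'. \<tau> \<subseteq> h}) > m ^ (r - Suc i)" if "h \<in> H'" "\<tau> \<subseteq> h" "card \<tau> = Suc i" for h \<tau>
    proof -
      have "{e'\<in>H'. \<tau> \<in> Tr e'} = {h\<in>H'. \<tau> \<subseteq> h}" using that(3) by (auto simp: Tr_def)
      moreover have "\<tau> \<in> Tr h" using that by (simp add: Tr_def)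
      ultimately show ?thesis using H'(2) that(1) by metis
    qed
    have "concentrated m r (Suc i) H'"
      by (rule step.IH) (use ne' finite_subset[OF H'(1) fin] sz H'(1) dg' in auto)
    then obtain j B R A where B: "Suc i \<le> j" "Suc j \<le> r" "B \<subseteq> H'" "B \<noteq> {}" "real (card B) * 2 ^ (r - Suc i) \<ge> real (card H')"
      "\<forall>h\<in>B. \<forall>\<tau>. \<tau> \<subseteq> h \<longrightarrow> card \<tau> = j \<longrightarrow> real (card {h\<in>B. \<tau> \<subseteq> h}) > m ^ (r - j)"
      "R \<subseteq> B" "2 * card R \<ge> card B" "\<forall>e\<in>R. A e \<subseteq> e \<and> card (A e) = Suc j"
      "\<forall>Y. real (card {e\<in>R. A e = Y}) \<le> m ^ (r - Suc j)"
      unfolding concentrated_def by (elim exE conjE) (rule that)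
    have "r - i = Suc (r - Suc i)" using step.hyps by simp
    then have "real (card B) * 2 ^ (r - i) = 2 * (real (card B) * 2 ^ (r - Suc i))" by simp
    also have "\<dots> \<ge> 2 * real (card H')" using B(5) by linarith
    finally have "real (card B) * 2 ^ (r - i) \<ge> real (card H)" using False cH by linarith
    then show ?thesis unfolding concentrated_def using B H'(1) step.hyps
      by - (rule exI[of _ j], rule exI[of _ B], rule exI[of _ R], rule exI[of _ A], auto)
  qed
qed

text \<open>Since every \<open>j\<close>-set inside some \<open>A e\<close> has degree at least \<open>m / (4 * 2 ^ r)\<close> times the maximal degree
  of a \<open>(j + 1)\<close>-set, its extensions are not dominated by a few vertices.\<close>

definition branching :: "real \<Rightarrow> nat \<Rightarrow> 'a set set \<Rightarrow> bool" where
  "branching m r H \<longleftrightarrow> (\<exists>j R A. 2 \<le> j \<and> Suc j \<le> r \<and> R \<subseteq> H \<and> real (card H) \<le> 4 * 2 ^ r * real (card R) \<and>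
      (\<forall>e\<in>R. A e \<subseteq> e \<and> card (A e) = Suc j) \<and> (\<forall>Y. real (card {e\<in>R. A e = Y}) \<le> m ^ (r - Suc j)) \<and>
      (\<forall>e\<in>R. \<forall>\<tau>. \<tau> \<subseteq> A e \<longrightarrow> card \<tau> = j \<longrightarrow> real (card {e\<in>R. \<tau> \<subseteq> A e}) \<ge> (m / (4 * 2 ^ r)) * m ^ (r - Suc j)))"

text \<open>The codegrees of pairs start the chain at level 2. A second pruning, of the
  \<open>j\<close>-sets inside the sets \<open>A e\<close>, loses at most a quarter of
  \<open>B\<close>: by double counting, the edges of \<open>B\<close> contain at most
  \<open>2 ^ r * card B / m ^ (r - j)\<close> sets of size \<open>j\<close>, each charged at most
  \<open>m ^ (r - j) / (4 * 2 ^ r)\<close> times. As \<open>R\<close> is at least half of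
  \<open>B\<close>, a quarter is left.\<close>

lemma heavy_structure:
  fixes m :: real
  assumes m: "m \<ge> 1" and r: "r \<ge> 2" and H: "finite H" "H \<noteq> {}" "\<And>h. h \<in> H \<Longrightarrow> finite h \<and> card h = r"
    and dg: "\<And>h P. h \<in> H \<Longrightarrow> P \<subseteq> h \<Longrightarrow> card P = 2 \<Longrightarrow> real (card {h\<in>H. P \<subseteq> h}) > m ^ (r - 2)"
  shows "branching m r H"
proof -
  have conc: "concentrated m r 2 H"
    by (rule heavy_chain[OF m r H(1,2)]) (use H(3) dg in auto)
  obtain j B R A where j: "2 \<le> j" "Suc j \<le> r" and B: "B \<subseteq> H" "B \<noteq> {}" "real (card B) * 2 ^ (r - 2) \<ge> real (card H)"
      "\<forall>h\<in>B. \<forall>\<tau>. \<tau> \<subseteq> h \<longrightarrow> card \<tau> = j \<longrightarrow> real (card {h\<in>B. \<tau> \<subseteq> h}) > m ^ (r - j)"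
      and R: "R \<subseteq> B" "2 * card R \<ge> card B" "\<forall>e\<in>R. A e \<subseteq> e \<and> card (A e) = Suc j"
      "\<forall>Y. real (card {e\<in>R. A e = Y}) \<le> m ^ (r - Suc j)"
    using conc unfolding concentrated_def by (elim exE conjE) (rule that)
  have finB: "finite B" using B H finite_subset by blast
  have finR: "finite R" using R finB finite_subset by blast
  define \<theta> where "\<theta> = m ^ (r - j) / (4 * 2 ^ r)"
  have mr: "m ^ (r - j) > 0" using m by simp
  have \<theta>: "\<theta> \<ge> 0" using mr by (simp add: \<theta>_def)
  define Tr where "Tr e = {\<tau>. \<tau> \<subseteq> A e \<and> card \<tau> = j}" for e
  obtain R' \<pi> where R': "R' \<subseteq> R" "\<forall>e\<in>R'. \<forall>\<tau>\<in>Tr e. real (card {e'\<in>R'. \<tau> \<in> Tr e'}) > \<theta>"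
    "\<forall>e\<in>R - R'. \<pi> e \<in> Tr e" "\<forall>\<tau>. \<theta> \<ge> 0 \<longrightarrow> real (card {e\<in>R - R'. \<pi> e = \<tau>}) \<le> \<theta>"
    using prune[OF finR, of Tr \<theta>] by auto
  define T where "T = {\<tau>. card \<tau> = j \<and> (\<exists>e\<in>B. \<tau> \<subseteq> e)}"
  have finh: "finite h \<and> card h = r" if "h \<in> B" for h using that B H by auto
  have "T \<subseteq> (\<Union>e\<in>B. Pow e)" by (auto simp: T_def)
  then have finT: "finite T" by (rule finite_subset) (use finB finh in auto)
  have "real (card T) * m ^ (r - j) = (\<Sum>\<tau>\<in>T. m ^ (r - j))" by simp
  also have "\<dots> \<le> (\<Sum>\<tau>\<in>T. real (card {h\<in>B. \<tau> \<subseteq> h}))"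
    using B(4) by (intro sum_mono) (auto simp: T_def intro: less_imp_le)
  also have "\<dots> = real (\<Sum>\<tau>\<in>T. card {h\<in>B. \<tau> \<subseteq> h})" by simp
  also have "(\<Sum>\<tau>\<in>T. card {h\<in>B. \<tau> \<subseteq> h}) = (\<Sum>h\<in>B. card {\<tau>\<in>T. \<tau> \<subseteq> h})"
    using sum.swap_restrict[OF finT finB, of "\<lambda>_ _. 1::nat" "\<lambda>\<tau> h. \<tau> \<subseteq> h"] by simp
  also have "\<dots> \<le> (\<Sum>h\<in>B. 2 ^ r)"
  proof (rule sum_mono)
    fix h assume h: "h \<in> B"
    have "card {\<tau>\<in>T. \<tau> \<subseteq> h} \<le> card (Pow h)" by (rule card_mono) (use finh[OF h] in auto)
    then show "card {\<tau>\<in>T. \<tau> \<subseteq> h} \<le> 2 ^ r" using finh[OF h] by (simp add: card_Pow)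
  qed
  finally have cT: "real (card T) * m ^ (r - j) \<le> real (card B) * 2 ^ r" by simp
  have "real (card (R - R')) \<le> real (card T) * \<theta>"
  proof (rule card_le_fibres[of _ _ \<pi>])
    show "\<pi> e \<in> T" if "e \<in> R - R'" for e
    proof -
      have "\<pi> e \<subseteq> A e" "card (\<pi> e) = j" using R'(3) that by (auto simp: Tr_def)
      moreover have "A e \<subseteq> e" "e \<in> B" using R that by auto
      ultimately show ?thesis unfolding T_def by blast
    qed
  qed (use finR finT R' \<theta> in auto)
  also have "\<dots> \<le> real (card B) / 4" using cT by (simp add: \<theta>_def field_simps)
  finally have 1: "real (card (R - R')) \<le> real (card B) / 4" .
  have "card R = card R' + card (R - R')"
    using R'(1) finR by (metis add.commute card_Diff_subset card_mono finite_subset le_add_diff_inverse2)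
  then have "real (card B) \<le> 4 * real (card R')" using 1 R(2) by linarith
  then have "real (card B) * 2 ^ (r - 2) \<le> 4 * real (card R') * 2 ^ (r - 2)" by (intro mult_right_mono) auto
  also have "\<dots> \<le> 4 * real (card R') * 2 ^ r" by (intro mult_left_mono power_increasing) auto
  finally have cR: "real (card H) \<le> 4 * 2 ^ r * real (card R')" using B(3) by (simp add: mult_ac)
  have rj: "r - j = Suc (r - Suc j)" using j by simp
  have \<theta>': "\<theta> = (m / (4 * 2 ^ r)) * m ^ (r - Suc j)" unfolding \<theta>_def rj by simp
  show ?thesis unfolding branching_def
  proof (intro exI[of _ j] exI[of _ R'] exI[of _ A] conjI)
    show "R' \<subseteq> H" using R' R B by auto
    show "\<forall>e\<in>R'. A e \<subseteq> e \<and> card (A e) = Suc j" using R' R by auto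
    show "\<forall>Y. real (card {e\<in>R'. A e = Y}) \<le> m ^ (r - Suc j)"
    proof
      fix Y
      have "card {e\<in>R'. A e = Y} \<le> card {e\<in>R. A e = Y}" using R' finR by (intro card_mono) auto
      then show "real (card {e\<in>R'. A e = Y}) \<le> m ^ (r - Suc j)" using R(4)[rule_format, of Y] by linarith
    qed
    show "\<forall>e\<in>R'. \<forall>\<tau>. \<tau> \<subseteq> A e \<longrightarrow> card \<tau> = j \<longrightarrow> real (card {e\<in>R'. \<tau> \<subseteq> A e}) \<ge> (m / (4 * 2 ^ r)) * m ^ (r - Suc j)"
    proof (intro ballI allI impI)
      fix e \<tau> assume e: "e \<in> R'" "\<tau> \<subseteq> A e" "card \<tau> = j"
      have "{e'\<in>R'. \<tau> \<in> Tr e'} = {e\<in>R'. \<tau> \<subseteq> A e}" using e(3) by (auto simp: Tr_def)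
      moreover have "\<tau> \<in> Tr e" using e by (simp add: Tr_def)
      ultimately show "real (card {e\<in>R'. \<tau> \<subseteq> A e}) \<ge> (m / (4 * 2 ^ r)) * m ^ (r - Suc j)"
        unfolding \<theta>'[symmetric] using R'(2) e(1) by (metis less_imp_le)
    qed
  qed (use j cR in auto)
qed

section \<open>Choice of the sampling densities\<close>

lemma sum_by_card_le:
  fixes g :: "nat \<Rightarrow> real"
  assumes fin: "finite F" and sz: "\<And>S. S \<in> F \<Longrightarrow> card S < k"
    and le: "\<And>j. j < k \<Longrightarrow> real (card {S\<in>F. card S = j}) * g j \<le> c"
  shows "(\<Sum>S\<in>F. g (card S)) \<le> real k * c"
proof -
  have "(\<Sum>S\<in>F. g (card S)) = (\<Sum>j\<in>{..<k}. \<Sum>S\<in>{S\<in>F. card S = j}. g (card S))"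
    by (rule sum.group[symmetric]) (use fin sz in auto)
  also have "\<dots> = (\<Sum>j\<in>{..<k}. real (card {S\<in>F. card S = j}) * g j)" by (intro sum.cong refl) auto
  also have "\<dots> \<le> (\<Sum>j\<in>{..<k}. c)" using le by (intro sum_mono) auto
  finally show ?thesis by simp
qed

lemma powr_inverse_power: "n > 0 \<Longrightarrow> l > 0 \<Longrightarrow> (real n powr (1 / real l)) ^ l = real n"
  by (simp add: powr_powr flip: powr_realpow)

text \<open>The density \<open>q\<close> has order \<open>C / b\<close>. The equation for
  \<open>b ^ (l - 1)\<close> is what lifts \<open>\<tau> ^ l\<close> above the number of sampled
  vertices. Small forbidden sets are controlled by the ratio \<open>s * q / D\<close>, bounded
  because \<open>s \<le> D * b\<close>; for full ones the last bound on \<open>s\<close> keeps their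
  number below \<open>\<delta> * t ^ (2 * l) * n ^ 2\<close>, the same power of \<open>t\<close> and
  \<open>n\<close> as in \<open>\<tau> ^ (2 * l)\<close>.\<close>

lemma light_case:
  fixes H :: "'e set" and \<pi> :: "'e \<Rightarrow> 'a set" and F :: "'e set set" and t D b s \<delta> C :: real
  assumes V: "finite V" "card V = n" "n > 0" and H: "finite H" and \<pi>: "\<And>e. e \<in> H \<Longrightarrow> \<pi> e \<subseteq> V \<and> card (\<pi> e) = 2"
    and fib: "\<And>P. real (card {e\<in>H. \<pi> e = P}) \<le> D" and D: "D \<ge> 1" and l: "l \<ge> 2" and t: "t > 0"
    and cH: "4 * real (card H) \<ge> t * real n powr (1 + 1 / real l)"
    and C: "C = (1024 * (real l)\<^sup>2) ^ l" and b: "b \<ge> 2 * C" "b ^ (l - 1) = (t / D) ^ l"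
    and s: "s > 0" "s \<le> D * b" "s ^ (2 * l - 1) \<le> t ^ (2 * l - 1) * real n powr (1 - 1 / real l)"
    and F: "\<And>S. S \<in> F \<Longrightarrow> S \<subseteq> H \<and> 2 \<le> card S \<and> card S \<le> 2 * l"
    and cF: "\<And>j. 2 \<le> j \<Longrightarrow> j \<le> 2 * l \<Longrightarrow> real (card {S\<in>F. card S = j}) \<le> \<delta> * (t * real n powr (1 + 1 / real l)) * s ^ (j - 1)"
    and \<delta>: "\<delta> \<ge> 0" "\<delta> * (2 * real l * (2 * C) ^ (2 * l)) \<le> 1 / 32" "\<delta> * (2 * real l) ^ (2 * l) * 64 ^ (2 * l) \<le> 1 / 4"
  shows "\<exists>xs h. distinct xs \<and> length xs = 2 * l \<and> (\<forall>i<2 * l. h i \<in> H \<and> \<pi> (h i) = cpair xs i) \<and>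
    (\<forall>S\<in>F. \<not> S \<subseteq> h ` {..<2 * l})"
proof -
  define N where "N = t * real n powr (1 + 1 / real l)"
  define \<nu> where "\<nu> = real n powr (1 / real l)"
  have n0: "real n > 0" using V by simp
  have \<nu>: "\<nu> > 0" "\<nu> ^ l = real n" using n0 powr_inverse_power[of n l] l V by (auto simp: \<nu>_def)
  have N: "N = t * real n * \<nu>" "N > 0" using n0 t by (auto simp: N_def \<nu>_def powr_add)
  have l0: "real l \<ge> 2" using l by simp
  have C1: "C \<ge> 4096"
  proof -
    have "(2::real)\<^sup>2 \<le> (real l)\<^sup>2" using l0 by (intro power_mono) auto
    then have x: "1024 * (real l)\<^sup>2 \<ge> 4096" by simp
    then have "(1024 * (real l)\<^sup>2) ^ 1 \<le> (1024 * (real l)\<^sup>2) ^ l" using l by (intro power_increasing) auto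
    then show ?thesis using x C by simp
  qed
  have b0: "b > 0" using b(1) C1 by linarith
  \<comment> \<open>Slots need an integer. Rounding up costs a factor of at most 2, which turns 64
    into 128 below.\<close>
  define D' where "D' = nat \<lceil>D\<rceil>"
  have D': "D \<le> real D'" "real D' \<le> 2 * D" "D' \<ge> 1" using D unfolding D'_def by linarith+
  have fib': "card {e\<in>H. \<pi> e = P} \<le> D'" for P
    using fib[of P] D'(1) by (meson of_nat_le_iff order_trans)
  \<comment> \<open>At most \<open>n ^ 2\<close> pairs receive at most \<open>D'\<close> charges
    each, so \<open>t * \<nu> \<le> 8 * D * n\<close>; its \<open>l\<close>-th power bounds
    \<open>b\<close> by \<open>64 * n\<close>. Hence the sample size \<open>C * n / b\<close> does
    not degenerate.\<close>
  have bn: "b \<le> 64 * real n"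
  proof -
    have "card H \<le> D' * n\<^sup>2"
    proof -
      have "real (card H) \<le> real (card {P. P \<subseteq> V \<and> card P = 2}) * real D'"
        by (rule card_le_fibres[OF H, of _ \<pi>]) (use V \<pi> fib' in auto)
      also have "card {P. P \<subseteq> V \<and> card P = 2} = n choose 2" using V by (simp add: n_subsets)
      also have "real (n choose 2) * real D' \<le> real (n\<^sup>2) * real D'"
      proof (intro mult_right_mono of_nat_mono)
        have "n choose 2 = n * (n - 1) div 2" by (simp add: choose_two)
        also have "\<dots> \<le> n * (n - 1)" by simp
        also have "\<dots> \<le> n * n" by (intro mult_left_mono) auto
        finally show "n choose 2 \<le> n\<^sup>2" by (simp add: power2_eq_square)
      qed auto
      finally have "real (card H) \<le> real (D' * n\<^sup>2)" by (simp add: mult.commute)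
      then show ?thesis by (simp only: of_nat_le_iff)
    qed
    then have "real (card H) \<le> real (D' * n\<^sup>2)" by (rule of_nat_mono)
    then have "real (card H) \<le> real D' * (real n)\<^sup>2" by simp
    also have "\<dots> \<le> 2 * D * (real n)\<^sup>2" using D' by (intro mult_right_mono) auto
    finally have "t * real n * \<nu> \<le> 8 * D * real n * real n"
      using cH unfolding N_def[symmetric] N(1) by (simp add: power2_eq_square mult_ac)
    then have "(t * \<nu>) * real n \<le> (8 * D * real n) * real n" by (simp add: mult_ac)
    then have "t * \<nu> \<le> 8 * D * real n" using n0 by simp
    then have "t / D * \<nu> \<le> 8 * real n" using D by (simp add: field_simps)
    then have "(t / D * \<nu>) ^ l \<le> (8 * real n) ^ l" using t D \<nu> by (intro power_mono) auto
    then have "(t / D) ^ l * real n \<le> 8 ^ l * real n ^ l" unfolding power_mult_distrib \<nu>(2) .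
    also have "\<dots> = (8 ^ l * real n ^ (l - 1)) * real n" using l by (simp add: power_eq_if)
    finally have "b ^ (l - 1) \<le> 8 ^ l * real n ^ (l - 1)" using n0 b(2) by simp
    also have "(8::real) ^ l \<le> 8 ^ (2 * (l - 1))" using l by (intro power_increasing) auto
    also have "(8::real) ^ (2 * (l - 1)) = 64 ^ (l - 1)" by (simp add: power_mult)
    finally have "b ^ (l - 1) \<le> (64 * real n) ^ (l - 1)" using n0 by (simp add: power_mult_distrib mult_right_mono)
    then show ?thesis using b0 n0 l by (subst (asm) power_mono_iff) auto
  qed
  define M where "M = nat \<lceil>C * real n / b\<rceil>"
  have big: "C * real n / b \<ge> 64"
  proof -
    have "64 * b \<le> 4096 * real n" using bn by simp
    also have "\<dots> \<le> C * real n" using C1 n0 by (intro mult_right_mono) auto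
    finally show ?thesis using b0 by (simp add: pos_le_divide_eq)
  qed
  have Mb: "C * real n / b \<le> real M" "real M \<le> 2 * (C * real n / b)" using big unfolding M_def by linarith+
  have M4: "4 \<le> M" using Mb(1) big by linarith
  define q where "q = real M / real n"
  have q: "q > 0" using M4 n0 by (simp add: q_def)
  have ql: "C \<le> q * b" using Mb(1) n0 b0 by (simp add: q_def field_simps)
  have qu: "q * b \<le> 2 * C" using Mb(2) n0 b0 by (simp add: q_def field_simps)
  have "q * b \<le> 1 * b" using qu b(1) by linarith
  then have "q \<le> 1" using b0 by (simp only: mult_le_cancel_right_pos)
  then have Mn: "M \<le> n" using n0 by (simp add: q_def)
  have Mq: "real M = q * real n" using n0 by (simp add: q_def)
  define \<tau> where "\<tau> = real (card H) * q\<^sup>2 / (16 * real D' * real M)"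
  have \<tau>eq: "\<tau> = real (card H) * q / (16 * real D' * real n)"
    unfolding \<tau>_def Mq using q by (simp add: power2_eq_square)
  have Npos: "4 * real (card H) \<ge> t * real n * \<nu>" using cH unfolding N_def[symmetric] N(1) .
  have \<tau>64: "\<tau> \<ge> q * t * \<nu> / (64 * real D')"
  proof -
    have "q * t * \<nu> / (64 * real D') = (t * real n * \<nu> / 4) * q / (16 * real D' * real n)"
      using n0 D' by (simp add: field_simps)
    also have "\<dots> \<le> \<tau>" unfolding \<tau>eq using Npos q n0 D' by (intro divide_right_mono mult_right_mono) auto
    finally show ?thesis .
  qed
  have base64: "q * t * \<nu> / (64 * real D') > 0" using q t \<nu> D' by simp
  have \<tau>0: "\<tau> > 0" using \<tau>64 base64 by linarith
  have \<tau>128: "\<tau> \<ge> q * (t / D) * \<nu> / 128"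
  proof -
    have "q * (t / D) * \<nu> / 128 = q * t * \<nu> / (64 * (2 * D))" by simp
    also have "\<dots> \<le> q * t * \<nu> / (64 * real D')" using q t \<nu> D' D by (intro divide_left_mono) auto
    finally show ?thesis using \<tau>64 by linarith
  qed
  \<comment> \<open>\<open>C\<close> is the product of the \<open>128 ^ l\<close> lost in the lower
    bound for \<open>\<tau>\<close> and the \<open>(8 * l ^ 2) ^ l\<close> needed for the cycle
    count. It is supplied by \<open>(q * b) ^ (l - 1) \<ge> C\<close>, where
    \<open>l \<ge> 2\<close> enters.\<close>
  have large: "(8 * (real l)\<^sup>2) ^ l * real M \<le> \<tau> ^ l"
  proof -
    have "(q * (t / D) * \<nu> / 128) ^ l = q ^ l * b ^ (l - 1) * real n / 128 ^ l"
      unfolding b(2) by (simp add: power_divide power_mult_distrib \<nu>(2))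
    also have "q ^ l = q * q ^ (l - 1)" using l by (simp add: power_eq_if)
    finally have e: "(q * (t / D) * \<nu> / 128) ^ l = (q * b) ^ (l - 1) * real M / 128 ^ l"
      unfolding Mq by (simp add: power_mult_distrib mult_ac)
    have "C ^ 1 \<le> C ^ (l - 1)" using C1 l by (intro power_increasing) auto
    also have "\<dots> \<le> (q * b) ^ (l - 1)" using ql C1 by (intro power_mono) auto
    finally have "C * real M / 128 ^ l \<le> (q * b) ^ (l - 1) * real M / 128 ^ l"
      by (intro divide_right_mono mult_right_mono) auto
    also have "\<dots> \<le> \<tau> ^ l" unfolding e[symmetric] using \<tau>128 q t D \<nu> by (intro power_mono) auto
    finally have "C * real M / 128 ^ l \<le> \<tau> ^ l" .
    moreover have "C = (8 * (real l)\<^sup>2) ^ l * 128 ^ l" unfolding C power_mult_distrib[symmetric] by simp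
    ultimately show ?thesis by simp
  qed
  have finF: "finite F" using F H by (intro finite_subset[of F "Pow H"]) auto
  \<comment> \<open>Relative to the order \<open>N * q ^ 2 / D'\<close> of the sampled edges,
    forbidden sets of size \<open>j\<close> cost a factor
    \<open>\<delta> * (s * q / D') ^ (j - 1)\<close>, a small multiple of a power of
    \<open>2 * C\<close>.\<close>
  have few: "(\<Sum>S | S \<in> F \<and> card S < 2 * l. q ^ (card S + 1) / real D' ^ card S) \<le> real (card H) * q\<^sup>2 / (8 * real D')"
  proof -
    define c where "c = \<delta> * N * (q\<^sup>2 / real D') * (2 * C) ^ (2 * l)"
    have c0: "c \<ge> 0" using \<delta> N C1 by (simp add: c_def)
    have "(\<Sum>S | S \<in> F \<and> card S < 2 * l. q ^ (card S + 1) / real D' ^ card S) \<le> real (2 * l) * c"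
    proof (rule sum_by_card_le)
      fix j assume j: "j < 2 * l"
      have eq: "{S \<in> {S \<in> F. card S < 2 * l}. card S = j} = {S\<in>F. card S = j}" using j by auto
      show "real (card {S \<in> {S \<in> F. card S < 2 * l}. card S = j}) * (q ^ (j + 1) / real D' ^ j) \<le> c"
      proof (cases "2 \<le> j")
        case True
        then obtain i where i: "j = Suc i" by (metis Suc_le_D numeral_2_eq_2)
        have "s * q / real D' \<le> 2 * C"
        proof -
          have "s * q / real D' \<le> (D * b) * q / D"
            using s q D D' b0 by (intro frac_le mult_right_mono) auto
          also have "\<dots> = q * b" using D by simp
          finally show ?thesis using qu by linarith
        qed
        then have "(s * q / real D') ^ i \<le> (2 * C) ^ i" using s q D' by (intro power_mono) auto
        also have "\<dots> \<le> (2 * C) ^ (2 * l)" using C1 i j by (intro power_increasing) auto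
        finally have pw: "(s * q / real D') ^ i \<le> (2 * C) ^ (2 * l)" .
        have "real (card {S\<in>F. card S = j}) * (q ^ (j + 1) / real D' ^ j) \<le> (\<delta> * N * s ^ i) * (q ^ (j + 1) / real D' ^ j)"
          using cF[OF True] j q i by (intro mult_right_mono) (auto simp: N_def)
        also have "\<dots> = \<delta> * N * (q\<^sup>2 / real D') * (s * q / real D') ^ i"
          by (simp add: i power_mult_distrib power_divide power2_eq_square)
        also have "\<dots> \<le> c" unfolding c_def using pw \<delta> N by (intro mult_left_mono) auto
        finally show ?thesis using eq by simp
      next
        case False
        then have emp: "{S\<in>F. card S = j} = {}" using F by fastforce
        show ?thesis unfolding eq emp using c0 by simp
      qed
    qed (use finF in auto)
    also have "real (2 * l) * c = (\<delta> * (2 * real l * (2 * C) ^ (2 * l))) * (N * q\<^sup>2 / real D')" by (simp add: c_def)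
    also have "\<dots> \<le> (1 / 32) * (N * q\<^sup>2 / real D')" using \<delta>(2) N by (intro mult_right_mono) auto
    also have "\<dots> = (N / 4) * q\<^sup>2 / (8 * real D')" by simp
    also have "\<dots> \<le> real (card H) * q\<^sup>2 / (8 * real D')"
      using cH by (intro divide_right_mono mult_right_mono) (auto simp: N_def)
    finally show ?thesis .
  qed
  have few': "real (card {S\<in>F. card S = 2 * l}) * (2 * real l) ^ (2 * l) * (q / real D') ^ (2 * l) < \<tau> ^ (2 * l) / 2"
  proof -
    \<comment> \<open>The origin of the exponent \<open>1 - 1 / l\<close>: it turns the bound on
      full sets into a multiple of the \<open>2 * l\<close>-th power of \<open>t * \<nu>\<close>,
      the power in which \<open>\<tau>\<close> enters.\<close>
    have Ne: "N * (t ^ (2 * l - 1) * real n powr (1 - 1 / real l)) = t ^ (2 * l) * (real n)\<^sup>2"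
    proof -
      have "real n powr (1 + 1 / real l) * real n powr (1 - 1 / real l) = (real n)\<^sup>2"
        using n0 by (simp flip: powr_add powr_numeral)
      moreover have "t * t ^ (2 * l - 1) = t ^ (2 * l)" using l by (simp flip: power_Suc)
      ultimately show ?thesis unfolding N_def by (metis (no_types, opaque_lifting) mult.assoc mult.left_commute)
    qed
    have "real (card {S\<in>F. card S = 2 * l}) \<le> \<delta> * N * s ^ (2 * l - 1)" using cF[of "2 * l"] l by (simp add: N_def)
    also have "\<dots> \<le> \<delta> * N * (t ^ (2 * l - 1) * real n powr (1 - 1 / real l))"
      using s(3) \<delta> N by (intro mult_left_mono) auto
    also have "\<dots> = \<delta> * (t ^ (2 * l) * (real n)\<^sup>2)" unfolding Ne[symmetric] by (rule mult.assoc)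
    finally have c: "real (card {S\<in>F. card S = 2 * l}) \<le> \<delta> * (t ^ (2 * l) * (real n)\<^sup>2)" .
    have n2: "(real n)\<^sup>2 = \<nu> ^ (2 * l)" using \<nu>(2) by (metis mult.commute power_mult)
    define X where "X = (q * t * \<nu> / real D') ^ (2 * l)"
    have X0: "X > 0" using q t \<nu> D' by (simp add: X_def)
    have "real (card {S\<in>F. card S = 2 * l}) * (2 * real l) ^ (2 * l) * (q / real D') ^ (2 * l)
      \<le> (\<delta> * (t ^ (2 * l) * (real n)\<^sup>2)) * (2 * real l) ^ (2 * l) * (q / real D') ^ (2 * l)"
      using c q by (intro mult_right_mono) auto
    also have "\<dots> = (\<delta> * (2 * real l) ^ (2 * l)) * X"
      unfolding X_def n2 by (simp add: power_mult_distrib power_divide mult_ac)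
    also have "\<dots> \<le> (1 / 4 / 64 ^ (2 * l)) * X"
      using \<delta>(3) X0 by (intro mult_right_mono) (auto simp: field_simps)
    also have "\<dots> < (X / 64 ^ (2 * l)) / 2"
    proof -
      have "X / 64 ^ (2 * l) > 0" using X0 by simp
      then show ?thesis by simp
    qed
    also have "X / 64 ^ (2 * l) = (q * t * \<nu> / (64 * real D')) ^ (2 * l)"
      unfolding X_def by (simp add: power_divide power_mult_distrib)
    also have "\<dots> / 2 \<le> \<tau> ^ (2 * l) / 2" using \<tau>64 base64 by (intro divide_right_mono power_mono) auto
    finally show ?thesis .
  qed
  show ?thesis
  proof (rule cycle_in_light_graph[OF V(1) H \<pi> fib' D'(3) l M4])
    show "M \<le> card V" using Mn V by simp
    show "S \<subseteq> H \<and> S \<noteq> {} \<and> card S \<le> 2 * l" if "S \<in> F" for S using F[OF that] by auto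
  qed (use large \<tau>0 few few' V(2) in \<open>auto simp: \<tau>_def q_def\<close>)
qed


text \<open>The density \<open>q\<close> has order \<open>C / m\<close>, about as small as the
  branching \<open>\<mu> = m / (4 * 2 ^ r)\<close> permits through \<open>\<mu> * q \<ge> 1\<close>.
  A full forbidden set lacks one factor \<open>q\<close>; this makes the bound on
  \<open>s ^ (k - 1)\<close> necessary for the estimate, which is stronger than the
  \<open>s \<le> D * m\<close> that suffices for smaller sets.\<close>

lemma heavy_case:
  fixes H :: "'a set set" and F :: "'a set set set" and N m s \<delta> C C1 :: real
  assumes V: "finite V" "card V = n" "n > 0" and H: "\<And>h. h \<in> H \<Longrightarrow> h \<subseteq> V \<and> card h = r" and ne: "H \<noteq> {}"
    and dg: "\<And>h P. h \<in> H \<Longrightarrow> P \<subseteq> h \<Longrightarrow> card P = 2 \<Longrightarrow> real (card {h\<in>H. P \<subseteq> h}) > m ^ (r - 2)"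
    and r: "r \<ge> 3" and k: "k \<ge> 3" and cH: "4 * real (card H) \<ge> N" "real (card H) \<le> N" and N: "N > 0"
    and C: "C = 128 * real k * 8 ^ r" and C1: "C1 = (1 + 2 * real k) * 2 ^ r * 2 ^ (r * k)"
    and m: "m \<ge> 2 * C" "m \<ge> C1 * 512 * 2 ^ r"
    and s: "s > 0" "s ^ (k - 1) \<le> (m ^ (r - 2)) ^ (k - 1) * m ^ (k - 2)"
    and F: "\<And>S. S \<in> F \<Longrightarrow> S \<subseteq> H \<and> 2 \<le> card S \<and> card S \<le> k"
    and cF: "\<And>j. 2 \<le> j \<Longrightarrow> j \<le> k \<Longrightarrow> real (card {S\<in>F. card S = j}) \<le> \<delta> * N * s ^ (j - 1)"
    and \<delta>: "\<delta> \<ge> 0" "\<delta> * (C1 * (real k + 1) * (2 * C) ^ k * 512 * 2 ^ r) \<le> 1"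
  shows "\<exists>xs h. distinct xs \<and> length xs = k \<and> inj_on h {..<k} \<and> (\<forall>i<k. h i \<in> H \<and> cpair xs i \<subseteq> h i) \<and>
    (\<forall>S\<in>F. \<not> S \<subseteq> h ` {..<k})"
proof -
  have n0: "real n > 0" using V by simp
  have "(8::real) ^ 1 \<le> 8 ^ r" using r by (intro power_increasing) auto
  then have "128 * 3 * (8::real) \<le> 128 * real k * 8 ^ r" using k by (intro mult_mono) auto
  then have C0: "C \<ge> 3072" unfolding C by linarith
  have m1: "m \<ge> 1" and m0: "m > 0" using m(1) C0 by linarith+
  have C10: "C1 > 0" unfolding C1 by (simp add: add_pos_nonneg)
  have finH: "finite H" using H V by (intro finite_subset[of H "Pow V"]) auto
  have Hf: "finite h \<and> card h = r" if "h \<in> H" for h using H[OF that] V finite_subset by blast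
  have r2: "r \<ge> 2" using r by simp
  have br: "branching m r H" by (rule heavy_structure[OF m1 r2 finH ne]) (use Hf dg in auto)
  obtain j R A where j: "2 \<le> j" "Suc j \<le> r" and R: "R \<subseteq> H" "real (card H) \<le> 4 * 2 ^ r * real (card R)"
    and A: "\<forall>e\<in>R. A e \<subseteq> e \<and> card (A e) = Suc j" and mult: "\<forall>Y. real (card {e\<in>R. A e = Y}) \<le> m ^ (r - Suc j)"
    and heavy: "\<forall>e\<in>R. \<forall>\<tau>. \<tau> \<subseteq> A e \<longrightarrow> card \<tau> = j \<longrightarrow> real (card {e\<in>R. \<tau> \<subseteq> A e}) \<ge> (m / (4 * 2 ^ r)) * m ^ (r - Suc j)"
    using br unfolding branching_def by (elim exE conjE) (rule that)
  define \<theta> where "\<theta> = m ^ (r - Suc j)"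
  define \<mu> where "\<mu> = m / (4 * 2 ^ r)"
  define D where "D = m ^ (r - 2)"
  have \<theta>: "\<theta> > 0" and \<mu>: "\<mu> > 0" using m0 by (auto simp: \<theta>_def \<mu>_def)
  have Dm: "D \<ge> m"
  proof -
    have "m ^ 1 \<le> m ^ (r - 2)" using m1 r by (intro power_increasing) auto
    then show ?thesis by (simp add: D_def)
  qed
  have D0: "D > 0" using Dm m0 by linarith
  have finR: "finite R" using R finH finite_subset by blast
  have NR: "N \<le> 16 * 2 ^ r * real (card R)" using R(2) cH by linarith
  have Rpos: "real (card R) > 0"
  proof (rule ccontr)
    assume "\<not> ?thesis"
    then show False using NR N by simp
  qed
  \<comment> \<open>A \<open>j\<close>-set inside some \<open>A e\<close> has at least
    \<open>\<mu> * \<theta>\<close> extensions, at most \<open>\<theta>\<close> of them by the same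
    vertex. The bound guarantees a sample of at least 6 vertices, twice the size of a
    triple.\<close>
  have \<mu>n: "\<mu> \<le> real n"
  proof -
    obtain e where e: "e \<in> R" using Rpos by (metis card.empty equals0I less_irrefl of_nat_0)
    have "j \<le> card (A e)" using A e by simp
    then obtain \<tau> where \<tau>: "\<tau> \<subseteq> A e" "card \<tau> = j" by (rule obtain_subset_with_card_n) (rule that)
    have sub: "{e\<in>R. \<tau> \<subseteq> A e} \<subseteq> (\<Union>x\<in>V. {e\<in>R. A e = insert x \<tau>})"
    proof
      fix f assume f: "f \<in> {e\<in>R. \<tau> \<subseteq> A e}"
      have fin\<tau>: "finite \<tau>" using \<tau>(2) j card.infinite by fastforce
      have "card (A f - \<tau>) = 1" using f A fin\<tau> \<tau> by (subst card_Diff_subset) auto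
      then obtain x where x: "A f - \<tau> = {x}" using card_1_singletonE by blast
      then have "A f = insert x \<tau>" using f by blast
      moreover have "x \<in> V" using x f A H R(1) by blast
      ultimately show "f \<in> (\<Union>x\<in>V. {e\<in>R. A e = insert x \<tau>})" using f by blast
    qed
    have "\<mu> * \<theta> \<le> real (card {e\<in>R. \<tau> \<subseteq> A e})" using heavy e \<tau> by (simp add: \<mu>_def \<theta>_def)
    also have "\<dots> \<le> real (card (\<Union>x\<in>V. {e\<in>R. A e = insert x \<tau>}))"
      by (rule of_nat_mono, rule card_mono[OF _ sub]) (use V finR in auto)
    also have "\<dots> \<le> real (\<Sum>x\<in>V. card {e\<in>R. A e = insert x \<tau>})"
      by (rule of_nat_mono, rule card_UN_le[OF V(1)])
    also have "\<dots> = (\<Sum>x\<in>V. real (card {e\<in>R. A e = insert x \<tau>}))" by (rule of_nat_sum)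
    also have "\<dots> \<le> real (card V) * \<theta>" using mult by (intro sum_bounded_above) (simp add: \<theta>_def)
    finally show ?thesis using \<theta> V by simp
  qed
  define M where "M = nat \<lceil>C * real n / m\<rceil>"
  have big: "C * real n / m \<ge> 6"
  proof -
    have "m \<le> 4 * 2 ^ r * real n" using \<mu>n by (simp add: \<mu>_def field_simps)
    also have "\<dots> \<le> 4 * 8 ^ r * real n" by (intro mult_right_mono mult_left_mono power_mono) auto
    finally have "6 * m \<le> 24 * (8 ^ r * real n)" by linarith
    also have "\<dots> \<le> (128 * real k) * (8 ^ r * real n)" using k by (intro mult_right_mono) auto
    finally have "6 * m \<le> C * real n" by (simp add: C)
    then show ?thesis using m0 by (simp add: pos_le_divide_eq)
  qed
  have Mb: "C * real n / m \<le> real M" "real M \<le> 2 * (C * real n / m)" using big unfolding M_def by linarith+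
  have M6: "6 \<le> M" using Mb(1) big by linarith
  define q where "q = real M / real n"
  have q: "q > 0" using M6 n0 by (simp add: q_def)
  have ql: "C \<le> m * q" using Mb(1) n0 m0 by (simp add: q_def field_simps)
  have qu: "m * q \<le> 2 * C" using Mb(2) n0 m0 by (simp add: q_def field_simps)
  have "m * q \<le> m * 1" using qu m(1) by linarith
  then have q1: "q \<le> 1" using m0 by (simp only: mult_le_cancel_left_pos)
  then have Mn: "M \<le> n" using n0 by (simp add: q_def)
  have \<mu>q: "\<mu> * q \<ge> 1"
  proof -
    have "(4::real) * 2 ^ r \<le> 128 * real k * 8 ^ r" using k by (intro mult_mono power_mono) auto
    then have "4 * 2 ^ r \<le> m * q" using ql C by linarith
    then show ?thesis by (simp add: \<mu>_def)
  qed
  \<comment> \<open>A quarter of the right side of \<open>few\<close>. The pairs, the forbidden sets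
    and the repeated edges cost at most one \<open>X\<close> each.\<close>
  define X where "X = real (card R) * q ^ 3 / 32"
  have X0: "X > 0" using Rpos q by (simp add: X_def)
  have NX: "N * q ^ 3 / (512 * 2 ^ r) \<le> X"
  proof -
    have "N * q ^ 3 / (512 * 2 ^ r) \<le> (16 * 2 ^ r * real (card R)) * q ^ 3 / (512 * 2 ^ r)"
      using NR q by (intro divide_right_mono mult_right_mono) auto
    also have "\<dots> = X" by (simp add: X_def)
    finally show ?thesis .
  qed
  have T1: "real k * 4 ^ r * real (card R) * q\<^sup>2 / \<mu> \<le> X"
  proof -
    have "32 * real k * 4 ^ r \<le> \<mu> * q"
    proof -
      have "(8::real) ^ r = 4 ^ r * 2 ^ r" by (simp flip: power_mult_distrib)
      then have "32 * real k * 4 ^ r * (4 * 2 ^ r) \<le> m * q" using ql by (simp add: C mult_ac)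
      then show ?thesis by (simp add: \<mu>_def pos_le_divide_eq)
    qed
    then have "(32 * real k * 4 ^ r) * (real (card R) * q\<^sup>2) \<le> (\<mu> * q) * (real (card R) * q\<^sup>2)"
      by (intro mult_right_mono) auto
    then show ?thesis using \<mu> by (simp add: X_def divide_le_eq power2_eq_square power3_eq_cube mult_ac)
  qed
  have sDm: "s \<le> D * m"
  proof -
    have "s ^ (k - 1) \<le> D ^ (k - 1) * m ^ (k - 2)" using s(2) by (simp add: D_def)
    also have "\<dots> \<le> D ^ (k - 1) * m ^ (k - 1)" using D0 m1 by (intro mult_left_mono power_increasing) auto
    finally have "s ^ (k - 1) \<le> (D * m) ^ (k - 1)" by (simp add: power_mult_distrib)
    then show ?thesis using s(1) D0 m0 k by (subst (asm) power_mono_iff) auto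
  qed
  have sq: "s * q / D \<le> 2 * C"
  proof -
    have "s * q / D \<le> (D * m) * q / D" using sDm q D0 by (intro divide_right_mono mult_right_mono) auto
    then show ?thesis using qu D0 by simp
  qed
  have finF: "finite F" using F finH by (intro finite_subset[of F "Pow H"]) auto
  define c where "c = \<delta> * N * q ^ 3 * (2 * C) ^ k"
  have c0: "c \<ge> 0" using \<delta> N q C0 by (simp add: c_def)
  have T2: "(\<Sum>S | S \<in> F \<and> card S < k. q ^ (card S + 2) / D ^ (card S - 1)) \<le> real k * c"
  proof (rule sum_by_card_le)
    fix i assume i: "i < k"
    have eq: "{S \<in> {S \<in> F. card S < k}. card S = i} = {S\<in>F. card S = i}" using i by auto
    show "real (card {S \<in> {S \<in> F. card S < k}. card S = i}) * (q ^ (i + 2) / D ^ (i - 1)) \<le> c"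
    proof (cases "2 \<le> i")
      case True
      then obtain a where a: "i = Suc a" by (metis Suc_le_D numeral_2_eq_2)
      have "(s * q / D) ^ a \<le> (2 * C) ^ a" using sq s q D0 by (intro power_mono) auto
      also have "\<dots> \<le> (2 * C) ^ k" using C0 a i by (intro power_increasing) auto
      finally have pw: "(s * q / D) ^ a \<le> (2 * C) ^ k" .
      have "real (card {S\<in>F. card S = i}) * (q ^ (i + 2) / D ^ (i - 1)) \<le> (\<delta> * N * s ^ a) * (q ^ (i + 2) / D ^ (i - 1))"
        using cF[OF True] i a q D0 by (intro mult_right_mono) auto
      also have "\<dots> = \<delta> * N * q ^ 3 * (s * q / D) ^ a"
        by (simp add: a power_mult_distrib power_divide power3_eq_cube)
      also have "\<dots> \<le> c" unfolding c_def using pw \<delta> N q by (intro mult_left_mono) auto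
      finally show ?thesis using eq by simp
    next
      case False
      then have emp: "{S\<in>F. card S = i} = {}" using F by fastforce
      show ?thesis unfolding eq emp using c0 by simp
    qed
  qed (use finF in auto)
  have T3: "real (card {S\<in>F. card S = k}) * q ^ (k + 1) / D ^ (k - 1) \<le> c"
  proof -
    have qe: "q ^ (k + 1) = q ^ (k - 2) * q ^ 3"
    proof -
      have "k + 1 = (k - 2) + 3" using k by simp
      then show ?thesis by (metis power_add)
    qed
    have "real (card {S\<in>F. card S = k}) * q ^ (k + 1) / D ^ (k - 1) \<le> (\<delta> * N * s ^ (k - 1)) * q ^ (k + 1) / D ^ (k - 1)"
      using cF[of k] k q D0 by (intro divide_right_mono mult_right_mono) auto
    also have "\<dots> \<le> (\<delta> * N * (D ^ (k - 1) * m ^ (k - 2))) * q ^ (k + 1) / D ^ (k - 1)"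
      using s(2) \<delta> N q D0 by (intro divide_right_mono mult_right_mono mult_left_mono) (auto simp: D_def)
    also have "\<dots> = \<delta> * N * m ^ (k - 2) * q ^ (k + 1)" using D0 by simp
    also have "\<dots> = \<delta> * N * m ^ (k - 2) * (q ^ (k - 2) * q ^ 3)" unfolding qe ..
    also have "\<delta> * N * m ^ (k - 2) * (q ^ (k - 2) * q ^ 3) = \<delta> * N * q ^ 3 * (m * q) ^ (k - 2)"
      by (simp add: power_mult_distrib mult_ac)
    also have "\<dots> \<le> \<delta> * N * q ^ 3 * (2 * C) ^ (k - 2)"
      using qu m0 q \<delta> N by (intro mult_left_mono power_mono) auto
    also have "\<dots> \<le> c" unfolding c_def using C0 \<delta> N q by (intro mult_left_mono power_increasing) auto
    finally show ?thesis .
  qed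
  have T23: "C1 * (real k * c + c) \<le> X"
  proof -
    have "C1 * (real k * c + c) = (\<delta> * (C1 * (real k + 1) * (2 * C) ^ k * 512 * 2 ^ r)) * (N * q ^ 3 / (512 * 2 ^ r))"
      by (simp add: c_def field_simps)
    also have "\<dots> \<le> 1 * (N * q ^ 3 / (512 * 2 ^ r))" using \<delta>(2) N q by (intro mult_right_mono) auto
    finally show ?thesis using NX by linarith
  qed
  \<comment> \<open>After \<open>q ^ 4\<close> is bounded by \<open>q ^ 3\<close>, the factor
    \<open>1 / D\<close>, at most \<open>1 / m\<close>, absorbs the constants; this is the purpose
    of the second lower bound on \<open>m\<close>.\<close>
  have T4: "C1 * (real (card H) * q ^ 4 / D) \<le> X"
  proof -
    have "real (card H) * q ^ 4 \<le> N * q ^ 3"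
      using cH(2) N q q1 by (intro mult_mono power_decreasing) auto
    then have "C1 * (real (card H) * q ^ 4) \<le> C1 * (N * q ^ 3)" using C10 by (intro mult_left_mono) auto
    moreover have "C1 * 512 * 2 ^ r * (N * q ^ 3) \<le> D * (N * q ^ 3)"
      using m(2) Dm N q by (intro mult_right_mono) auto
    then have "C1 * (N * q ^ 3) \<le> D * (N * q ^ 3) / (512 * 2 ^ r)" by (simp add: pos_le_divide_eq mult_ac)
    ultimately have "C1 * (real (card H) * q ^ 4) \<le> D * (N * q ^ 3 / (512 * 2 ^ r))" by simp
    also have "\<dots> \<le> D * X" using NX D0 by (intro mult_left_mono) auto
    finally show ?thesis using D0 by (simp add: divide_le_eq mult.commute)
  qed
  have few: "real k * 4 ^ r * real (card R) * q\<^sup>2 / \<mu> + (1 + 2 * real k) * 2 ^ r * 2 ^ (r * k) *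
       ((\<Sum>S | S \<in> F \<and> card S < k. q ^ (card S + 2) / D ^ (card S - 1)) +
        real (card {S\<in>F. card S = k}) * q ^ (k + 1) / D ^ (k - 1) + real (card H) * q ^ 4 / D)
      < real (card R) * (q / 2) ^ 3"
  proof -
    have "C1 * ((\<Sum>S | S \<in> F \<and> card S < k. q ^ (card S + 2) / D ^ (card S - 1)) +
        real (card {S\<in>F. card S = k}) * q ^ (k + 1) / D ^ (k - 1) + real (card H) * q ^ 4 / D)
       \<le> C1 * (real k * c + c + real (card H) * q ^ 4 / D)"
      using T2 T3 C10 by (intro mult_left_mono add_mono) auto
    also have "\<dots> = C1 * (real k * c + c) + C1 * (real (card H) * q ^ 4 / D)" by (rule distrib_left)
    also have "\<dots> \<le> X + X" using T23 T4 by (rule add_mono)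
    finally have "real k * 4 ^ r * real (card R) * q\<^sup>2 / \<mu> + C1 * ((\<Sum>S | S \<in> F \<and> card S < k. q ^ (card S + 2) / D ^ (card S - 1)) +
        real (card {S\<in>F. card S = k}) * q ^ (k + 1) / D ^ (k - 1) + real (card H) * q ^ 4 / D) \<le> 3 * X"
      using T1 by linarith
    also have "\<dots> < 4 * X" using X0 by simp
    also have "\<dots> = real (card R) * (q / 2) ^ 3" by (simp add: X_def power_divide)
    finally show ?thesis unfolding C1 .
  qed
  show ?thesis
  proof (rule cycle_in_heavy_graph[OF V(1) H R(1) j _ \<theta> \<mu> k M6 _ D0])
    show "A e \<subseteq> e \<and> card (A e) = Suc j" if "e \<in> R" for e using A that by blast
    show "M \<le> card V" using Mn V by simp
    show "D \<le> real (card {h\<in>H. P \<subseteq> h})" if "e \<in> R" "P \<subseteq> A e" "card P = 2" for P e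
      using dg[of e P] that A R(1) by (force simp: D_def intro: less_imp_le)
    show "real (card {e\<in>R. A e = Y}) \<le> \<theta>" for Y using mult by (simp add: \<theta>_def)
    show "\<mu> * \<theta> \<le> real (card {e\<in>R. \<tau> \<subseteq> A e})" if "e \<in> R" "\<tau> \<subseteq> A e" "card \<tau> = j" for \<tau> e
      using heavy that by (simp add: \<mu>_def \<theta>_def)
    show "S \<subseteq> H \<and> S \<noteq> {} \<and> card S \<le> k" if "S \<in> F" for S using F[OF that] by auto
    show "1 \<le> \<mu> * (real M / real (card V))" using \<mu>q V by (simp add: q_def)
  qed (use few V(2) in \<open>auto simp: q_def\<close>)
qed

text \<open>Edges forbidden as singletons are discarded, at most half of all, and the pairs in at
  most \<open>D\<close> of the remaining edges are pruned. Then a quarter of \<open>H\<close> has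
  been charged to pairs with at most \<open>D\<close> charges, or a quarter of \<open>H\<close>
  survives with all codegrees above \<open>D\<close>. The forbidden sets still to be avoided have at
  least two elements.\<close>

lemma berge_avoiding_family:
  fixes V :: "'a set" and F :: "'a set set set" and l r :: nat and a x y t s \<delta> CL CH C1 :: real
  assumes l: "l \<ge> 2" and r: "r \<ge> 3"
    and a: "a > 0" "x = 1 - (real l - 1) * a" "x > 0"
    and ax: "x * (2 * real l - 2) / (real r - 2) = a * real l * (2 * real l - 1)"
    and y: "y * (2 * real l - 1) = 1 - 1 / real l"
    and CL: "CL = (1024 * (real l)\<^sup>2) ^ l" and CH: "CH = 128 * real (2 * l) * 8 ^ r"
    and C1: "C1 = (1 + 2 * real (2 * l)) * 2 ^ r * 2 ^ (r * (2 * l))"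
    and V: "finite V" "V \<noteq> {}" and H: "H \<subseteq> {h. h \<subseteq> V \<and> card h = r}"
    and cH: "real (card H) = t * real (card V) powr (1 + 1 / real l)"
    and t: "t \<ge> 1" "t powr (a * real l) \<ge> 2 * CL" "t powr (x / (real r - 2)) \<ge> 2 * CH"
      "t powr (x / (real r - 2)) \<ge> C1 * 512 * 2 ^ r"
    and s: "s > 0" "s \<le> t powr (1 + a)" "s \<le> t * real (card V) powr y"
    and F: "F \<subseteq> Pow H - {{}}"
    and cF: "\<And>j. 1 \<le> j \<Longrightarrow> j \<le> 2 * l \<Longrightarrow> real (card {S\<in>F. card S = j}) \<le> \<delta> * real (card H) * s ^ (j - 1)"
    and \<delta>: "\<delta> \<ge> 0" "\<delta> \<le> 1 / 2" "\<delta> * (2 * real l * (2 * CL) ^ (2 * l)) \<le> 1 / 32"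
      "\<delta> * (2 * real l) ^ (2 * l) * 64 ^ (2 * l) \<le> 1 / 4"
      "\<delta> * (C1 * (real (2 * l) + 1) * (2 * CH) ^ (2 * l) * 512 * 2 ^ r) \<le> 1"
  shows "\<exists>E. E \<subseteq> H \<and> card E = 2 * l \<and> is_berge (2 * l) E \<and> (\<forall>S\<in>F. \<not> S \<subseteq> E)"
proof -
  define n where "n = card V"
  have n0: "n > 0" using V by (simp add: n_def card_gt_0_iff)
  define N where "N = real (card H)"
  have Nt: "N = t * real n powr (1 + 1 / real l)" using cH by (simp add: N_def n_def)
  have t0: "t > 0" using t by simp
  have N0: "N > 0" unfolding Nt using t0 n0 by simp
  have l1: "real l > 1" using l by simp
  have finH: "finite H" using H V by (intro finite_subset[of H "Pow V"]) auto
  have fin: "finite h" if "h \<in> H" for h using that H V finite_subset by blast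
  have finF: "finite F" using F finH by (intro finite_subset[of F "Pow H"]) auto
  define D where "D = t powr x"
  \<comment> \<open>The root with \<open>m ^ (r - 2) = D\<close>, so that codegrees above
    \<open>D\<close> start the chain of degrees at level 2.\<close>
  define m where "m = t powr (x / (real r - 2))"
  define b where "b = t powr (a * real l)"
  have D1: "D \<ge> 1" unfolding D_def using t a(3) by (simp add: ge_one_powr_ge_zero)
  have r2: "real r - 2 > 0" using r by simp
  have m1: "m \<ge> 1" unfolding m_def using t a(3) r2 by (simp add: ge_one_powr_ge_zero)
  have mD: "m ^ (r - 2) = D"
  proof -
    have "m ^ (r - 2) = m powr real (r - 2)" using m1 by (simp add: powr_realpow)
    also have "\<dots> = t powr (x / (real r - 2) * real (r - 2))" by (simp add: m_def powr_powr)
    also have "x / (real r - 2) * real (r - 2) = x" using r2 r by (simp add: of_nat_diff)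
    finally show ?thesis by (simp add: D_def)
  qed
  have tD: "t / D = t powr ((real l - 1) * a)"
  proof -
    have "t / D = t powr 1 / t powr x" using t0 by (simp add: D_def)
    also have "\<dots> = t powr (1 - x)" by (rule powr_diff[symmetric])
    finally show ?thesis using a(2) by simp
  qed
  have bl: "b ^ (l - 1) = (t / D) ^ l"
  proof -
    have "b ^ (l - 1) = b powr real (l - 1)" using t0 by (simp add: b_def powr_realpow)
    also have "\<dots> = t powr (a * real l * (real l - 1))" using l by (simp add: b_def powr_powr of_nat_diff)
    also have "\<dots> = t powr ((real l - 1) * a * real l)" by (simp add: mult_ac)
    also have "\<dots> = (t / D) powr real l" unfolding tD by (simp add: powr_powr)
    also have "\<dots> = (t / D) ^ l" using t0 D1 by (simp add: powr_realpow)
    finally show ?thesis .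
  qed
  have sDb: "s \<le> D * b"
  proof -
    have "D * b = t powr (x + a * real l)" by (simp add: D_def b_def powr_add)
    also have "x + a * real l = 1 + a" using a(2) by (simp add: algebra_simps)
    finally show ?thesis using s(2) by simp
  qed
  have k1: "real (2 * l - 1) = 2 * real l - 1" using l by (simp add: of_nat_diff)
  have st: "s ^ (2 * l - 1) \<le> t ^ (2 * l - 1) * real n powr (1 - 1 / real l)"
  proof -
    have "s ^ (2 * l - 1) \<le> (t * real n powr y) ^ (2 * l - 1)" using s by (intro power_mono) (auto simp: n_def)
    also have "\<dots> = t ^ (2 * l - 1) * (real n powr y) powr real (2 * l - 1)"
      using n0 by (simp add: power_mult_distrib powr_realpow)
    also have "(real n powr y) powr real (2 * l - 1) = real n powr (1 - 1 / real l)"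
      unfolding k1 powr_powr y ..
    finally show ?thesis .
  qed
  \<comment> \<open>Here the two regimes are balanced: \<open>ax\<close> says that
    \<open>b ^ (2 * l - 1) = m ^ (2 * l - 2)\<close>.\<close>
  have sm: "s ^ (2 * l - 1) \<le> (m ^ (r - 2)) ^ (2 * l - 1) * m ^ (2 * l - 2)"
  proof -
    have "s ^ (2 * l - 1) \<le> (D * b) ^ (2 * l - 1)" using s(1) sDb by (intro power_mono) auto
    also have "\<dots> = D ^ (2 * l - 1) * b powr real (2 * l - 1)"
      using t0 by (simp add: power_mult_distrib powr_realpow b_def)
    also have "b powr real (2 * l - 1) = t powr (a * real l * (2 * real l - 1))"
      unfolding k1 b_def powr_powr ..
    also have "\<dots> = t powr (x / (real r - 2) * (2 * real l - 2))" unfolding ax[symmetric] by simp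
    also have "\<dots> = m powr real (2 * l - 2)" using l by (simp add: m_def powr_powr of_nat_diff)
    also have "\<dots> = m ^ (2 * l - 2)" using m1 by (simp add: powr_realpow)
    finally show ?thesis unfolding mD .
  qed
  define H1 where "H1 = {h\<in>H. {h} \<notin> F}"
  have cH1: "real (card H1) \<ge> N / 2"
  proof -
    have "card (H - H1) \<le> card {S\<in>F. card S = 1}"
    proof -
      have "(\<lambda>h. {h}) ` (H - H1) \<subseteq> {S\<in>F. card S = 1}" by (auto simp: H1_def)
      then have "card ((\<lambda>h. {h}) ` (H - H1)) \<le> card {S\<in>F. card S = 1}" using finF by (intro card_mono) auto
      then show ?thesis by (simp add: card_image)
    qed
    then have "real (card (H - H1)) \<le> \<delta> * N" using cF[of 1] l by (simp add: N_def)
    also have "\<dots> \<le> 1 / 2 * N" using \<delta> N0 by (intro mult_right_mono) auto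
    finally have "real (card (H - H1)) \<le> N / 2" by simp
    moreover have "H1 \<subseteq> H" by (auto simp: H1_def)
    then have "card H = card H1 + card (H - H1)"
      using finH by (metis add.commute card_Diff_subset card_mono finite_subset le_add_diff_inverse2)
    ultimately show ?thesis by (simp add: N_def)
  qed
  have finH1: "finite H1" using finH by (simp add: H1_def)
  define Tr where "Tr h = {P. P \<subseteq> h \<and> card P = 2}" for h :: "'a set"
  obtain H2 \<pi> where H2: "H2 \<subseteq> H1" "\<forall>e\<in>H2. \<forall>\<tau>\<in>Tr e. real (card {e'\<in>H2. \<tau> \<in> Tr e'}) > D"
    "\<forall>e\<in>H1 - H2. \<pi> e \<in> Tr e" "\<forall>\<tau>. D \<ge> 0 \<longrightarrow> real (card {e\<in>H1 - H2. \<pi> e = \<tau>}) \<le> D"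
    using prune[OF finH1, of Tr D] by auto
  \<comment> \<open>A forbidden set inside the cycle would be a singleton, excluded by the choice of
    \<open>H1\<close>, or have between 2 and \<open>2 * l\<close> elements, which the two cases
    below exclude.\<close>
  have finish: "\<exists>E. E \<subseteq> H \<and> card E = 2 * l \<and> is_berge (2 * l) E \<and> (\<forall>S\<in>F. \<not> S \<subseteq> E)"
    if G: "G \<subseteq> H1" and xs: "distinct xs" "length xs = 2 * l" "inj_on h {..<2 * l}"
      "\<And>i. i < 2 * l \<Longrightarrow> h i \<in> G \<and> cpair xs i \<subseteq> h i"
      "\<And>S. S \<in> F \<Longrightarrow> S \<subseteq> G \<Longrightarrow> 2 \<le> card S \<Longrightarrow> card S \<le> 2 * l \<Longrightarrow> \<not> S \<subseteq> h ` {..<2 * l}" for G xs h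
  proof (intro exI[of _ "h ` {..<2 * l}"] conjI ballI)
    have hG: "h ` {..<2 * l} \<subseteq> G" using xs(4) by auto
    then show "h ` {..<2 * l} \<subseteq> H" using G by (auto simp: H1_def)
    show cE: "card (h ` {..<2 * l}) = 2 * l" using xs(3) by (simp add: card_image)
    show "is_berge (2 * l) (h ` {..<2 * l})" using is_bergeI[of xs h] xs l by simp
    show "\<not> S \<subseteq> h ` {..<2 * l}" if S: "S \<in> F" for S
    proof
      assume sub: "S \<subseteq> h ` {..<2 * l}"
      have "card S \<le> 2 * l" using card_mono[OF _ sub] cE by simp
      have "S \<subseteq> G" using sub hG by blast
      have "finite S" using sub by (rule finite_subset) simp
      moreover have "S \<noteq> {}" using F S by blast
      ultimately have "card S \<noteq> 0" by simp
      moreover have "card S \<noteq> 1"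
      proof
        assume "card S = 1"
        then obtain h' where "S = {h'}" using card_1_singletonE by blast
        then show False using \<open>S \<subseteq> G\<close> G S by (auto simp: H1_def)
      qed
      ultimately have "2 \<le> card S" by simp
      then show False using xs(5)[OF S \<open>S \<subseteq> G\<close> _ \<open>card S \<le> 2 * l\<close>] sub by blast
    qed
  qed
  show ?thesis
  proof (cases "4 * real (card (H1 - H2)) \<ge> N")
    case True
    define F' where "F' = {S\<in>F. S \<subseteq> H1 - H2 \<and> 2 \<le> card S \<and> card S \<le> 2 * l}"
    have "\<exists>xs h. distinct xs \<and> length xs = 2 * l \<and> (\<forall>i<2 * l. h i \<in> H1 - H2 \<and> \<pi> (h i) = cpair xs i) \<and>
      (\<forall>S\<in>F'. \<not> S \<subseteq> h ` {..<2 * l})"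
    proof (rule light_case[OF V(1) n_def[symmetric] n0 _ _ _ D1 l t0 _ CL _ bl s(1) sDb st])
      show "finite (H1 - H2)" using finH1 by simp
      show "\<pi> e \<subseteq> V \<and> card (\<pi> e) = 2" if "e \<in> H1 - H2" for e
      proof -
        have "\<pi> e \<subseteq> e" "card (\<pi> e) = 2" using H2(3) that by (auto simp: Tr_def)
        moreover have "e \<subseteq> V" using that H by (auto simp: H1_def)
        ultimately show ?thesis by blast
      qed
      show "real (card {e\<in>H1 - H2. \<pi> e = P}) \<le> D" for P using H2(4) D1 by auto
      show "t * real n powr (1 + 1 / real l) \<le> 4 * real (card (H1 - H2))" using True by (simp add: Nt)
      show "2 * CL \<le> b" using t(2) by (simp add: b_def)
      show "S \<subseteq> H1 - H2 \<and> 2 \<le> card S \<and> card S \<le> 2 * l" if "S \<in> F'" for S using that by (simp add: F'_def)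
      show "real (card {S\<in>F'. card S = j}) \<le> \<delta> * (t * real n powr (1 + 1 / real l)) * s ^ (j - 1)"
        if "2 \<le> j" "j \<le> 2 * l" for j
      proof -
        have "card {S\<in>F'. card S = j} \<le> card {S\<in>F. card S = j}" using finF by (intro card_mono) (auto simp: F'_def)
        moreover have "real (card {S\<in>F. card S = j}) \<le> \<delta> * N * s ^ (j - 1)" using cF[of j] that by (simp add: N_def)
        ultimately show ?thesis unfolding Nt by linarith
      qed
    qed (use \<delta> in auto)
    then obtain xs h where xs: "distinct xs" "length xs = 2 * l" "\<forall>i<2 * l. h i \<in> H1 - H2 \<and> \<pi> (h i) = cpair xs i"
      "\<forall>S\<in>F'. \<not> S \<subseteq> h ` {..<2 * l}" by (elim exE conjE) (rule that)
    have hinj: "inj_on h {..<2 * l}"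
    proof (rule inj_onI)
      fix i j assume ij: "i \<in> {..<2 * l}" "j \<in> {..<2 * l}" "h i = h j"
      then have "cpair xs i = cpair xs j" using xs(3) by (metis lessThan_iff)
      then show "i = j" using cpair_inj[OF xs(1)] ij xs(2) l by (auto simp: inj_on_def)
    qed
    show ?thesis
    proof (rule finish[OF _ xs(1,2) hinj])
      show "H1 - H2 \<subseteq> H1" by blast
      show "h i \<in> H1 - H2 \<and> cpair xs i \<subseteq> h i" if "i < 2 * l" for i
        using xs(3) H2(3) that unfolding Tr_def by (metis (no_types, lifting) mem_Collect_eq)
      show "\<not> S \<subseteq> h ` {..<2 * l}" if "S \<in> F" "S \<subseteq> H1 - H2" "2 \<le> card S" "card S \<le> 2 * l" for S
        using xs(4) that unfolding F'_def by blast
    qed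
  next
    case False
    have "card H1 = card H2 + card (H1 - H2)"
      using H2(1) finH1 by (metis add.commute card_Diff_subset card_mono finite_subset le_add_diff_inverse2)
    then have c2: "4 * real (card H2) \<ge> N" using False cH1 by simp
    define F' where "F' = {S\<in>F. S \<subseteq> H2 \<and> 2 \<le> card S \<and> card S \<le> 2 * l}"
    have H2H: "H2 \<subseteq> H" using H2 by (auto simp: H1_def)
    have "\<exists>xs h. distinct xs \<and> length xs = 2 * l \<and> inj_on h {..<2 * l} \<and> (\<forall>i<2 * l. h i \<in> H2 \<and> cpair xs i \<subseteq> h i) \<and>
      (\<forall>S\<in>F'. \<not> S \<subseteq> h ` {..<2 * l})"
    proof (rule heavy_case[OF V(1) n_def[symmetric] n0 _ _ _ r _ c2 _ N0 CH C1 _ _ s(1)])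
      show "h \<subseteq> V \<and> card h = r" if "h \<in> H2" for h using that H2H H by blast
      show "H2 \<noteq> {}" using c2 N0 by auto
      show "m ^ (r - 2) < real (card {h\<in>H2. P \<subseteq> h})" if "h \<in> H2" "P \<subseteq> h" "card P = 2" for h P
      proof -
        have "{e'\<in>H2. P \<in> Tr e'} = {h\<in>H2. P \<subseteq> h}" using that(3) by (auto simp: Tr_def)
        moreover have "P \<in> Tr h" using that by (simp add: Tr_def)
        ultimately show ?thesis using H2(2) that(1) unfolding mD by metis
      qed
      show "3 \<le> 2 * l" using l by simp
      show "real (card H2) \<le> N" unfolding N_def using H2H finH by (intro of_nat_mono card_mono)
      show "2 * CH \<le> m" "C1 * 512 * 2 ^ r \<le> m" using t by (auto simp: m_def)
      show "s ^ (2 * l - 1) \<le> (m ^ (r - 2)) ^ (2 * l - 1) * m ^ (2 * l - 2)" by (rule sm)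
      show "S \<subseteq> H2 \<and> 2 \<le> card S \<and> card S \<le> 2 * l" if "S \<in> F'" for S using that by (simp add: F'_def)
      show "real (card {S\<in>F'. card S = j}) \<le> \<delta> * N * s ^ (j - 1)" if "2 \<le> j" "j \<le> 2 * l" for j
      proof -
        have "card {S\<in>F'. card S = j} \<le> card {S\<in>F. card S = j}" using finF by (intro card_mono) (auto simp: F'_def)
        moreover have "real (card {S\<in>F. card S = j}) \<le> \<delta> * N * s ^ (j - 1)" using cF[of j] that by (simp add: N_def)
        ultimately show ?thesis by linarith
      qed
      show "0 \<le> \<delta>" by (rule \<delta>(1))
      show "\<delta> * (C1 * (real (2 * l) + 1) * (2 * CH) ^ (2 * l) * 512 * 2 ^ r) \<le> 1" by (rule \<delta>(5))
    qed
    then obtain xs h where xs: "distinct xs" "length xs = 2 * l" "inj_on h {..<2 * l}"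
      "\<forall>i<2 * l. h i \<in> H2 \<and> cpair xs i \<subseteq> h i" "\<forall>S\<in>F'. \<not> S \<subseteq> h ` {..<2 * l}" by (elim exE conjE) (rule that)
    show ?thesis
    proof (rule finish[OF H2(1) xs(1-3)])
      show "h i \<in> H2 \<and> cpair xs i \<subseteq> h i" if "i < 2 * l" for i using xs(4) that by blast
      show "\<not> S \<subseteq> h ` {..<2 * l}" if "S \<in> F" "S \<subseteq> H2" "2 \<le> card S" "card S \<le> 2 * l" for S
        using xs(5) that unfolding F'_def by blast
    qed
  qed
qed

text \<open>The denominator equals \<open>(r - 2) * l * (2 * l - 1) + 2 * (l - 1) ^ 2\<close>. In
  this form \<open>a\<close> is visibly the solution of the balance equation in the last claim,
  which is linear in \<open>a\<close>.\<close>

lemma exponent_identities: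
  fixes l r :: real
  assumes "l \<ge> 2" "r \<ge> 3"
  defines "a \<equiv> (2 * l - 2) / (2 * (r - 1) * l\<^sup>2 - (r + 2) * l + 2)"
  shows "a > 0" and "1 - (l - 1) * a > 0"
    and "(1 - (l - 1) * a) * (2 * l - 2) / (r - 2) = a * l * (2 * l - 1)"
proof -
  define den where "den = 2 * (r - 1) * l\<^sup>2 - (r + 2) * l + 2"
  have den: "den = (r - 2) * l * (2 * l - 1) + 2 * (l - 1)\<^sup>2"
    by (simp add: den_def algebra_simps power2_eq_square)
  have pos: "(r - 2) * l * (2 * l - 1) > 0" using assms by simp
  then have d0: "den > 0" unfolding den by (simp add: add_pos_nonneg)
  have a: "a = (2 * l - 2) / den" by (simp add: a_def den_def)
  show "a > 0" unfolding a using d0 assms by simp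
  have x: "1 - (l - 1) * a = (r - 2) * l * (2 * l - 1) / den"
  proof -
    have "1 - (l - 1) * a = (den - (l - 1) * (2 * l - 2)) / den" unfolding a using d0 by (simp add: field_simps)
    also have "den - (l - 1) * (2 * l - 2) = (r - 2) * l * (2 * l - 1)"
      unfolding den by (simp add: power2_eq_square algebra_simps)
    finally show ?thesis .
  qed
  show "1 - (l - 1) * a > 0" unfolding x using pos d0 by simp
  show "(1 - (l - 1) * a) * (2 * l - 2) / (r - 2) = a * l * (2 * l - 1)"
  proof -
    have "r - 2 \<noteq> 0" using assms(2) by simp
    then have "(r - 2) * l * (2 * l - 1) / den * (2 * l - 2) / (r - 2) = l * (2 * l - 1) * (2 * l - 2) / den" by simp
    then show ?thesis unfolding x unfolding a by (simp add: mult_ac)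
  qed
qed

section \<open>The container theorem\<close>

theorem theorem5p2:
  fixes l r :: nat
  assumes "l \<ge> 2" and "r \<ge> 3"
  shows "\<exists>\<epsilon> K :: real. \<epsilon> > 0 \<and> K > 0 \<and>
    (\<forall>\<^sub>F n :: nat in sequentially. \<forall>t :: real. t \<ge> K * ln (real n) ^ (r - 2) \<longrightarrow>
      (\<forall>H :: 'a hypergraph.
        r_graph r H \<and> card (verts H) = n \<and>
        real (num_edges H) = t * real n powr (1 + 1 / real l) \<longrightarrow>
        (\<exists>C :: 'a hypergraph set.
          finite C \<and> (\<forall>G \<in> C. subgraph r G H) \<and>
          real (card C) \<le>
            exp (ln (real n) ^ (r - 1) / \<epsilon> *
              max ((t / ln (real n) ^ (r - 2)) powr
                     (- ((2 * real l - 2) /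
                         (2 * (real r - 1) * (real l)\<^sup>2 - (real r + 2) * real l + 2)))
                   * real n powr (1 + 1 / real l))
                  (real n powr (1 + 1 / (2 * real l - 1)))) \<and>
          (\<forall>F. subgraph r F H \<and> berge_free r (2 * l) F \<longrightarrow> (\<exists>G \<in> C. subgraph r F G)) \<and>
          (\<forall>G \<in> C. real (num_edges G) \<le>
             (1 - \<epsilon> / ln (real n) ^ (r - 2)) * (t * real n powr (1 + 1 / real l))))))"
proof -
  define a where "a = (2 * real l - 2) / (2 * (real r - 1) * (real l)\<^sup>2 - (real r + 2) * real l + 2)"
  define x where "x = 1 - (real l - 1) * a"
  define y where "y = (real l - 1) / (real l * (2 * real l - 1))"
  have lr: "real l \<ge> 2" "real r \<ge> 3" using assms by simp_all
  note ids = exponent_identities[OF lr, folded a_def, folded x_def]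
  have y: "y * (2 * real l - 1) = 1 - 1 / real l"
    unfolding y_def using lr by (simp add: field_simps)
  define CL where "CL = (1024 * (real l)\<^sup>2) ^ l"
  define CH where "CH = 128 * real (2 * l) * 8 ^ r"
  define C1 where "C1 = (1 + 2 * real (2 * l)) * 2 ^ r * 2 ^ (r * (2 * l))"
  define X1 where "X1 = 2 * real l * (2 * CL) ^ (2 * l)"
  define X2 where "X2 = (2 * real l) ^ (2 * l) * 64 ^ (2 * l)"
  define X3 where "X3 = C1 * (real (2 * l) + 1) * (2 * CH) ^ (2 * l) * 512 * 2 ^ r"
  have nn: "CL \<ge> 0" "CH \<ge> 0" "C1 \<ge> 0" by (auto simp: CL_def CH_def C1_def)
  have X0: "X1 \<ge> 0" "X2 \<ge> 0" "X3 \<ge> 0" using nn by (auto simp: X1_def X2_def X3_def)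
  \<comment> \<open>Small enough for all four requirements, each summand of the denominator taking
    care of one.\<close>
  define \<delta> where "\<delta> = 1 / (2 + 32 * X1 + 4 * X2 + X3)"
  have \<delta>0: "\<delta> > 0" using X0 by (simp add: \<delta>_def)
  have \<delta>: "\<delta> \<le> 1 / 2" "\<delta> * X1 \<le> 1 / 32" "\<delta> * X2 \<le> 1 / 4" "\<delta> * X3 \<le> 1"
    using X0 by (auto simp: \<delta>_def divide_le_eq)
  have k1: "2 * l \<ge> 1" using assms by simp
  have \<delta>k: "\<delta> / 2 ^ (2 * l) > 0" using \<delta>0 by simp
  have two: "(2::real) \<ge> 1" by simp
  obtain \<epsilon>0 c :: real where \<epsilon>0: "\<epsilon>0 > 0" and c: "c > 0"
    and cont: "\<And>(V :: 'a set set) HH p. \<lbrakk>finite V; uniform V (2 * l) HH; 0 < p; p \<le> 1; spread V p (2 * l) 2 HH;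
       real (card HH) \<ge> \<delta> / 2 ^ (2 * l) * real (card V) * (1 / p) ^ (2 * l - 1)\<rbrakk> \<Longrightarrow> has_containers V HH p \<epsilon>0 c"
    using containers[OF k1 \<delta>k two, where ?'b = "'a set"] by auto
  \<comment> \<open>The second bound pays for the factor \<open>2 * c * (r + 1)\<close> in the
    logarithm of the number of containers.\<close>
  define \<epsilon> where "\<epsilon> = min \<epsilon>0 (1 / (2 * c * (real r + 1)))"
  \<comment> \<open>The summands force, in this order, \<open>t \<ge> 1\<close> and the three lower
    bounds on powers of \<open>t\<close> that \<open>berge_avoiding_family\<close> requires.\<close>
  define K where "K = 1 + (2 * CL) powr (1 / (a * real l)) + (2 * CH) powr ((real r - 2) / x) + (C1 * 512 * 2 ^ r) powr ((real r - 2) / x)"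
  have \<epsilon>: "\<epsilon> > 0" using \<epsilon>0 c by (simp add: \<epsilon>_def)
  have K1: "K \<ge> 1" by (simp add: K_def)
  have big: "t powr e \<ge> Z" if "t \<ge> Z powr (1 / e)" "e > 0" "Z \<ge> 0" "t \<ge> 1" for t e Z :: real
  proof (cases "Z = 0")
    case False
    then have "Z = (Z powr (1 / e)) powr e" using that by (simp add: powr_powr)
    also have "\<dots> \<le> t powr e" using that by (intro powr_mono2) auto
    finally show ?thesis .
  qed simp
  show ?thesis
  proof (rule exI[of _ \<epsilon>], rule exI[of _ K], intro conjI)
    show "\<epsilon> > 0" by fact
    show "K > 0" using K1 by simp
    show "\<forall>\<^sub>F n :: nat in sequentially. \<forall>t :: real. t \<ge> K * ln (real n) ^ (r - 2) \<longrightarrow>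
      (\<forall>H :: 'a hypergraph.
        r_graph r H \<and> card (verts H) = n \<and>
        real (num_edges H) = t * real n powr (1 + 1 / real l) \<longrightarrow>
        (\<exists>C :: 'a hypergraph set.
          finite C \<and> (\<forall>G \<in> C. subgraph r G H) \<and>
          real (card C) \<le>
            exp (ln (real n) ^ (r - 1) / \<epsilon> *
              max ((t / ln (real n) ^ (r - 2)) powr
                     (- ((2 * real l - 2) /
                         (2 * (real r - 1) * (real l)\<^sup>2 - (real r + 2) * real l + 2)))
                   * real n powr (1 + 1 / real l))
                  (real n powr (1 + 1 / (2 * real l - 1)))) \<and>
          (\<forall>F. subgraph r F H \<and> berge_free r (2 * l) F \<longrightarrow> (\<exists>G \<in> C. subgraph r F G)) \<and>
          (\<forall>G \<in> C. real (num_edges G) \<le>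
             (1 - \<epsilon> / ln (real n) ^ (r - 2)) * (t * real n powr (1 + 1 / real l)))))"
      unfolding eventually_sequentially a_def[symmetric]
    \<comment> \<open>From \<open>n = 3\<close> on the logarithm is at least 1, so its powers only
      weaken the bounds in which they appear.\<close>
    proof (rule exI[of _ 3], intro allI impI, elim conjE)
      fix n :: nat and t :: real and H :: "'a hypergraph"
      assume n3: "3 \<le> n" and tK: "K * ln (real n) ^ (r - 2) \<le> t" and rH: "r_graph r H" and nH: "card (verts H) = n"
        and eH: "real (num_edges H) = t * real n powr (1 + 1 / real l)"
      define L where "L = ln (real n)"
      have "exp 1 \<le> real n" using exp_le n3 by linarith
      then have "ln (exp 1) \<le> ln (real n)" using n3 by (subst ln_le_cancel_iff) auto
      then have L1: "L \<ge> 1" by (simp add: L_def)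
      have Lp: "L ^ j \<ge> 1" for j using L1 by (rule one_le_power)
      have Lpos: "L ^ j > 0" for j using L1 by simp
      have n0: "real n > 0" using n3 by simp
      have "K * 1 \<le> K * L ^ (r - 2)" using Lp K1 by (intro mult_left_mono) auto
      then have tKK: "t \<ge> K" using tK by (simp add: L_def)
      then have t1: "t \<ge> 1" using K1 by simp
      define V where "V = verts H"
      define E where "E = edges H"
      have V: "finite V" "card V = n" "V \<noteq> {}" using rH nH n3 by (auto simp: V_def r_graph_def)
      have EV: "E \<subseteq> {h. h \<subseteq> V \<and> card h = r}" using rH by (auto simp: E_def V_def r_graph_def)
      have finE: "finite E" using EV V by (intro finite_subset[of E "Pow V"]) auto
      define N where "N = real (card E)"
      have N: "N = t * real n powr (1 + 1 / real l)" using eH by (simp add: N_def E_def num_edges_def)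
      have N0: "N > 0" unfolding N using t1 n0 by simp
      \<comment> \<open>The largest scale allowed by the forbidden sets: the first term is
        \<open>D * b\<close>, the second comes from the full sets in the light regime.\<close>
      define s where "s = min (t powr (1 + a)) (t * real n powr y)"
      have y0: "y \<ge> 0" using lr by (simp add: y_def)
      have s1: "s \<ge> 1"
      proof -
        have "t powr (1 + a) \<ge> 1" using t1 ids(1) by (intro ge_one_powr_ge_zero) auto
        moreover have "1 * 1 \<le> t * real n powr y" using t1 y0 n3 by (intro mult_mono ge_one_powr_ge_zero) auto
        ultimately show ?thesis by (simp add: s_def)
      qed
      define p where "p = 1 / s"
      have p: "0 < p" "p \<le> 1" "1 / p = s" using s1 by (auto simp: p_def)
      \<comment> \<open>The hypergraph handed to the container lemma: its vertices are the edges of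
        \<open>H\<close>, its edges the Berge cycles in \<open>H\<close>.\<close>
      define HH where "HH = {B. B \<subseteq> E \<and> card B = 2 * l \<and> is_berge (2 * l) B}"
      have unif: "uniform E (2 * l) HH" by (auto simp: HH_def uniform_def)
      have "\<exists>HH'. HH' \<subseteq> HH \<and> spread E p (2 * l) 2 HH' \<and> real (card HH') \<ge> \<delta> / 2 ^ (2 * l) * real (card E) * (1 / p) ^ (2 * l - 1)"
      proof (rule balanced_subfamily[OF finE unif p(1,2) k1])
        fix F assume F: "F \<subseteq> Pow E - {{}}"
          and cF: "\<And>j. 1 \<le> j \<Longrightarrow> j \<le> 2 * l \<Longrightarrow> real (card {T\<in>F. card T = j}) \<le> \<delta> * real (card E) * (1 / p) ^ (j - 1)"
        have "\<exists>B. B \<subseteq> E \<and> card B = 2 * l \<and> is_berge (2 * l) B \<and> (\<forall>S\<in>F. \<not> S \<subseteq> B)"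
        proof (rule berge_avoiding_family[OF assms ids(1) x_def ids(2,3) y CL_def CH_def C1_def V(1,3) EV _ t1 _ _ _ _ _ _ F])
          show "real (card E) = t * real (card V) powr (1 + 1 / real l)" using N V by (simp add: N_def)
          show "t powr (a * real l) \<ge> 2 * CL"
            by (rule big) (use tKK t1 nn ids(1) lr in \<open>auto simp: K_def intro: order_trans[rotated]\<close>)
          show "t powr (x / (real r - 2)) \<ge> 2 * CH" "t powr (x / (real r - 2)) \<ge> C1 * 512 * 2 ^ r"
            by (rule big; use tKK t1 nn ids(2) lr in \<open>auto simp: K_def intro: order_trans[rotated]\<close>)+
          show "0 < s" using s1 by simp
          show "s \<le> t powr (1 + a)" "s \<le> t * real (card V) powr y" using V by (auto simp: s_def)
          show "real (card {S\<in>F. card S = j}) \<le> \<delta> * real (card E) * s ^ (j - 1)" if "1 \<le> j" "j \<le> 2 * l" for j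
            using cF[OF that] p(3) by simp
          show "0 \<le> \<delta>" using \<delta>0 by simp
          show "\<delta> \<le> 1 / 2" by (rule \<delta>(1))
          show "\<delta> * (2 * real l * (2 * CL) ^ (2 * l)) \<le> 1 / 32" using \<delta>(2) by (simp only: X1_def)
          show "\<delta> * (2 * real l) ^ (2 * l) * 64 ^ (2 * l) \<le> 1 / 4" using \<delta>(3) by (simp only: X2_def mult.assoc)
          show "\<delta> * (C1 * (real (2 * l) + 1) * (2 * CH) ^ (2 * l) * 512 * 2 ^ r) \<le> 1" using \<delta>(4) by (simp only: X3_def)
        qed
        then show "\<exists>B\<in>HH. \<forall>T\<in>F. \<not> T \<subseteq> B" unfolding HH_def by blast
      qed
      then obtain HH' where HH': "HH' \<subseteq> HH" "spread E p (2 * l) 2 HH'"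
        "real (card HH') \<ge> \<delta> / 2 ^ (2 * l) * real (card E) * (1 / p) ^ (2 * l - 1)" by blast
      have unif': "uniform E (2 * l) HH'" using unif HH'(1) by (auto simp: uniform_def)
      have "has_containers E HH' p \<epsilon>0 c" by (rule cont[OF finE unif' p(1,2) HH'(2,3)])
      then obtain \<C> B where C: "finite \<C>" "real B \<le> c * (p * real (card E) + 1)" "card \<C> \<le> (card E + 1) ^ B"
          "\<forall>X\<in>\<C>. X \<subseteq> E \<and> real (card X) \<le> (1 - \<epsilon>0) * real (card E)"
          "\<forall>I. I \<subseteq> E \<longrightarrow> indep HH' I \<longrightarrow> (\<exists>X\<in>\<C>. I \<subseteq> X)"
        unfolding has_containers_def by (elim exE conjE) (rule that)
      have sub: "subgraph r (Hypergraph V X) H" if "X \<subseteq> E" for X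
        using rH that by (auto simp: subgraph_def r_graph_def V_def E_def)
      define mx where "mx = max ((t / L ^ (r - 2)) powr (- a) * real n powr (1 + 1 / real l)) (real n powr (1 + 1 / (2 * real l - 1)))"
      have pN: "p * N \<le> mx" "p * N \<ge> 1"
      proof -
        have e1: "t * real n powr (1 + 1 / real l) / t powr (1 + a) = t powr (- a) * real n powr (1 + 1 / real l)"
          using t1 by (simp add: powr_add powr_minus field_simps)
        have ex: "1 + 1 / real l - y = 1 + 1 / (2 * real l - 1)" unfolding y_def using lr by (simp add: field_simps)
        have "real n powr (1 + 1 / real l) / real n powr y = real n powr (1 + 1 / (2 * real l - 1))"
          unfolding ex[symmetric] by (rule powr_diff[symmetric])
        then have e2: "t * real n powr (1 + 1 / real l) / (t * real n powr y) = real n powr (1 + 1 / (2 * real l - 1))"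
          using t1 by simp
        have big1: "real n powr (1 + 1 / (2 * real l - 1)) \<ge> 1"
          using n3 lr by (intro ge_one_powr_ge_zero) auto
        \<comment> \<open>The exponent is negative and \<open>L \<ge> 1\<close>, so dividing
          \<open>t\<close> by a power of \<open>L\<close> only enlarges the bound.\<close>
        have "t / L ^ (r - 2) \<le> t / 1" using Lp Lpos t1 by (intro divide_left_mono) auto
        moreover have "t / L ^ (r - 2) > 0" using L1 t1 by (intro divide_pos_pos zero_less_power) auto
        ultimately have "t powr (- a) \<le> (t / L ^ (r - 2)) powr (- a)" using ids(1) by (intro powr_mono2') auto
        then have tm: "t powr (- a) * real n powr (1 + 1 / real l) \<le> mx"
          unfolding mx_def by (intro max.coboundedI1 mult_right_mono) auto
        have pNeq: "p * N = t * real n powr (1 + 1 / real l) / s" by (simp add: p_def N)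
        show "p * N \<le> mx"
        proof (cases "t powr (1 + a) \<le> t * real n powr y")
          case True
          then show ?thesis using pNeq e1 tm by (simp add: s_def)
        next
          case False
          then show ?thesis using pNeq e2 by (simp add: s_def mx_def)
        qed
        have "s \<le> t * real n powr y" by (simp add: s_def)
        then have "N / (t * real n powr y) \<le> N / s" using s1 N0 by (intro divide_left_mono) auto
        then have "1 \<le> N / s" using big1 e2 by (simp add: N)
        then show "p * N \<ge> 1" by (simp add: p_def)
      qed
      \<comment> \<open>This is the logarithm that the power of \<open>ln n\<close> in the bound has
        to absorb. The \<open>r + 1\<close> in place of \<open>r\<close> covers the added 1.\<close>
      have lnE: "ln (real (card E + 1)) \<le> (real r + 1) * L"
      proof -
        have "card E \<le> card {h. h \<subseteq> V \<and> card h = r}" using EV V by (intro card_mono) auto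
        also have "\<dots> = n choose r" using V by (simp add: n_subsets)
        also have "\<dots> \<le> n ^ r"
        proof (cases "r \<le> n")
          case True
          then show ?thesis by (rule binomial_le_pow)
        qed (simp add: binomial_eq_0)
        finally have "card E \<le> n ^ r" .
        moreover have "1 \<le> n ^ r" using n3 by simp
        ultimately have "card E + 1 \<le> n ^ r + n ^ r" by linarith
        also have "\<dots> = 2 * n ^ r" by simp
        also have "\<dots> \<le> n * n ^ r" using n3 by (intro mult_right_mono) auto
        also have "\<dots> = n ^ (r + 1)" by simp
        finally have "real (card E + 1) \<le> real (n ^ (r + 1))" by (rule of_nat_mono)
        then have "real (card E + 1) \<le> real n ^ (r + 1)" by simp
        then have "ln (real (card E + 1)) \<le> ln (real n ^ (r + 1))" using n0 by (subst ln_le_cancel_iff) auto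
        also have "\<dots> = real (r + 1) * L" unfolding L_def by (rule ln_realpow)
        finally show ?thesis by (simp add: add.commute)
      qed
      have count: "real (card \<C>) \<le> exp (L ^ (r - 1) / \<epsilon> * mx)"
      proof -
        have "real (card \<C>) \<le> real ((card E + 1) ^ B)" using C(3) by (rule of_nat_mono)
        also have "\<dots> = exp (real B * ln (real (card E + 1)))" by (simp add: exp_of_nat_mult)
        also have "\<dots> \<le> exp (L ^ (r - 1) / \<epsilon> * mx)"
        proof (subst exp_le_cancel_iff)
          have "real B * ln (real (card E + 1)) \<le> (c * (p * N + 1)) * ((real r + 1) * L)"
            using C(2) lnE c pN by (intro mult_mono) (auto simp: N_def)
          \<comment> \<open>\<open>p * N \<ge> 1\<close> allows the additive 1 to be absorbed by
            doubling.\<close>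
          also have "\<dots> \<le> (c * (2 * mx)) * ((real r + 1) * L)"
            using pN c L1 by (intro mult_right_mono mult_left_mono) auto
          also have "\<dots> = (2 * c * (real r + 1)) * (L * mx)" by simp
          also have "\<dots> \<le> (1 / \<epsilon>) * (L * mx)"
          proof (rule mult_right_mono)
            have "\<epsilon> \<le> 1 / (2 * c * (real r + 1))" by (simp add: \<epsilon>_def)
            then have "\<epsilon> * (2 * c * (real r + 1)) \<le> 1" using c by (simp add: pos_le_divide_eq)
            then show "2 * c * (real r + 1) \<le> 1 / \<epsilon>" using \<epsilon> by (simp add: pos_le_divide_eq mult.commute)
            show "0 \<le> L * mx" using L1 pN by simp
          qed
          also have "\<dots> \<le> (1 / \<epsilon>) * (L ^ (r - 1) * mx)"
          proof (intro mult_left_mono mult_right_mono)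
            have "L ^ 1 \<le> L ^ (r - 1)" using L1 assms by (intro power_increasing) auto
            then show "L \<le> L ^ (r - 1)" by simp
          qed (use pN \<epsilon> in auto)
          finally show "real B * ln (real (card E + 1)) \<le> L ^ (r - 1) / \<epsilon> * mx" by simp
        qed
        finally show ?thesis .
      qed
      show "\<exists>C :: 'a hypergraph set.
          finite C \<and> (\<forall>G \<in> C. subgraph r G H) \<and>
          real (card C) \<le>
            exp (ln (real n) ^ (r - 1) / \<epsilon> *
              max ((t / ln (real n) ^ (r - 2)) powr (- a)
                   * real n powr (1 + 1 / real l))
                  (real n powr (1 + 1 / (2 * real l - 1)))) \<and>
          (\<forall>F. subgraph r F H \<and> berge_free r (2 * l) F \<longrightarrow> (\<exists>G \<in> C. subgraph r F G)) \<and>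
          (\<forall>G \<in> C. real (num_edges G) \<le>
             (1 - \<epsilon> / ln (real n) ^ (r - 2)) * (t * real n powr (1 + 1 / real l)))"
      proof (rule exI[of _ "Hypergraph V ` \<C>"], intro conjI allI impI ballI)
        show "finite (Hypergraph V ` \<C>)" using C(1) by simp
        show "subgraph r G H" if "G \<in> Hypergraph V ` \<C>" for G using that C(4) sub by auto
        have "card (Hypergraph V ` \<C>) \<le> card \<C>" using C(1) by (rule card_image_le)
        then have "real (card (Hypergraph V ` \<C>)) \<le> real (card \<C>)" by (rule of_nat_mono)
        then show "real (card (Hypergraph V ` \<C>)) \<le>
            exp (ln (real n) ^ (r - 1) / \<epsilon> *
              max ((t / ln (real n) ^ (r - 2)) powr (- a)
                   * real n powr (1 + 1 / real l))
                  (real n powr (1 + 1 / (2 * real l - 1))))"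
          using count unfolding mx_def L_def by (rule order_trans)
      next
        fix F assume F: "subgraph r F H \<and> berge_free r (2 * l) F"
        have rF: "r_graph r F" "edges F \<subseteq> E" "verts F \<subseteq> V" using F by (auto simp: subgraph_def E_def V_def)
        have "indep HH' (edges F)"
          unfolding indep_def
        proof
          fix S assume "S \<in> HH'"
          then have S: "is_berge (2 * l) S" using HH'(1) by (auto simp: HH_def)
          show "\<not> S \<subseteq> edges F"
          proof
            assume SF: "S \<subseteq> edges F"
            \<comment> \<open>Keeping the vertex set of \<open>F\<close> makes the Berge cycle a
              literal subgraph of \<open>F\<close>.\<close>
            have r: "r_graph r (Hypergraph (verts F) S)" using rF(1) SF by (auto simp: r_graph_def)
            then have "Hypergraph (verts F) S \<in> berge_cycles r (2 * l)"
              using S by (simp add: berge_cycles_def is_berge_def)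
            moreover have "subgraph r (Hypergraph (verts F) S) F" using r rF(1) SF by (simp add: subgraph_def)
            ultimately show False using F by (auto simp: berge_free_def)
          qed
        qed
        then obtain X where X: "X \<in> \<C>" "edges F \<subseteq> X" using C(5) rF(2) by blast
        have "r_graph r (Hypergraph V X)" using sub X(1) C(4) by (auto simp: subgraph_def)
        then have "subgraph r F (Hypergraph V X)" using rF X(2) by (simp add: subgraph_def)
        then show "\<exists>G\<in>Hypergraph V ` \<C>. subgraph r F G" using X(1) by blast
      next
        fix G assume "G \<in> Hypergraph V ` \<C>"
        then obtain X where X: "G = Hypergraph V X" "X \<in> \<C>" by blast
        have "real (num_edges G) \<le> (1 - \<epsilon>0) * N" using C(4) X by (simp add: num_edges_def N_def)
        also have "\<dots> \<le> (1 - \<epsilon> / ln (real n) ^ (r - 2)) * N"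
        proof (rule mult_right_mono)
          have "\<epsilon> / L ^ (r - 2) \<le> \<epsilon> / 1" using Lp Lpos \<epsilon> by (intro divide_left_mono) auto
          also have "\<dots> \<le> \<epsilon>0" by (simp add: \<epsilon>_def)
          finally show "1 - \<epsilon>0 \<le> 1 - \<epsilon> / ln (real n) ^ (r - 2)" by (simp add: L_def)
        qed (use N0 in simp)
        finally show "real (num_edges G) \<le> (1 - \<epsilon> / ln (real n) ^ (r - 2)) * (t * real n powr (1 + 1 / real l))"
          unfolding N .
      qed
    qed
  qed
qed

end
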